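(* Let $(M,\mathcal{V},P)$ be a Poisson foliation such that $\mathcal{V}$ is orientable and transversally orientable. Then the modular class $\operatorname{Mod}(M,P)\in H^1_P(M)$ of the Poisson manifold $(M,P)$ is related to the foliated modular class $\operatorname{Mod}(M,\mathcal{V},P)$ and the Reeb class $\operatorname{Mod}(\mathcal{V})$ of $\mathcal{V}$ by $$\operatorname{Mod}(M,P)=\operatorname{Mod}(M,\mathcal{V},P)-(P^{\sharp})^{*}\operatorname{Mod}(\mathcal{V}).$$
   Context: Everything is smooth. For a Poisson bivector field $\Pi$ on $M$, $\Pi^\sharp:T^*M\to TM$ is given by $\langle\beta,\Pi^\sharp\alpha\rangle=\Pi(\alpha,\beta)$. $\operatorname{Poiss}(M,\Pi)=\{X\in\mathfrak{X}(M): L_X\Pi=0\}$, $\operatorname{Ham}(M,\Pi)=\{\Pi^\sharp df: f\in C^\infty(M)\}$, $H^1_\Pi(M)=\operatorname{Poiss}(M,\Pi)/\operatorname{Ham}(M,\Pi)$. If $M$ is orientable with volume form $\Omega$, the modular vector field $Z_\Pi^\Omega$ is defined by $Z_\Pi^\Omega(f)=\operatorname{div}^\Omega(\Pi^\sharp df)$; equivalently $-\mathbf{i}_{Z_\Pi^\Omega}\Omega=d\,\mathbf{i}_\Pi\Omega$, where $\mathbf{i}_{X_1\wedge\dots\wedge X_k}=\mathbf{i}_{X_1}\circ\dots\circ\mathbf{i}_{X_k}$. Its class $\operatorname{Mod}(M,\Pi)=[Z_\Pi^\Omega]\in H^1_\Pi(M)$ does not depend on $\Omega$ and is the modular class. Let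 $\mathcal{V}$ be a regular foliation on $M$, $\mathbb{V}=T\mathcal{V}$, $\mathbb{V}^0\subset T^*M$ the annihilator of $\mathbb{V}$, and $d_{\mathcal{V}}$ the foliated exterior derivative on $\Gamma(\wedge^\bullet\mathbb{V}^* )$, with cohomology $H^\bullet_{\operatorname{dR}}(\mathcal{V})$. $\mathcal{V}$ is orientable if there is a nowhere vanishing $\tau\in\Gamma(\wedge^{\operatorname{top}}\mathbb{V}^* )$ (a leaf-wise volume form), and transversally orientable if there is a nowhere vanishing $\varsigma\in\Gamma(\wedge^{\operatorname{top}}\mathbb{V}^0)$ (a transversal volume element). Reeb class: for a transversal volume element $\varsigma$ let $\lambda_\varsigma\in\Gamma(\mathbb{V}^* )$ be defined by $L_X\varsigma=\lambda_\varsigma(X)\varsigma$ for all $X\in\Gamma(\mathbb{V})$. Then $d_{\mathcal V}\lambda_\varsigma=0$ and $\operatorname{Mod}(\mathcal{V}):=[\lambda_\varsigma]\in H^1_{\operatorname{dR}}(\mathcal{V})$ is independent of $\varsigma$. A Poisson foliation $(M,\mathcal{V},P)$ is a regular foliation $\mathcal{V}$ on $M$ with a Poisson bivector field $P\in\Gamma(\wedge^2\mathbb{V})$. Put $\operatorname{Poiss}_{\mathcal{V}}(M,P)=\Gamma(\mathbb{V})\cap\operatorname{Poiss}(M,P)$. For a leaf-wise volume form $\tau$, the modular vector field $Z_P^\tau\in\Gamma(\mathbb{V})$ of the Poisson foliation is defined by $\mathbf{i}_{Z_P^\tau}\tau=-d_{\mathcal{V}}\mathbf{i}_P\tau$. The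 foliated modular class is $\operatorname{Mod}(M,\mathcal{V},P):=[Z_P^\tau]\in\operatorname{Poiss}_{\mathcal{V}}(M,P)/\operatorname{Ham}(M,P)\subset H^1_P(M)$, which is independent of $\tau$. The map $(P^\sharp)^*:H^1_{\operatorname{dR}}(\mathcal{V})\to \operatorname{Poiss}_{\mathcal{V}}(M,P)/\operatorname{Ham}(M,P)\subset H_P^1(M)$ is $[\mu]\mapsto[P^\sharp\mu]$, with $P^\sharp$ regarded as a morphism $\mathbb{V}^*\to\mathbb{V}$. *)

theory Defs
  imports
    "HOL-Analysis.Analysis"
    "HOL-Combinatorics.Permutations"
    "HOL-Library.Function_Algebras"
    "HOL-Algebra.Coset"
begin

section \<open>Smooth maps between open subsets of vector spaces\<close>

text \<open>Meaningful for open \<open>S\<close>: all iterated directional derivatives up to order \<open>k\<close> exist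
  and are continuous.\<close>

primrec Ck_on :: "nat \<Rightarrow> 'e::real_normed_vector set \<Rightarrow> ('e \<Rightarrow> 'f::real_normed_vector) \<Rightarrow> bool" where
  "Ck_on 0 S f \<longleftrightarrow> continuous_on S f"
| "Ck_on (Suc k) S f \<longleftrightarrow> (\<forall>t\<in>S. f differentiable (at t)) \<and>
     (\<forall>v. Ck_on k S (\<lambda>t. frechet_derivative f (at t) v))"

definition smooth_on :: "'e::real_normed_vector set \<Rightarrow> ('e \<Rightarrow> 'f::real_normed_vector) \<Rightarrow> bool" where
  "smooth_on S f \<longleftrightarrow> (\<forall>k. Ck_on k S f)"


section \<open>Smooth manifolds\<close>

text \<open>The manifold is the whole type \<open>'a\<close> (Hausdorff and second countable by its type classes
  in the theorem); its smooth structure is given by an atlas with values in \<open>'e\<close>, so that its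
  dimension is \<open>DIM('e)\<close>.  The coordinate map of a chart is only meaningful on the chart domain.\<close>

record ('a, 'e) chart =
  chart_dom :: "'a set"
  chart_map :: "'a \<Rightarrow> 'e"

definition chart_img :: "('a, 'e) chart \<Rightarrow> 'e set" where
  "chart_img c = chart_map c ` chart_dom c"

definition chart_inv :: "('a, 'e) chart \<Rightarrow> 'e \<Rightarrow> 'a" where
  "chart_inv c = inv_into (chart_dom c) (chart_map c)"

definition is_chart :: "('a::topological_space, 'e::euclidean_space) chart \<Rightarrow> bool" where
  "is_chart c \<longleftrightarrow> open (chart_dom c) \<and> open (chart_img c) \<and>
     homeomorphism (chart_dom c) (chart_img c) (chart_map c) (chart_inv c)"

definition transition :: "('a, 'e) chart \<Rightarrow> ('a, 'e) chart \<Rightarrow> 'e \<Rightarrow> 'e" where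
  "transition c c' = chart_map c' \<circ> chart_inv c"

definition overlap :: "('a, 'e) chart \<Rightarrow> ('a, 'e) chart \<Rightarrow> 'e set" where
  "overlap c c' = chart_map c ` (chart_dom c \<inter> chart_dom c')"

definition compatible :: "('a, 'e::euclidean_space) chart \<Rightarrow> ('a, 'e) chart \<Rightarrow> bool" where
  "compatible c c' \<longleftrightarrow>
     smooth_on (overlap c c') (transition c c') \<and> smooth_on (overlap c' c) (transition c' c)"

definition smooth_atlas :: "('a::topological_space, 'e::euclidean_space) chart set \<Rightarrow> bool" where
  "smooth_atlas A \<longleftrightarrow> (\<forall>c\<in>A. is_chart c) \<and> (\<Union>c\<in>A. chart_dom c) = UNIV \<and>
     (\<forall>c\<in>A. \<forall>c'\<in>A. compatible c c')"

text \<open>One chart \<open>base_chart A x\<close> is chosen around every point \<open>x\<close>, and the tangent space at \<open>x\<close>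
  is the model space \<open>'e\<close>: a vector stands for the tangent vector at \<open>x\<close> having these components
  in \<open>base_chart A x\<close>.  \<open>chart_diff A c x\<close> is the differential at \<open>x\<close> of the chart \<open>c\<close>, that is,
  it gives the components in \<open>c\<close> of a tangent vector at \<open>x\<close>; \<open>chart_frame A c x\<close> is its inverse,
  sending the standard basis of \<open>'e\<close> to the coordinate vectors of \<open>c\<close> at \<open>x\<close>.\<close>

definition base_chart :: "('a, 'e) chart set \<Rightarrow> 'a \<Rightarrow> ('a, 'e) chart" where
  "base_chart A x = (SOME c. c \<in> A \<and> x \<in> chart_dom c)"

definition base_pt :: "('a, 'e) chart set \<Rightarrow> 'a \<Rightarrow> 'e" where
  "base_pt A x = chart_map (base_chart A x) x"

definition chart_diff ::
    "('a, 'e::euclidean_space) chart set \<Rightarrow> ('a, 'e) chart \<Rightarrow> 'a \<Rightarrow> 'e \<Rightarrow> 'e" where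
  "chart_diff A c x = frechet_derivative (transition (base_chart A x) c) (at (base_pt A x))"

definition chart_frame ::
    "('a, 'e::euclidean_space) chart set \<Rightarrow> ('a, 'e) chart \<Rightarrow> 'a \<Rightarrow> 'e \<Rightarrow> 'e" where
  "chart_frame A c x = frechet_derivative (transition c (base_chart A x)) (at (chart_map c x))"


section \<open>Functions, vector fields, bivector fields and forms\<close>

definition smooth_functions :: "('a, 'e::euclidean_space) chart set \<Rightarrow> ('a \<Rightarrow> real) set" where
  "smooth_functions A = {f. \<forall>c\<in>A. smooth_on (chart_img c) (f \<circ> chart_inv c)}"

definition differential ::
    "('a, 'e::euclidean_space) chart set \<Rightarrow> ('a \<Rightarrow> real) \<Rightarrow> 'a \<Rightarrow> 'e \<Rightarrow> real" where
  "differential A f x = frechet_derivative (f \<circ> chart_inv (base_chart A x)) (at (base_pt A x))"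

text \<open>Components of a tensor field in a chart, as functions on the image of the chart.\<close>

definition vec_in ::
    "('a, 'e::euclidean_space) chart set \<Rightarrow> ('a, 'e) chart \<Rightarrow> ('a \<Rightarrow> 'e) \<Rightarrow> 'e \<Rightarrow> 'e" where
  "vec_in A c X t = chart_diff A c (chart_inv c t) (X (chart_inv c t))"

definition form_in ::
    "('a, 'e::euclidean_space) chart set \<Rightarrow> ('a, 'e) chart \<Rightarrow> ('a \<Rightarrow> 'e list \<Rightarrow> real) \<Rightarrow>
     'e list \<Rightarrow> 'e \<Rightarrow> real" where
  "form_in A c \<omega> us t = \<omega> (chart_inv c t) (map (chart_frame A c (chart_inv c t)) us)"

definition bivec_in ::
    "('a, 'e::euclidean_space) chart set \<Rightarrow> ('a, 'e) chart \<Rightarrow>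
     ('a \<Rightarrow> ('e \<Rightarrow> real) \<Rightarrow> ('e \<Rightarrow> real) \<Rightarrow> real) \<Rightarrow> ('e \<Rightarrow> real) \<Rightarrow> ('e \<Rightarrow> real) \<Rightarrow> 'e \<Rightarrow> real" where
  "bivec_in A c P \<alpha> \<beta> t =
     P (chart_inv c t) (\<alpha> \<circ> chart_diff A c (chart_inv c t)) (\<beta> \<circ> chart_diff A c (chart_inv c t))"

definition vector_fields :: "('a, 'e::euclidean_space) chart set \<Rightarrow> ('a \<Rightarrow> 'e) set" where
  "vector_fields A = {X. \<forall>c\<in>A. smooth_on (chart_img c) (vec_in A c X)}"

text \<open>The \<open>k\<close>-linear alternating forms on a linear subspace \<open>S\<close>, extended by zero to all other
  lists so that they are determined by their values on \<open>S\<close>.\<close>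

definition alt_forms :: "nat \<Rightarrow> 'e::euclidean_space set \<Rightarrow> ('e list \<Rightarrow> real) set" where
  "alt_forms k S = {\<omega>.
     (\<forall>vs. length vs = k \<and> set vs \<subseteq> S \<longrightarrow>
        (\<forall>i<k. \<forall>u\<in>S. \<forall>v\<in>S. \<forall>a b.
           \<omega> (vs[i := a *\<^sub>R u + b *\<^sub>R v]) = a * \<omega> (vs[i := u]) + b * \<omega> (vs[i := v])) \<and>
        (\<forall>i<k. \<forall>j<k. i \<noteq> j \<and> vs ! i = vs ! j \<longrightarrow> \<omega> vs = 0)) \<and>
     (\<forall>vs. \<not> (length vs = k \<and> set vs \<subseteq> S) \<longrightarrow> \<omega> vs = 0)}"

definition forms :: "('a, 'e::euclidean_space) chart set \<Rightarrow> nat \<Rightarrow> ('a \<Rightarrow> 'e list \<Rightarrow> real) set" where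
  "forms A k = {\<omega>. (\<forall>x. \<omega> x \<in> alt_forms k UNIV) \<and>
     (\<forall>c\<in>A. \<forall>us. length us = k \<longrightarrow> smooth_on (chart_img c) (form_in A c \<omega> us))}"

definition nowhere_vanishing :: "('a \<Rightarrow> 'e list \<Rightarrow> real) \<Rightarrow> bool" where
  "nowhere_vanishing \<omega> \<longleftrightarrow> (\<forall>x. \<exists>vs. \<omega> x vs \<noteq> 0)"

text \<open>A bivector is given by its values on pairs of covectors, i.e. linear functionals; its values
  on other arguments are irrelevant.  \<open>wedge_sum p ps\<close> says that \<open>p\<close> is the sum of the bivectors
  \<open>X \<and> Y\<close> with \<open>(X, Y)\<close> in \<open>ps\<close>.\<close>

definition wedge_sum ::
    "(('e::euclidean_space \<Rightarrow> real) \<Rightarrow> ('e \<Rightarrow> real) \<Rightarrow> real) \<Rightarrow> ('e \<times> 'e) list \<Rightarrow> bool" where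
  "wedge_sum p ps \<longleftrightarrow> (\<forall>\<alpha> \<beta>. linear \<alpha> \<longrightarrow> linear \<beta> \<longrightarrow>
     p \<alpha> \<beta> = (\<Sum>(X, Y)\<leftarrow>ps. \<alpha> X * \<beta> Y - \<alpha> Y * \<beta> X))"

definition bivectors ::
    "'e::euclidean_space set \<Rightarrow> (('e \<Rightarrow> real) \<Rightarrow> ('e \<Rightarrow> real) \<Rightarrow> real) set" where
  "bivectors S = {p. \<exists>ps. set ps \<subseteq> S \<times> S \<and> wedge_sum p ps}"

definition bivector_fields ::
    "('a, 'e::euclidean_space) chart set \<Rightarrow>
     ('a \<Rightarrow> ('e \<Rightarrow> real) \<Rightarrow> ('e \<Rightarrow> real) \<Rightarrow> real) set" where
  "bivector_fields A = {P. (\<forall>x. P x \<in> bivectors UNIV) \<and>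
     (\<forall>c\<in>A. \<forall>\<alpha> \<beta>. linear \<alpha> \<and> linear \<beta> \<longrightarrow> smooth_on (chart_img c) (bivec_in A c P \<alpha> \<beta>))}"

text \<open>Lie derivatives, computed at \<open>x\<close> in the base chart of \<open>x\<close> by the Leibniz rule
  \<open>(L\<^sub>X \<omega>)(Y\<^sub>1, \<dots>, Y\<^sub>k) = X (\<omega>(Y\<^sub>1, \<dots>, Y\<^sub>k)) - (\<Sum>i. \<omega>(Y\<^sub>1, \<dots>, [X, Y\<^sub>i], \<dots>, Y\<^sub>k))\<close> for fields \<open>Y\<^sub>i\<close> with
  constant components, so that \<open>[X, Y\<^sub>i]\<close> is minus the derivative of \<open>X\<close> along \<open>Y\<^sub>i\<close>, respectively
  \<open>(L\<^sub>X P)(\<alpha>, \<beta>) = X (P(\<alpha>, \<beta>)) - P(L\<^sub>X \<alpha>, \<beta>) - P(\<alpha>, L\<^sub>X \<beta>)\<close> for \<open>\<alpha>\<close>, \<open>\<beta>\<close> with constant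
  components.\<close>

definition lie_form ::
    "('a, 'e::euclidean_space) chart set \<Rightarrow> ('a \<Rightarrow> 'e) \<Rightarrow> ('a \<Rightarrow> 'e list \<Rightarrow> real) \<Rightarrow>
     'a \<Rightarrow> 'e list \<Rightarrow> real" where
  "lie_form A X \<omega> x vs =
     (let c = base_chart A x; t = base_pt A x; DX = frechet_derivative (vec_in A c X) (at t)
      in frechet_derivative (form_in A c \<omega> vs) (at t) (X x) +
         (\<Sum>i<length vs. \<omega> x (vs[i := DX (vs ! i)])))"

definition lie_bivec ::
    "('a, 'e::euclidean_space) chart set \<Rightarrow> ('a \<Rightarrow> 'e) \<Rightarrow>
     ('a \<Rightarrow> ('e \<Rightarrow> real) \<Rightarrow> ('e \<Rightarrow> real) \<Rightarrow> real) \<Rightarrow> 'a \<Rightarrow> ('e \<Rightarrow> real) \<Rightarrow> ('e \<Rightarrow> real) \<Rightarrow> real" where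
  "lie_bivec A X P x \<alpha> \<beta> =
     (let c = base_chart A x; t = base_pt A x; DX = frechet_derivative (vec_in A c X) (at t)
      in frechet_derivative (bivec_in A c P \<alpha> \<beta>) (at t) (X x) -
         P x (\<alpha> \<circ> DX) \<beta> - P x \<alpha> (\<beta> \<circ> DX))"


section \<open>Poisson manifolds and the modular class\<close>

definition bracket ::
    "('a, 'e::euclidean_space) chart set \<Rightarrow> ('a \<Rightarrow> ('e \<Rightarrow> real) \<Rightarrow> ('e \<Rightarrow> real) \<Rightarrow> real) \<Rightarrow>
     ('a \<Rightarrow> real) \<Rightarrow> ('a \<Rightarrow> real) \<Rightarrow> 'a \<Rightarrow> real" where
  "bracket A P f g x = P x (differential A f x) (differential A g x)"

definition poisson_bivector ::
    "('a, 'e::euclidean_space) chart set \<Rightarrow> ('a \<Rightarrow> ('e \<Rightarrow> real) \<Rightarrow> ('e \<Rightarrow> real) \<Rightarrow> real) \<Rightarrow> bool" where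
  "poisson_bivector A P \<longleftrightarrow> P \<in> bivector_fields A \<and>
     (\<forall>f\<in>smooth_functions A. \<forall>g\<in>smooth_functions A. \<forall>h\<in>smooth_functions A. \<forall>x.
        bracket A P f (bracket A P g h) x + bracket A P g (bracket A P h f) x +
        bracket A P h (bracket A P f g) x = 0)"

definition sharp ::
    "(('e::euclidean_space \<Rightarrow> real) \<Rightarrow> ('e \<Rightarrow> real) \<Rightarrow> real) \<Rightarrow> ('e \<Rightarrow> real) \<Rightarrow> 'e" where
  "sharp p \<alpha> = (THE v. \<forall>\<beta>. linear \<beta> \<longrightarrow> \<beta> v = p \<alpha> \<beta>)"

definition ham_field ::
    "('a, 'e::euclidean_space) chart set \<Rightarrow> ('a \<Rightarrow> ('e \<Rightarrow> real) \<Rightarrow> ('e \<Rightarrow> real) \<Rightarrow> real) \<Rightarrow>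
     ('a \<Rightarrow> real) \<Rightarrow> 'a \<Rightarrow> 'e" where
  "ham_field A P f x = sharp (P x) (differential A f x)"

definition Ham ::
    "('a, 'e::euclidean_space) chart set \<Rightarrow> ('a \<Rightarrow> ('e \<Rightarrow> real) \<Rightarrow> ('e \<Rightarrow> real) \<Rightarrow> real) \<Rightarrow>
     ('a \<Rightarrow> 'e) set" where
  "Ham A P = ham_field A P ` smooth_functions A"

definition Poiss ::
    "('a, 'e::euclidean_space) chart set \<Rightarrow> ('a \<Rightarrow> ('e \<Rightarrow> real) \<Rightarrow> ('e \<Rightarrow> real) \<Rightarrow> real) \<Rightarrow>
     ('a \<Rightarrow> 'e) set" where
  "Poiss A P = {X \<in> vector_fields A.
     \<forall>x \<alpha> \<beta>. linear \<alpha> \<longrightarrow> linear \<beta> \<longrightarrow> lie_bivec A X P x \<alpha> \<beta> = 0}"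

text \<open>Additive groups of tensor fields, in the form required by the quotient construction of
  the algebra library.\<close>

definition add_group :: "'b::ab_group_add set \<Rightarrow> 'b monoid" where
  "add_group C = \<lparr>carrier = C, monoid.mult = (+), one = 0\<rparr>"

definition H1_poisson ::
    "('a, 'e::euclidean_space) chart set \<Rightarrow> ('a \<Rightarrow> ('e \<Rightarrow> real) \<Rightarrow> ('e \<Rightarrow> real) \<Rightarrow> real) \<Rightarrow>
     ('a \<Rightarrow> 'e) set monoid" where
  "H1_poisson A P = add_group (Poiss A P) Mod Ham A P"

definition poisson_class ::
    "('a, 'e::euclidean_space) chart set \<Rightarrow> ('a \<Rightarrow> ('e \<Rightarrow> real) \<Rightarrow> ('e \<Rightarrow> real) \<Rightarrow> real) \<Rightarrow>
     ('a \<Rightarrow> 'e) \<Rightarrow> ('a \<Rightarrow> 'e) set" where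
  "poisson_class A P X = Ham A P #>\<^bsub>add_group (Poiss A P)\<^esub> X"

definition volume_forms ::
    "('a, 'e::euclidean_space) chart set \<Rightarrow> ('a \<Rightarrow> 'e list \<Rightarrow> real) set" where
  "volume_forms A = {\<Omega> \<in> forms A DIM('e). nowhere_vanishing \<Omega>}"

definition divergence ::
    "('a, 'e::euclidean_space) chart set \<Rightarrow> ('a \<Rightarrow> 'e list \<Rightarrow> real) \<Rightarrow> ('a \<Rightarrow> 'e) \<Rightarrow> 'a \<Rightarrow> real" where
  "divergence A \<Omega> X = (THE g. \<forall>x vs. lie_form A X \<Omega> x vs = g x * \<Omega> x vs)"

definition modular_field ::
    "('a, 'e::euclidean_space) chart set \<Rightarrow> ('a \<Rightarrow> ('e \<Rightarrow> real) \<Rightarrow> ('e \<Rightarrow> real) \<Rightarrow> real) \<Rightarrow>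
     ('a \<Rightarrow> 'e list \<Rightarrow> real) \<Rightarrow> 'a \<Rightarrow> 'e" where
  "modular_field A P \<Omega> = (THE Z. Z \<in> vector_fields A \<and>
     (\<forall>f\<in>smooth_functions A. \<forall>x. differential A f x (Z x) = divergence A \<Omega> (ham_field A P f) x))"

text \<open>Here and below, a class that does not depend on some choice is the unique element of the
  set of classes obtained from all choices.\<close>

definition modular_class ::
    "('a, 'e::euclidean_space) chart set \<Rightarrow> ('a \<Rightarrow> ('e \<Rightarrow> real) \<Rightarrow> ('e \<Rightarrow> real) \<Rightarrow> real) \<Rightarrow>
     ('a \<Rightarrow> 'e) set" where
  "modular_class A P = the_elem ((\<lambda>\<Omega>. poisson_class A P (modular_field A P \<Omega>)) ` volume_forms A)"


section \<open>Regular foliations\<close>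

text \<open>A regular foliation is given by a foliated atlas: charts of the smooth structure whose
  transition maps locally preserve the partition of the model space into the translates of a
  fixed linear subspace \<open>leaf_dir\<close>.  In every chart the leaves are locally these translates; the
  leaf dimension is the dimension of \<open>leaf_dir\<close> (0 and \<open>DIM('e)\<close> are allowed).\<close>

record ('a, 'e) foliation =
  leaf_dir :: "'e set"
  fol_charts :: "('a, 'e) chart set"

definition regular_foliation ::
    "('a::topological_space, 'e::euclidean_space) chart set \<Rightarrow> ('a, 'e) foliation \<Rightarrow> bool" where
  "regular_foliation A \<V> \<longleftrightarrow> subspace (leaf_dir \<V>) \<and>
     (\<forall>c\<in>fol_charts \<V>. is_chart c \<and> (\<forall>c'\<in>A. compatible c c')) \<and>
     (\<Union>c\<in>fol_charts \<V>. chart_dom c) = UNIV \<and>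
     (\<forall>c\<in>fol_charts \<V>. \<forall>c'\<in>fol_charts \<V>. \<forall>t\<in>overlap c c'.
        \<exists>N\<subseteq>overlap c c'. open N \<and> t \<in> N \<and>
          (\<forall>s\<in>N. \<forall>s'\<in>N. s - s' \<in> leaf_dir \<V> \<longrightarrow>
             transition c c' s - transition c c' s' \<in> leaf_dir \<V>))"

definition tangent_dist ::
    "('a, 'e::euclidean_space) chart set \<Rightarrow> ('a, 'e) foliation \<Rightarrow> 'a \<Rightarrow> 'e set" where
  "tangent_dist A \<V> x =
     {v. \<exists>c\<in>fol_charts \<V>. x \<in> chart_dom c \<and> chart_diff A c x v \<in> leaf_dir \<V>}"

definition tangent_fields ::
    "('a, 'e::euclidean_space) chart set \<Rightarrow> ('a, 'e) foliation \<Rightarrow> ('a \<Rightarrow> 'e) set" where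
  "tangent_fields A \<V> = {X \<in> vector_fields A. \<forall>x. X x \<in> tangent_dist A \<V> x}"

definition fol_forms ::
    "('a, 'e::euclidean_space) chart set \<Rightarrow> ('a, 'e) foliation \<Rightarrow> nat \<Rightarrow>
     ('a \<Rightarrow> 'e list \<Rightarrow> real) set" where
  "fol_forms A \<V> k = {\<omega>. (\<forall>x. \<omega> x \<in> alt_forms k (tangent_dist A \<V> x)) \<and>
     (\<forall>c\<in>fol_charts \<V>. \<forall>us. length us = k \<and> set us \<subseteq> leaf_dir \<V> \<longrightarrow>
        smooth_on (chart_img c) (form_in A c \<omega> us))}"

text \<open>The foliated exterior derivative, computed at \<open>x\<close> in a foliated chart by the Koszul formula
  for commuting tangent fields with constant components.\<close>

definition fol_d ::
    "('a, 'e::euclidean_space) chart set \<Rightarrow> ('a, 'e) foliation \<Rightarrow> ('a \<Rightarrow> 'e list \<Rightarrow> real) \<Rightarrow>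
     'a \<Rightarrow> 'e list \<Rightarrow> real" where
  "fol_d A \<V> \<omega> x vs =
     (if set vs \<subseteq> tangent_dist A \<V> x then
        let c = (SOME c. c \<in> fol_charts \<V> \<and> x \<in> chart_dom c);
            us = map (chart_diff A c x) vs
        in (\<Sum>i<length vs. (-1) ^ i *
              frechet_derivative (form_in A c \<omega> (take i us @ drop (Suc i) us))
                (at (chart_map c x)) (us ! i))
      else 0)"

definition fol_closed1 ::
    "('a, 'e::euclidean_space) chart set \<Rightarrow> ('a, 'e) foliation \<Rightarrow> ('a \<Rightarrow> 'e list \<Rightarrow> real) set" where
  "fol_closed1 A \<V> = {\<mu> \<in> fol_forms A \<V> 1. fol_d A \<V> \<mu> = 0}"

definition fol_exact1 ::
    "('a, 'e::euclidean_space) chart set \<Rightarrow> ('a, 'e) foliation \<Rightarrow> ('a \<Rightarrow> 'e list \<Rightarrow> real) set" where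
  "fol_exact1 A \<V> = fol_d A \<V> ` fol_forms A \<V> 0"

definition H1_foliated ::
    "('a, 'e::euclidean_space) chart set \<Rightarrow> ('a, 'e) foliation \<Rightarrow>
     ('a \<Rightarrow> 'e list \<Rightarrow> real) set monoid" where
  "H1_foliated A \<V> = add_group (fol_closed1 A \<V>) Mod fol_exact1 A \<V>"

definition fol_class ::
    "('a, 'e::euclidean_space) chart set \<Rightarrow> ('a, 'e) foliation \<Rightarrow> ('a \<Rightarrow> 'e list \<Rightarrow> real) \<Rightarrow>
     ('a \<Rightarrow> 'e list \<Rightarrow> real) set" where
  "fol_class A \<V> \<mu> = fol_exact1 A \<V> #>\<^bsub>add_group (fol_closed1 A \<V>)\<^esub> \<mu>"

definition leaf_volume_forms ::
    "('a, 'e::euclidean_space) chart set \<Rightarrow> ('a, 'e) foliation \<Rightarrow> ('a \<Rightarrow> 'e list \<Rightarrow> real) set" where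
  "leaf_volume_forms A \<V> = {\<tau> \<in> fol_forms A \<V> (dim (leaf_dir \<V>)). nowhere_vanishing \<tau>}"

text \<open>The exterior power of order \<open>k\<close> of a space \<open>N\<close> of covectors, as the span of the exterior
  products of elements of \<open>N\<close>.\<close>

definition wedge_covectors :: "('e \<Rightarrow> real) list \<Rightarrow> 'e list \<Rightarrow> real" where
  "wedge_covectors \<alpha>s vs =
     (if length vs = length \<alpha>s then
        (\<Sum>\<sigma> | \<sigma> permutes {..<length \<alpha>s}.
           of_int (sign \<sigma>) * (\<Prod>i<length \<alpha>s. (\<alpha>s ! i) (vs ! \<sigma> i)))
      else 0)"

definition ext_power :: "nat \<Rightarrow> ('e \<Rightarrow> real) set \<Rightarrow> ('e list \<Rightarrow> real) set" where
  "ext_power k N = {\<omega>. \<exists>ws. (\<forall>(a, \<alpha>s)\<in>set ws. length \<alpha>s = k \<and> set \<alpha>s \<subseteq> N) \<and>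
     (\<forall>vs. \<omega> vs = (\<Sum>(a, \<alpha>s)\<leftarrow>ws. a * wedge_covectors \<alpha>s vs))}"

definition annihilator ::
    "('a, 'e::euclidean_space) chart set \<Rightarrow> ('a, 'e) foliation \<Rightarrow> 'a \<Rightarrow> ('e \<Rightarrow> real) set" where
  "annihilator A \<V> x = {\<alpha>. linear \<alpha> \<and> (\<forall>v\<in>tangent_dist A \<V> x. \<alpha> v = 0)}"

definition transversal_volumes ::
    "('a, 'e::euclidean_space) chart set \<Rightarrow> ('a, 'e) foliation \<Rightarrow> ('a \<Rightarrow> 'e list \<Rightarrow> real) set" where
  "transversal_volumes A \<V> = {\<sigma> \<in> forms A (DIM('e) - dim (leaf_dir \<V>)).
     (\<forall>x. \<sigma> x \<in> ext_power (DIM('e) - dim (leaf_dir \<V>)) (annihilator A \<V> x)) \<and>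
     nowhere_vanishing \<sigma>}"

definition fol_orientable ::
    "('a, 'e::euclidean_space) chart set \<Rightarrow> ('a, 'e) foliation \<Rightarrow> bool" where
  "fol_orientable A \<V> \<longleftrightarrow> leaf_volume_forms A \<V> \<noteq> {}"

definition transversally_orientable ::
    "('a, 'e::euclidean_space) chart set \<Rightarrow> ('a, 'e) foliation \<Rightarrow> bool" where
  "transversally_orientable A \<V> \<longleftrightarrow> transversal_volumes A \<V> \<noteq> {}"

definition reeb_form ::
    "('a, 'e::euclidean_space) chart set \<Rightarrow> ('a, 'e) foliation \<Rightarrow> ('a \<Rightarrow> 'e list \<Rightarrow> real) \<Rightarrow>
     'a \<Rightarrow> 'e list \<Rightarrow> real" where
  "reeb_form A \<V> \<sigma> = (THE \<mu>. \<mu> \<in> fol_forms A \<V> 1 \<and>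
     (\<forall>X\<in>tangent_fields A \<V>. \<forall>x vs. lie_form A X \<sigma> x vs = \<mu> x [X x] * \<sigma> x vs))"

definition reeb_class ::
    "('a, 'e::euclidean_space) chart set \<Rightarrow> ('a, 'e) foliation \<Rightarrow>
     ('a \<Rightarrow> 'e list \<Rightarrow> real) set" where
  "reeb_class A \<V> = the_elem ((\<lambda>\<sigma>. fol_class A \<V> (reeb_form A \<V> \<sigma>)) ` transversal_volumes A \<V>)"


section \<open>Poisson foliations\<close>

definition poisson_foliation ::
    "('a::topological_space, 'e::euclidean_space) chart set \<Rightarrow> ('a, 'e) foliation \<Rightarrow>
     ('a \<Rightarrow> ('e \<Rightarrow> real) \<Rightarrow> ('e \<Rightarrow> real) \<Rightarrow> real) \<Rightarrow> bool" where
  "poisson_foliation A \<V> P \<longleftrightarrow> smooth_atlas A \<and> regular_foliation A \<V> \<and>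
     poisson_bivector A P \<and> (\<forall>x. P x \<in> bivectors (tangent_dist A \<V> x))"

definition interior_prod ::
    "('a \<Rightarrow> 'e) \<Rightarrow> ('a \<Rightarrow> 'e list \<Rightarrow> real) \<Rightarrow> 'a \<Rightarrow> 'e list \<Rightarrow> real" where
  "interior_prod X \<omega> x vs = \<omega> x (X x # vs)"

text \<open>Interior product with a bivector: \<open>i\<^bsub>X \<and> Y\<^esub> = i\<^sub>X \<circ> i\<^sub>Y\<close>, hence \<open>Y\<close> is inserted first.\<close>

definition fol_interior_bivec ::
    "('a, 'e::euclidean_space) chart set \<Rightarrow> ('a, 'e) foliation \<Rightarrow>
     ('a \<Rightarrow> ('e \<Rightarrow> real) \<Rightarrow> ('e \<Rightarrow> real) \<Rightarrow> real) \<Rightarrow> ('a \<Rightarrow> 'e list \<Rightarrow> real) \<Rightarrow>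
     'a \<Rightarrow> 'e list \<Rightarrow> real" where
  "fol_interior_bivec A \<V> P \<omega> x vs = (THE r. \<exists>ps.
     set ps \<subseteq> tangent_dist A \<V> x \<times> tangent_dist A \<V> x \<and> wedge_sum (P x) ps \<and>
     r = (\<Sum>(X, Y)\<leftarrow>ps. \<omega> x (Y # X # vs)))"

definition fol_modular_field ::
    "('a, 'e::euclidean_space) chart set \<Rightarrow> ('a, 'e) foliation \<Rightarrow>
     ('a \<Rightarrow> ('e \<Rightarrow> real) \<Rightarrow> ('e \<Rightarrow> real) \<Rightarrow> real) \<Rightarrow> ('a \<Rightarrow> 'e list \<Rightarrow> real) \<Rightarrow> 'a \<Rightarrow> 'e" where
  "fol_modular_field A \<V> P \<tau> =
     (THE Z. Z \<in> tangent_fields A \<V> \<and> interior_prod Z \<tau> = - fol_d A \<V> (fol_interior_bivec A \<V> P \<tau>))"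

text \<open>The quotient of the Poisson fields tangent to the foliation by \<open>Ham A P\<close> is the subset of
  \<open>H1_poisson A P\<close> formed by the cosets of these fields.\<close>

definition fol_modular_class ::
    "('a, 'e::euclidean_space) chart set \<Rightarrow> ('a, 'e) foliation \<Rightarrow>
     ('a \<Rightarrow> ('e \<Rightarrow> real) \<Rightarrow> ('e \<Rightarrow> real) \<Rightarrow> real) \<Rightarrow> ('a \<Rightarrow> 'e) set" where
  "fol_modular_class A \<V> P =
     the_elem ((\<lambda>\<tau>. poisson_class A P (fol_modular_field A \<V> P \<tau>)) ` leaf_volume_forms A \<V>)"

text \<open>A foliated 1-form is only defined on tangent vectors of the leaves; \<open>P x\<close> is applied to any
  of its linear extensions.\<close>

definition fol_sharp ::
    "('a, 'e::euclidean_space) chart set \<Rightarrow> ('a, 'e) foliation \<Rightarrow>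
     ('a \<Rightarrow> ('e \<Rightarrow> real) \<Rightarrow> ('e \<Rightarrow> real) \<Rightarrow> real) \<Rightarrow> ('a \<Rightarrow> 'e list \<Rightarrow> real) \<Rightarrow> 'a \<Rightarrow> 'e" where
  "fol_sharp A \<V> P \<mu> x = (THE w. \<forall>\<alpha>. linear \<alpha> \<and> (\<forall>v\<in>tangent_dist A \<V> x. \<alpha> v = \<mu> x [v]) \<longrightarrow>
     w = sharp (P x) \<alpha>)"

text \<open>The induced map on classes, from \<open>H1_foliated A \<V>\<close> to \<open>H1_poisson A P\<close>.\<close>

definition sharp_map ::
    "('a, 'e::euclidean_space) chart set \<Rightarrow> ('a, 'e) foliation \<Rightarrow>
     ('a \<Rightarrow> ('e \<Rightarrow> real) \<Rightarrow> ('e \<Rightarrow> real) \<Rightarrow> real) \<Rightarrow>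
     ('a \<Rightarrow> 'e list \<Rightarrow> real) set \<Rightarrow> ('a \<Rightarrow> 'e) set" where
  "sharp_map A \<V> P C = the_elem ((\<lambda>\<mu>. poisson_class A P (fol_sharp A \<V> P \<mu>)) ` C)"

end

theory Submission
  imports Defs
begin

text \<open>Everything is compared in the charts of the foliation.  With foliated coordinates \<open>x\<^sub>i\<close> along
  the leaves, \<open>\<tau> = \<rho> dx\<^sub>1 \<and> \<dots> \<and> dx\<^sub>p\<close> and \<open>\<sigma> = s dx\<^sub>p\<^sub>+\<^sub>1 \<and> \<dots> \<and> dx\<^sub>n\<close>, the modular vector field of
  \<open>\<Omega> = \<tau> \<and> \<sigma>\<close> has the components \<open>\<Sum>\<^sub>j \<partial>\<^sub>j (\<rho> s P\<^sub>i\<^sub>j) / (\<rho> s)\<close>, that of the Poisson foliation the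
  components \<open>\<Sum>\<^sub>j \<partial>\<^sub>j (\<rho> P\<^sub>i\<^sub>j) / \<rho>\<close>, and the Reeb form is \<open>d\<^sub>\<V> ln \<bar>s\<bar>\<close>; the difference of the two fields
  is \<open>\<Sum>\<^sub>j P\<^sub>i\<^sub>j \<partial>\<^sub>j ln \<bar>s\<bar>\<close>, the component of \<open>-P\<^sup>\<sharp> \<lambda>\<close>.  So already the representatives satisfy the relation for every
  choice of \<open>\<tau>\<close> and \<open>\<sigma>\<close>, and the independence of the foliated modular class of \<open>\<tau>\<close> follows from that
  of the modular class of \<open>\<Omega>\<close>.  The Reeb form is locally exact, hence \<open>P\<^sup>\<sharp> \<lambda>\<close> is locally Hamiltonian and
  in particular a Poisson vector field, so that its class is invertible in the quotient group.\<close>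

text \<open>Two features of the definitions shape most of the work. Tangent spaces are identified
  with the model space through \<open>base_chart\<close>, which jumps from point to point, so
  smoothness and Lie derivatives become usable only after being rewritten in one fixed chart;
  foliated charts are merely compatible with \<open>A\<close>, so the rewriting is done for all
  \<open>admissible\<close> charts. And divergence, modular field, Reeb form and foliated modular
  field are definite descriptions, each needing a solution and its uniqueness. Uniqueness rests on
  enough global objects: bump functions extend germs of functions and tangent vectors to the whole
  manifold. Existence of the foliated modular field is read off from the relation itself: the
  modular field of \<tau> \<and> \<sigma> plus the sharp of the Reeb form is the candidate, smooth
  at once, and the chart formula then shows that it is tangent and has the right interior product
  with \<tau>. The form \<tau> \<and> \<sigma> makes sense although \<tau> is given on leaf vectors
  only, because changes of foliated charts preserve the leaf direction and their determinants
  split.\<close>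

abbreviation fd :: "('e::real_normed_vector \<Rightarrow> 'f::real_normed_vector) \<Rightarrow> 'e \<Rightarrow> 'e \<Rightarrow> 'f" where
  "fd f t \<equiv> frechet_derivative f (at t)"

lemma fd_eqI: "(f has_derivative f') (at t) \<Longrightarrow> fd f t = f'"
  by (rule frechet_derivative_at [symmetric])

text \<open>Coordinate expressions agree only near the point under study, so derivatives are always
  transported along equality of germs; \<open>nhds\<close> includes the value at \<open>t\<close>
  itself.\<close>

lemma has_derivative_cong_nhds:
  assumes "\<forall>\<^sub>F s in nhds t. f s = g s" "(f has_derivative f') (at t)"
  shows "(g has_derivative f') (at t)"
proof -
  obtain U where "open U" "t \<in> U" "\<And>s. s \<in> U \<Longrightarrow> f s = g s"
    using assms(1) by (auto simp: eventually_nhds)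
  then show ?thesis
    using has_derivative_transform_within_open [OF assms(2)] by blast
qed

text \<open>Holds even where nothing is differentiable: functions with the same germ have the same
  derivatives, and \<open>frechet_derivative\<close> chooses among these.\<close>

lemma fd_cong:
  assumes "\<forall>\<^sub>F s in nhds t. f s = g s"
  shows "fd f t = fd g t"
proof -
  have "\<forall>\<^sub>F s in nhds t. g s = f s" using assms by (simp add: eq_commute)
  then have "(f has_derivative f') (at t) = (g has_derivative f') (at t)" for f'
    using has_derivative_cong_nhds assms by blast
  then show ?thesis by (simp add: frechet_derivative_def)
qed

subsection \<open>Functions of class \<open>C\<^sup>k\<close>\<close>

lemma Ck_on_subset: "Ck_on k S f \<Longrightarrow> T \<subseteq> S \<Longrightarrow> Ck_on k T f"
  by (induction k arbitrary: f) (auto intro: continuous_on_subset)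

lemma Ck_on_Suc_has_derivative:
  "Ck_on (Suc k) S f \<Longrightarrow> t \<in> S \<Longrightarrow> (f has_derivative fd f t) (at t)"
  by (simp add: frechet_derivative_works [symmetric])

lemma Ck_on_cong:
  assumes "open S" "\<And>t. t \<in> S \<Longrightarrow> f t = g t" "Ck_on k S f"
  shows "Ck_on k S g"
  using assms
proof (induction k arbitrary: f g)
  case 0
  then show ?case by (metis Ck_on.simps(1) continuous_on_cong)
next
  case (Suc k)
  have ev: "\<forall>\<^sub>F s in nhds t. f s = g s" if "t \<in> S" for t
    using Suc.prems that by (auto simp: eventually_nhds)
  have "g differentiable at t" if "t \<in> S" for t
    using has_derivative_cong_nhds [OF ev [OF that] Ck_on_Suc_has_derivative [OF Suc.prems(3) that]]
    by (auto simp: differentiable_def)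
  moreover have "Ck_on k S (\<lambda>t. fd g t v)" for v
    by (rule Suc.IH [where f = "\<lambda>t. fd f t v"]) (use Suc.prems fd_cong [OF ev] in auto)
  ultimately show ?case by simp
qed

lemma Ck_on_Suc_imp: "Ck_on (Suc k) S f \<Longrightarrow> Ck_on k S f"
proof (induction k arbitrary: f)
  case 0
  then show ?case
    by (auto intro!: continuous_at_imp_continuous_on differentiable_imp_continuous_within)
next
  case (Suc k)
  then show ?case by simp
qed

lemma Ck_on_SucI:
  assumes "open S" "\<And>t. t \<in> S \<Longrightarrow> (f has_derivative f' t) (at t)"
    and "\<And>v. Ck_on k S (\<lambda>t. f' t v)"
  shows "Ck_on (Suc k) S f"
proof -
  have "Ck_on k S (\<lambda>t. fd f t v)" for v
    by (rule Ck_on_cong [OF assms(1) _ assms(3)]) (use fd_eqI [OF assms(2)] in auto)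
  then show ?thesis using assms(2) by (auto simp: differentiable_def)
qed

lemma Ck_on_local:
  assumes "\<And>t. t \<in> S \<Longrightarrow> \<exists>U. open U \<and> t \<in> U \<and> Ck_on k U f"
  shows "Ck_on k S f"
  using assms
proof (induction k arbitrary: f)
  case 0
  have "continuous (at t within S) f" if t: "t \<in> S" for t
  proof -
    obtain U where "open U" "t \<in> U" "continuous_on U f"
      using "0"[OF t] by auto
    then have "isCont f t" by (simp add: continuous_on_eq_continuous_at)
    then show ?thesis by (rule continuous_at_imp_continuous_at_within)
  qed
  then show ?case by (simp add: continuous_on_eq_continuous_within)
next
  case (Suc k)
  have "f differentiable at t" if "t \<in> S" for t using Suc.prems [OF that] by auto
  moreover have "Ck_on k S (\<lambda>t. fd f t v)" for v
    by (rule Suc.IH) (use Suc.prems in fastforce)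
  ultimately show ?case by simp
qed

lemma Ck_on_const: "Ck_on k S (\<lambda>t. c)"
  by (induction k arbitrary: c) auto

lemma Ck_on_bounded_linear:
  assumes L: "bounded_linear L" and "open S" "Ck_on k S f"
  shows "Ck_on k S (\<lambda>t. L (f t))"
  using assms(2,3)
proof (induction k arbitrary: f)
  case 0
  then show ?case by (simp add: bounded_linear.continuous_on [OF L])
next
  case (Suc k)
  show ?case
  proof (rule Ck_on_SucI [where f' = "\<lambda>t v. L (fd f t v)"])
    show "((\<lambda>t. L (f t)) has_derivative (\<lambda>v. L (fd f t v))) (at t)" if "t \<in> S" for t
      using bounded_linear.has_derivative [OF L Ck_on_Suc_has_derivative [OF Suc.prems(2) that]] .
  qed (use Suc in auto)
qed

lemma Ck_on_add:
  assumes "open S" "Ck_on k S f" "Ck_on k S g"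
  shows "Ck_on k S (\<lambda>t. f t + g t)"
  using assms
proof (induction k arbitrary: f g)
  case 0
  then show ?case by (simp add: continuous_on_add)
next
  case (Suc k)
  show ?case
  proof (rule Ck_on_SucI [where f' = "\<lambda>t v. fd f t v + fd g t v"])
    show "((\<lambda>t. f t + g t) has_derivative (\<lambda>v. fd f t v + fd g t v)) (at t)" if "t \<in> S" for t
      by (rule has_derivative_add [OF Ck_on_Suc_has_derivative [OF Suc.prems(2) that]
            Ck_on_Suc_has_derivative [OF Suc.prems(3) that]])
  qed (use Suc in auto)
qed

text \<open>The Leibniz rule leaves products of one factor with a derivative of the other, so the
  induction runs over both factors at once. Products, scalings and inner products are the
  instances.\<close>

lemma Ck_on_bilinear:
  assumes B: "bounded_bilinear B" and "open S" "Ck_on k S f" "Ck_on k S g"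
  shows "Ck_on k S (\<lambda>t. B (f t) (g t))"
  using assms(2-)
proof (induction k arbitrary: f g)
  case 0
  then show ?case by (simp add: bounded_bilinear.continuous_on [OF B])
next
  case (Suc k)
  show ?case
  proof (rule Ck_on_SucI [where f' = "\<lambda>t v. B (f t) (fd g t v) + B (fd f t v) (g t)"])
    show "((\<lambda>t. B (f t) (g t)) has_derivative (\<lambda>v. B (f t) (fd g t v) + B (fd f t v) (g t))) (at t)"
      if "t \<in> S" for t
      by (rule bounded_bilinear.FDERIV [OF B Ck_on_Suc_has_derivative [OF Suc.prems(2) that]
            Ck_on_Suc_has_derivative [OF Suc.prems(3) that]])
    show "Ck_on k S (\<lambda>t. B (f t) (fd g t v) + B (fd f t v) (g t))" for v
      using Suc.prems Ck_on_Suc_imp [OF Suc.prems(2)] Ck_on_Suc_imp [OF Suc.prems(3)]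
      by (intro Ck_on_add Suc.IH) simp_all
  qed (use Suc in auto)
qed

lemma Ck_on_sum:
  assumes "open S" "\<And>i. i \<in> I \<Longrightarrow> Ck_on k S (f i)"
  shows "Ck_on k S (\<lambda>t. \<Sum>i\<in>I. f i t)"
  using assms by (induction I rule: infinite_finite_induct) (auto intro: Ck_on_const Ck_on_add)

lemma Ck_on_ident: "open S \<Longrightarrow> Ck_on k S (\<lambda>t. t)"
proof (cases k)
  case (Suc k')
  then show "open S \<Longrightarrow> ?thesis"
    by (auto intro!: Ck_on_SucI [where f' = "\<lambda>t v. v"] Ck_on_const)
qed auto

text \<open>In the chain rule both the base point and the vector fed to the derivative of
  \<open>g\<close> depend on \<open>t\<close>. Expanding the vector in \<open>Basis\<close>
  separates them, so that the induction hypothesis applies to \<open>g\<close> differentiated along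
  a fixed \<open>b\<close>.\<close>

lemma Ck_on_compose:
  fixes f :: "'a::real_normed_vector \<Rightarrow> 'b::euclidean_space"
  assumes "open S" "open T" "Ck_on k S f" "Ck_on k T g" "f ` S \<subseteq> T"
  shows "Ck_on k S (\<lambda>t. g (f t))"
  using assms
proof (induction k arbitrary: g)
  case 0
  then show ?case by (auto intro: continuous_on_compose2)
next
  case (Suc k)
  have fT: "f t \<in> T" if "t \<in> S" for t using Suc.prems that by auto
  show ?case
  proof (rule Ck_on_SucI [where f' = "\<lambda>t v. \<Sum>b\<in>Basis. (fd f t v \<bullet> b) *\<^sub>R fd g (f t) b"])
    fix t assume t: "t \<in> S"
    have dg: "(g has_derivative fd g (f t)) (at (f t))"
      using Ck_on_Suc_has_derivative [OF Suc.prems(4)] fT t by blast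
    then have lin: "linear (fd g (f t))" by (rule has_derivative_linear)
    have rep: "fd g (f t) w = (\<Sum>b\<in>Basis. (w \<bullet> b) *\<^sub>R fd g (f t) b)" for w
      by (subst euclidean_representation [of w, symmetric])
        (simp only: linear_sum [OF lin] linear_scale [OF lin])
    show "((\<lambda>t. g (f t)) has_derivative
        (\<lambda>v. \<Sum>b\<in>Basis. (fd f t v \<bullet> b) *\<^sub>R fd g (f t) b)) (at t)"
      by (rule has_derivative_eq_rhs
          [OF has_derivative_compose [OF Ck_on_Suc_has_derivative [OF Suc.prems(3) t] dg] ext [OF rep]])
  next
    fix v
    show "Ck_on k S (\<lambda>t. \<Sum>b\<in>Basis. (fd f t v \<bullet> b) *\<^sub>R fd g (f t) b)"
    proof (intro Ck_on_sum Ck_on_bilinear [OF bounded_bilinear_scaleR])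
      show "Ck_on k S (\<lambda>t. fd f t v \<bullet> b)" for b
        using Suc.prems by (intro Ck_on_bounded_linear [OF bounded_linear_inner_left]) auto
      show "Ck_on k S (\<lambda>t. fd g (f t) b)" for b
        using Suc.prems Ck_on_Suc_imp [OF Suc.prems(3)] by (intro Suc.IH [of "\<lambda>s. fd g s b"]) simp_all
    qed (use Suc in auto)
  qed (use Suc in auto)
qed

lemma Ck_on_inverse:
  fixes f :: "'a::real_normed_vector \<Rightarrow> real"
  assumes "open S" "Ck_on k S f" "\<And>t. t \<in> S \<Longrightarrow> f t \<noteq> 0"
  shows "Ck_on k S (\<lambda>t. inverse (f t))"
  using assms
proof (induction k)
  case 0
  then show ?case by (auto intro: continuous_on_inverse)
next
  case (Suc k)
  show ?case
  proof (rule Ck_on_SucI [where f' = "\<lambda>t v. - (inverse (f t) * fd f t v * inverse (f t))"])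
    show "((\<lambda>t. inverse (f t)) has_derivative (\<lambda>v. - (inverse (f t) * fd f t v * inverse (f t)))) (at t)"
      if "t \<in> S" for t
      using that by (intro Deriv.has_derivative_inverse Ck_on_Suc_has_derivative [OF Suc.prems(2)] Suc.prems(3))
    have "Ck_on k S (\<lambda>t. inverse (f t))" using Suc Ck_on_Suc_imp by blast
    then show "Ck_on k S (\<lambda>t. - (inverse (f t) * fd f t v * inverse (f t)))" for v
      using Suc by (intro Ck_on_bounded_linear [OF bounded_linear_minus [OF bounded_linear_ident]]
          Ck_on_bilinear [OF bounded_bilinear_mult]) auto
  qed (use Suc in auto)
qed

text \<open>The coefficient of a nowhere vanishing form may have either sign in a chart, as charts
  carry no orientation; hence the absolute value and the two cases.\<close>

lemma has_derivative_ln_abs: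
  fixes f :: "'a::real_normed_vector \<Rightarrow> real"
  assumes "(f has_derivative f') (at t)" "f t \<noteq> 0"
  shows "((\<lambda>s. ln \<bar>f s\<bar>) has_derivative (\<lambda>v. f' v / f t)) (at t)"
proof (cases "f t > 0")
  case True
  have "isCont f t" using assms(1) has_derivative_continuous by blast
  then have "\<forall>\<^sub>F s in nhds t. f s > 0"
    using True by (simp add: tendsto_at_iff_tendsto_nhds isCont_def order_tendstoD(1))
  then have "\<forall>\<^sub>F s in nhds t. ln (f s) = ln \<bar>f s\<bar>" by eventually_elim auto
  moreover have "((\<lambda>s. ln (f s)) has_derivative (\<lambda>v. f' v / f t)) (at t)"
    using True by (auto intro!: derivative_eq_intros assms simp: divide_inverse)
  ultimately show ?thesis by (rule has_derivative_cong_nhds)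
next
  case False
  then have neg: "f t < 0" using assms(2) by simp
  have "isCont f t" using assms(1) has_derivative_continuous by blast
  then have "\<forall>\<^sub>F s in nhds t. f s < 0"
    using neg by (simp add: tendsto_at_iff_tendsto_nhds isCont_def order_tendstoD(2))
  then have "\<forall>\<^sub>F s in nhds t. ln (- f s) = ln \<bar>f s\<bar>" by eventually_elim auto
  moreover have "((\<lambda>s. ln (- f s)) has_derivative (\<lambda>v. f' v / f t)) (at t)"
    using neg by (auto intro!: derivative_eq_intros assms simp: divide_inverse)
  ultimately show ?thesis by (rule has_derivative_cong_nhds)
qed

text \<open>The derivative is that of \<open>f\<close> divided by \<open>f\<close>, settled one
  order lower by the rules for products and inverses; order 0 is later inferred from order
  1.\<close>

lemma Ck_on_ln_abs:
  fixes f :: "'a::real_normed_vector \<Rightarrow> real"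
  assumes "open S" "Ck_on (Suc k) S f" "\<And>t. t \<in> S \<Longrightarrow> f t \<noteq> 0"
  shows "Ck_on (Suc k) S (\<lambda>t. ln \<bar>f t\<bar>)"
proof (rule Ck_on_SucI [where f' = "\<lambda>t v. fd f t v * inverse (f t)"])
  fix t assume t: "t \<in> S"
  show "((\<lambda>t. ln \<bar>f t\<bar>) has_derivative (\<lambda>v. fd f t v * inverse (f t))) (at t)"
    using has_derivative_ln_abs [OF Ck_on_Suc_has_derivative [OF assms(2) t] assms(3) [OF t]]
    by (simp add: divide_inverse)
next
  show "Ck_on k S (\<lambda>t. fd f t v * inverse (f t))" for v
    using assms Ck_on_Suc_imp
    by (intro Ck_on_bilinear [OF bounded_bilinear_mult] Ck_on_inverse) auto
qed fact

subsection \<open>Germs of smooth functions\<close>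

text \<open>One neighbourhood serves all orders. Working at a point avoids the bookkeeping of nested
  chart domains; \<open>smooth_on_iff\<close> leads back to open sets.\<close>

definition smooth_at :: "'e::real_normed_vector \<Rightarrow> ('e \<Rightarrow> 'f::real_normed_vector) \<Rightarrow> bool" where
  "smooth_at t f \<longleftrightarrow> (\<exists>U. open U \<and> t \<in> U \<and> smooth_on U f)"

lemma smooth_on_iff: "open S \<Longrightarrow> smooth_on S f \<longleftrightarrow> (\<forall>t\<in>S. smooth_at t f)"
  unfolding smooth_at_def smooth_on_def by (meson Ck_on_local)

lemma smooth_atI: "open U \<Longrightarrow> t \<in> U \<Longrightarrow> smooth_on U f \<Longrightarrow> smooth_at t f"
  unfolding smooth_at_def by blast

lemma smooth_at_cong:
  assumes "\<forall>\<^sub>F s in nhds t. f s = g s" "smooth_at t f"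
  shows "smooth_at t g"
proof -
  obtain U where U: "open U" "t \<in> U" "\<And>k. Ck_on k U f"
    using assms(2) by (auto simp: smooth_at_def smooth_on_def)
  obtain V where V: "open V" "t \<in> V" "\<And>s. s \<in> V \<Longrightarrow> f s = g s"
    using assms(1) by (auto simp: eventually_nhds)
  have "smooth_on (U \<inter> V) g"
    unfolding smooth_on_def
    by (auto intro!: Ck_on_cong [where f = f] Ck_on_subset [OF U(3)] U V)
  then show ?thesis using U V by (auto simp: smooth_at_def)
qed

lemma eventually_smooth_at:
  assumes "smooth_at t f"
  shows "\<forall>\<^sub>F s in nhds t. smooth_at s f"
  using assms unfolding smooth_at_def eventually_nhds by blast

lemma smooth_at_has_derivative: "smooth_at t f \<Longrightarrow> (f has_derivative fd f t) (at t)"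
  unfolding smooth_at_def smooth_on_def using Ck_on_Suc_has_derivative by blast

lemma smooth_at_linear_fd: "smooth_at t f \<Longrightarrow> linear (fd f t)"
  using smooth_at_has_derivative has_derivative_linear by blast

lemma smooth_at_isCont: "smooth_at t f \<Longrightarrow> isCont f t"
  using smooth_at_has_derivative has_derivative_continuous by blast

lemma smooth_at_fd: "smooth_at t f \<Longrightarrow> smooth_at t (\<lambda>s. fd f s v)"
  unfolding smooth_at_def smooth_on_def by (metis Ck_on.simps(2))

text \<open>Lifts a closure rule proved order by order to germs, on the intersection of the two
  neighbourhoods.\<close>

lemma smooth_at_combine:
  assumes "smooth_at t f" "smooth_at t g"
    and "\<And>k S. open S \<Longrightarrow> Ck_on k S f \<Longrightarrow> Ck_on k S g \<Longrightarrow> Ck_on k S h"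
  shows "smooth_at t h"
proof -
  obtain U V where "open U" "t \<in> U" "\<And>k. Ck_on k U f" "open V" "t \<in> V" "\<And>k. Ck_on k V g"
    using assms(1,2) unfolding smooth_at_def smooth_on_def by auto
  then show ?thesis
    unfolding smooth_at_def smooth_on_def
    by (intro exI [of _ "U \<inter> V"]) (auto intro!: assms(3) intro: Ck_on_subset)
qed

lemma smooth_at_const [simp]: "smooth_at t (\<lambda>s. c)"
  unfolding smooth_at_def smooth_on_def using Ck_on_const by blast

lemma smooth_at_ident [simp]: "smooth_at t (\<lambda>s. s)"
  unfolding smooth_at_def smooth_on_def using Ck_on_ident open_UNIV by blast

lemma smooth_at_bounded_linear:
  "bounded_linear L \<Longrightarrow> smooth_at t f \<Longrightarrow> smooth_at t (\<lambda>s. L (f s))"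
  by (rule smooth_at_combine [of t f f]) (auto intro: Ck_on_bounded_linear)

lemma smooth_at_linear:
  fixes L :: "'b::euclidean_space \<Rightarrow> 'c::real_normed_vector"
  shows "linear L \<Longrightarrow> smooth_at t f \<Longrightarrow> smooth_at t (\<lambda>s. L (f s))"
  using smooth_at_bounded_linear linear_conv_bounded_linear by blast

lemma smooth_at_add: "smooth_at t f \<Longrightarrow> smooth_at t g \<Longrightarrow> smooth_at t (\<lambda>s. f s + g s)"
  by (rule smooth_at_combine [of t f g]) (auto intro: Ck_on_add)

lemma smooth_at_bilinear:
  "bounded_bilinear B \<Longrightarrow> smooth_at t f \<Longrightarrow> smooth_at t g \<Longrightarrow> smooth_at t (\<lambda>s. B (f s) (g s))"
  by (rule smooth_at_combine [of t f g]) (auto intro: Ck_on_bilinear)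

lemmas smooth_at_mult = smooth_at_bilinear [OF bounded_bilinear_mult]
lemmas smooth_at_scaleR = smooth_at_bilinear [OF bounded_bilinear_scaleR]
lemmas smooth_at_inner = smooth_at_bilinear [OF bounded_bilinear_inner]

lemma smooth_at_minus: "smooth_at t f \<Longrightarrow> smooth_at t (\<lambda>s. - f s)"
  by (rule smooth_at_bounded_linear [OF bounded_linear_minus [OF bounded_linear_ident]])

lemma smooth_at_diff: "smooth_at t f \<Longrightarrow> smooth_at t g \<Longrightarrow> smooth_at t (\<lambda>s. f s - g s)"
  using smooth_at_add [of t f "\<lambda>s. - g s"] by (simp add: smooth_at_minus)

lemma smooth_at_sum:
  "(\<And>i. i \<in> I \<Longrightarrow> smooth_at t (f i)) \<Longrightarrow> smooth_at t (\<lambda>s. \<Sum>i\<in>I. f i s)"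
  by (induction I rule: infinite_finite_induct) (auto intro: smooth_at_add)

lemma smooth_at_compose:
  fixes f :: "'a::real_normed_vector \<Rightarrow> 'b::euclidean_space"
  assumes "smooth_at t f" "smooth_at (f t) g"
  shows "smooth_at t (\<lambda>s. g (f s))"
proof -
  obtain U V where U: "open U" "t \<in> U" "\<And>k. Ck_on k U f"
    and V: "open V" "f t \<in> V" "\<And>k. Ck_on k V g"
    using assms unfolding smooth_at_def smooth_on_def by auto
  have "continuous_on U f" using U(3) [of 0] by simp
  then have W: "open (U \<inter> f -` V)" using U V by (simp add: continuous_on_open_vimage Int_commute)
  have "Ck_on k (U \<inter> f -` V) (\<lambda>s. g (f s))" for k
    by (rule Ck_on_compose [OF W V(1) _ V(3)]) (auto intro: Ck_on_subset [OF U(3)])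
  then show ?thesis
    unfolding smooth_at_def smooth_on_def using W U(2) V(2) by blast
qed

lemma smooth_at_nonzero:
  fixes f :: "'a::real_normed_vector \<Rightarrow> real"
  assumes "smooth_at t f" "f t \<noteq> 0"
  obtains U where "open U" "t \<in> U" "\<And>k. Ck_on k U f" "\<And>s. s \<in> U \<Longrightarrow> f s \<noteq> 0"
proof -
  obtain U where U: "open U" "t \<in> U" "\<And>k. Ck_on k U f"
    using assms unfolding smooth_at_def smooth_on_def by auto
  have "continuous_on U f" using U(3) [of 0] by simp
  then have W: "open (U \<inter> f -` (- {0}))"
    using U by (simp add: continuous_on_open_vimage Int_commute open_Compl)
  show ?thesis by (rule that [OF W]) (use U assms in \<open>auto intro: Ck_on_subset\<close>)
qed

lemma smooth_at_inverse:
  fixes f :: "'a::real_normed_vector \<Rightarrow> real"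
  assumes "smooth_at t f" "f t \<noteq> 0"
  shows "smooth_at t (\<lambda>s. inverse (f s))"
  using smooth_at_nonzero [OF assms] Ck_on_inverse unfolding smooth_at_def smooth_on_def by metis

lemma smooth_at_divide:
  fixes f g :: "'a::real_normed_vector \<Rightarrow> real"
  shows "smooth_at t f \<Longrightarrow> smooth_at t g \<Longrightarrow> g t \<noteq> 0 \<Longrightarrow> smooth_at t (\<lambda>s. f s / g s)"
  by (simp add: divide_inverse smooth_at_inverse smooth_at_mult)

lemma smooth_at_ln_abs:
  fixes f :: "'a::real_normed_vector \<Rightarrow> real"
  assumes "smooth_at t f" "f t \<noteq> 0"
  shows "smooth_at t (\<lambda>s. ln \<bar>f s\<bar>)"
proof -
  obtain U where U: "open U" "t \<in> U" "\<And>k. Ck_on k U f" "\<And>s. s \<in> U \<Longrightarrow> f s \<noteq> 0"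
    using smooth_at_nonzero [OF assms] by metis
  have "Ck_on k U (\<lambda>s. ln \<bar>f s\<bar>)" for k
    using Ck_on_Suc_imp [OF Ck_on_ln_abs [OF U(1) U(3) U(4)]] by blast
  then show ?thesis unfolding smooth_at_def smooth_on_def using U by blast
qed

subsection \<open>Symmetry of second derivatives\<close>

lemma has_real_derivative_along:
  fixes f :: "'e::euclidean_space \<Rightarrow> real"
  assumes "(f has_derivative fd f (w + s *\<^sub>R u)) (at (w + s *\<^sub>R u))"
  shows "((\<lambda>s. f (w + s *\<^sub>R u)) has_real_derivative fd f (w + s *\<^sub>R u) u) (at s)"
proof -
  have "((\<lambda>s. w + s *\<^sub>R u) has_derivative (\<lambda>h. h *\<^sub>R u)) (at s)"
    by (auto intro!: derivative_eq_intros)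
  from has_derivative_compose [OF this assms]
  have "((\<lambda>s. f (w + s *\<^sub>R u)) has_derivative (\<lambda>h. fd f (w + s *\<^sub>R u) (h *\<^sub>R u))) (at s)" .
  moreover have "(\<lambda>h. fd f (w + s *\<^sub>R u) (h *\<^sub>R u)) = (*) (fd f (w + s *\<^sub>R u) u)"
    using has_derivative_linear [OF assms] by (auto simp: linear_cmul mult.commute)
  ultimately show ?thesis by (simp add: has_field_derivative_def)
qed

text \<open>The mean value theorem is applied twice, along \<open>u\<close> to a difference of two
  translates and then along \<open>v\<close> to the \<open>u\<close>-derivative. The left-hand side
  is symmetric in \<open>u\<close> and \<open>v\<close>, so exchanging them represents it by the
  other mixed derivative.\<close>

lemma second_difference:
  fixes f :: "'e::euclidean_space \<Rightarrow> real"
  assumes h: "0 < h"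
    and sm: "\<And>a b. 0 \<le> a \<Longrightarrow> a \<le> h \<Longrightarrow> 0 \<le> b \<Longrightarrow> b \<le> h \<Longrightarrow> smooth_at (t + a *\<^sub>R u + b *\<^sub>R v) f"
  shows "\<exists>a b. 0 \<le> a \<and> a \<le> h \<and> 0 \<le> b \<and> b \<le> h \<and>
    f (t + h *\<^sub>R u + h *\<^sub>R v) - f (t + h *\<^sub>R u) - f (t + h *\<^sub>R v) + f t =
      h\<^sup>2 * fd (\<lambda>s. fd f s u) (t + a *\<^sub>R u + b *\<^sub>R v) v"
proof -
  define g where "g = (\<lambda>s. f (t + h *\<^sub>R v + s *\<^sub>R u) - f (t + s *\<^sub>R u))"
  have dg: "(g has_real_derivative fd f (t + h *\<^sub>R v + s *\<^sub>R u) u - fd f (t + s *\<^sub>R u) u) (at s)"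
    if "0 \<le> s" "s \<le> h" for s
    unfolding g_def
    using sm [of s 0] sm [of s h] that h
    by (intro DERIV_diff has_real_derivative_along smooth_at_has_derivative)
      (simp_all add: add.assoc add.commute [of "h *\<^sub>R v"])
  obtain a where a: "0 < a" "a < h" "g h - g 0 = (h - 0) * (fd f (t + h *\<^sub>R v + a *\<^sub>R u) u - fd f (t + a *\<^sub>R u) u)"
    using MVT2 [OF h dg] by blast
  define k where "k = (\<lambda>r. fd f (t + a *\<^sub>R u + r *\<^sub>R v) u)"
  have dk: "(k has_real_derivative fd (\<lambda>s. fd f s u) (t + a *\<^sub>R u + r *\<^sub>R v) v) (at r)"
    if "0 \<le> r" "r \<le> h" for r
    unfolding k_def using sm [of a r] that a
    by (intro has_real_derivative_along [of "\<lambda>s. fd f s u"] smooth_at_has_derivative smooth_at_fd) simp_all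
  obtain b where b: "0 < b" "b < h" "k h - k 0 = (h - 0) * fd (\<lambda>s. fd f s u) (t + a *\<^sub>R u + b *\<^sub>R v) v"
    using MVT2 [OF h dk] by blast
  have "f (t + h *\<^sub>R u + h *\<^sub>R v) - f (t + h *\<^sub>R u) - f (t + h *\<^sub>R v) + f t = g h - g 0"
    by (simp add: g_def algebra_simps)
  also have "\<dots> = h * (k h - k 0)"
    using a(3) by (simp add: k_def algebra_simps)
  also have "\<dots> = h\<^sup>2 * fd (\<lambda>s. fd f s u) (t + a *\<^sub>R u + b *\<^sub>R v) v"
    using b(3) by (simp add: power2_eq_square)
  finally show ?thesis using a b less_imp_le by blast
qed

lemma second_derivative_symmetric_real:
  fixes f :: "'e::euclidean_space \<Rightarrow> real"
  assumes f: "smooth_at t f"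
  shows "fd (\<lambda>s. fd f s u) t v = fd (\<lambda>s. fd f s v) t u"
proof (rule ccontr)
  define p where "p = (\<lambda>s. fd (\<lambda>s. fd f s u) s v)"
  define q where "q = (\<lambda>s. fd (\<lambda>s. fd f s v) s u)"
  assume "\<not> ?thesis"
  then have ne: "p t \<noteq> q t" by (simp add: p_def q_def)
  \<comment> \<open>Half the gap, so that values within \<open>e\<close> of \<open>p t\<close> and
    of \<open>q t\<close> cannot coincide.\<close>
  define e where "e = dist (p t) (q t) / 2"
  have e: "e > 0" using ne by (simp add: e_def)
  have "isCont p t" "isCont q t"
    unfolding p_def q_def using f by (auto intro!: smooth_at_isCont smooth_at_fd)
  then have "\<forall>\<^sub>F s in nhds t. dist (p s) (p t) < e" "\<forall>\<^sub>F s in nhds t. dist (q s) (q t) < e"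
    using e by (auto simp: isCont_def tendsto_at_iff_tendsto_nhds dest: tendstoD)
  with eventually_smooth_at [OF f]
  have "\<forall>\<^sub>F s in nhds t. smooth_at s f \<and> dist (p s) (p t) < e \<and> dist (q s) (q t) < e"
    by eventually_elim auto
  then obtain d where d: "d > 0" "\<And>s. dist s t < d \<Longrightarrow> smooth_at s f \<and> dist (p s) (p t) < e \<and> dist (q s) (q t) < e"
    by (auto simp: eventually_nhds_metric)
  \<comment> \<open>Keeps the parallelogram with sides \<open>h *\<^sub>R u\<close> and
    \<open>h *\<^sub>R v\<close> within distance \<open>d\<close> of \<open>t\<close>; the summand 1
    avoids division by zero if both vectors vanish.\<close>
  define h where "h = d / (2 * (norm u + norm v + 1))"
  have n1: "norm u + norm v + 1 > 0" by (smt (verit) norm_ge_zero)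
  then have h: "h > 0" using d by (simp add: h_def)
  have near: "dist (t + a *\<^sub>R x + b *\<^sub>R y) t < d"
    if "0 \<le> a" "a \<le> h" "0 \<le> b" "b \<le> h" "norm x + norm y = norm u + norm v" for a b x y
  proof -
    have "dist (t + a *\<^sub>R x + b *\<^sub>R y) t \<le> norm (a *\<^sub>R x) + norm (b *\<^sub>R y)"
      by (simp add: dist_norm add.assoc norm_triangle_ineq del: norm_scaleR)
    also have "\<dots> \<le> h * norm x + h * norm y"
      using that by (auto intro!: add_mono mult_right_mono)
    also have "\<dots> = h * (norm u + norm v)" using that(5) by (simp add: distrib_left [symmetric])
    also have "\<dots> \<le> h * (norm u + norm v + 1)" using h by simp
    also have "\<dots> = d / 2" using n1 unfolding h_def by (simp add: field_simps)
    also have "\<dots> < d" using d(1) by simp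
    finally show ?thesis .
  qed
  define \<Delta> where "\<Delta> = f (t + h *\<^sub>R u + h *\<^sub>R v) - f (t + h *\<^sub>R u) - f (t + h *\<^sub>R v) + f t"
  obtain a b where ab: "0 \<le> a" "a \<le> h" "0 \<le> b" "b \<le> h" "\<Delta> = h\<^sup>2 * p (t + a *\<^sub>R u + b *\<^sub>R v)"
    unfolding \<Delta>_def p_def using second_difference [OF h, of t u v f] near d(2) by blast
  obtain a' b' where ab': "0 \<le> a'" "a' \<le> h" "0 \<le> b'" "b' \<le> h"
    "f (t + h *\<^sub>R v + h *\<^sub>R u) - f (t + h *\<^sub>R v) - f (t + h *\<^sub>R u) + f t = h\<^sup>2 * q (t + a' *\<^sub>R v + b' *\<^sub>R u)"
    unfolding q_def using second_difference [OF h, of t v u f] near d(2) by (metis add.commute)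
  have "\<Delta> = h\<^sup>2 * q (t + a' *\<^sub>R v + b' *\<^sub>R u)"
    using ab'(5) by (simp add: \<Delta>_def algebra_simps)
  with ab(5) h have "p (t + a *\<^sub>R u + b *\<^sub>R v) = q (t + a' *\<^sub>R v + b' *\<^sub>R u)" by simp
  moreover have "dist (p (t + a *\<^sub>R u + b *\<^sub>R v)) (p t) < e" using d(2) near ab by blast
  moreover have "dist (q (t + a' *\<^sub>R v + b' *\<^sub>R u)) (q t) < e"
    using d(2) near [OF ab'(1-4)] by (simp add: add.commute)
  ultimately have "dist (p t) (q t) < e + e" by (metis dist_triangle_less_add dist_commute)
  then show False by (simp add: e_def)
qed

lemma fd_linear:
  fixes L :: "'b::euclidean_space \<Rightarrow> 'c::real_normed_vector"
  assumes "linear L" "(f has_derivative f') (at t)"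
  shows "((\<lambda>s. L (f s)) has_derivative (\<lambda>v. L (f' v))) (at t)"
  using bounded_linear.has_derivative [OF _ assms(2)] assms(1) linear_conv_bounded_linear by blast

lemma second_derivative_symmetric:
  fixes f :: "'e::euclidean_space \<Rightarrow> 'f::euclidean_space"
  assumes f: "smooth_at t f"
  shows "fd (\<lambda>s. fd f s u) t v = fd (\<lambda>s. fd f s v) t u"
proof (rule euclidean_eqI)
  fix b :: 'f assume "b \<in> Basis"
  have *: "fd (\<lambda>s. fd (\<lambda>r. f r \<bullet> b) s u) t v = fd (\<lambda>s. fd f s u) t v \<bullet> b" for u v
  proof -
    have lin: "linear (\<lambda>x. x \<bullet> b)" by (simp add: bounded_linear.linear bounded_linear_inner_left)
    have "\<forall>\<^sub>F s in nhds t. fd f s u \<bullet> b = fd (\<lambda>r. f r \<bullet> b) s u"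
      using eventually_smooth_at [OF f]
      by eventually_elim (simp add: fd_eqI [OF fd_linear [OF lin smooth_at_has_derivative]])
    from fd_cong [OF this] show ?thesis
      using fd_eqI [OF fd_linear [OF lin smooth_at_has_derivative [OF smooth_at_fd [OF f, of u]]]]
      by metis
  qed
  have "smooth_at t (\<lambda>r. f r \<bullet> b)" using f by (intro smooth_at_inner) auto
  from second_derivative_symmetric_real [OF this]
  show "fd (\<lambda>s. fd f s u) t v \<bullet> b = fd (\<lambda>s. fd f s v) t u \<bullet> b" by (simp only: *)
qed

subsection \<open>Bump functions\<close>

text \<open>With y = 1/x this is the decay of the functions \<open>flat_fun p\<close> at 0 from the
  right.\<close>

lemma poly_times_exp_minus_tendsto_0:
  fixes p :: "real poly"
  shows "((\<lambda>y. poly p y * exp (- y)) \<longlongrightarrow> 0) at_top"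
proof -
  have "((\<lambda>y. \<Sum>i\<le>degree p. coeff p i * (y ^ i / exp y)) \<longlongrightarrow> (\<Sum>i\<le>degree p. coeff p i * 0)) at_top"
    by (intro tendsto_intros tendsto_power_div_exp_0)
  moreover have "poly p y * exp (- y) = (\<Sum>i\<le>degree p. coeff p i * (y ^ i / exp y))" for y
    by (simp add: poly_altdef exp_minus sum_distrib_right divide_inverse mult.assoc)
  ultimately show ?thesis by simp
qed

text \<open>The classical flat function exp (-1/x) is \<open>flat_fun [:1:]\<close>; the polynomial
  in 1/x absorbs the factors produced by differentiation.\<close>

definition flat_fun :: "real poly \<Rightarrow> real \<Rightarrow> real" where
  "flat_fun p x = (if x \<le> 0 then 0 else poly p (inverse x) * exp (- inverse x))"

text \<open>The functions \<open>flat_fun p\<close> are closed under differentiation, hence all of them are smooth.\<close>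

lemma flat_fun_has_derivative:
  "(flat_fun p has_real_derivative flat_fun ([:0, 0, 1:] * (p - pderiv p)) x) (at x)"
proof -
  \<comment> \<open>With y = 1/x, the derivative for x > 0 is y^2 (p y - p' y) exp (-y), which is
    where the polynomial in the statement comes from.\<close>
  consider "x < 0" | "x = 0" | "x > 0" by linarith
  then show ?thesis
  proof cases
    case 1
    then have "\<forall>\<^sub>F y in nhds x. y < 0" by (rule eventually_nhds_in_open [OF open_lessThan, simplified])
    then have "\<forall>\<^sub>F y in nhds x. flat_fun p y = 0" by eventually_elim (simp add: flat_fun_def)
    then show ?thesis using 1 by (subst DERIV_cong_ev [OF refl _ refl]) (auto simp: flat_fun_def)
  next
    case 2
    have "((\<lambda>h. (flat_fun p (0 + h) - flat_fun p 0) / h) \<longlongrightarrow> 0) (at_left 0)"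
      by (rule tendsto_eventually) (auto simp: flat_fun_def eventually_at_filter)
    moreover have "((\<lambda>h. (flat_fun p (0 + h) - flat_fun p 0) / h) \<longlongrightarrow> 0) (at_right 0)"
    proof -
      \<comment> \<open>Dividing by \<open>h\<close> is multiplying by 1/h, which turns
        \<open>p\<close> into \<open>[:0, 1:] * p\<close>.\<close>
      have "((\<lambda>h. poly ([:0, 1:] * p) (inverse h) * exp (- inverse h)) \<longlongrightarrow> 0) (at_right 0)"
        using filterlim_compose [OF poly_times_exp_minus_tendsto_0 filterlim_inverse_at_top_right] .
      moreover have "\<forall>\<^sub>F h in at_right 0. poly ([:0, 1:] * p) (inverse h) * exp (- inverse h) =
          (flat_fun p (0 + h) - flat_fun p 0) / h"
        unfolding eventually_at_filter
        by (intro always_eventually) (auto simp: flat_fun_def divide_inverse)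
      ultimately show ?thesis by (rule Lim_transform_eventually)
    qed
    ultimately have "((\<lambda>h. (flat_fun p (0 + h) - flat_fun p 0) / h) \<longlongrightarrow> 0) (at 0)"
      by (simp add: filterlim_split_at)
    then show ?thesis using 2 by (simp add: DERIV_def flat_fun_def)
  next
    case 3
    then have "\<forall>\<^sub>F y in nhds x. y > 0" by (rule eventually_nhds_in_open [OF open_greaterThan, simplified])
    then have "\<forall>\<^sub>F y in nhds x. flat_fun p y = poly p (inverse y) * exp (- inverse y)"
      by eventually_elim (simp add: flat_fun_def)
    moreover have "((\<lambda>y. poly p (inverse y) * exp (- inverse y)) has_real_derivative
        flat_fun ([:0, 0, 1:] * (p - pderiv p)) x) (at x)"
      using 3 by (auto intro!: derivative_eq_intros DERIV_chain2 [OF poly_DERIV]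
          simp: flat_fun_def field_simps power2_eq_square)
    ultimately show ?thesis by (subst DERIV_cong_ev [OF refl _ refl])
  qed
qed

lemma smooth_at_flat_fun: "smooth_at x (flat_fun p)"
proof -
  have "Ck_on k UNIV (flat_fun p)" for k
  proof (induction k arbitrary: p)
    case 0
    then show ?case
      using DERIV_isCont [OF flat_fun_has_derivative [of p]]
      by (auto intro: continuous_at_imp_continuous_on)
  next
    case (Suc k)
    show ?case
    proof (rule Ck_on_SucI [where f' = "\<lambda>x v. flat_fun ([:0, 0, 1:] * (p - pderiv p)) x * v"])
      show "(flat_fun p has_derivative (\<lambda>v. flat_fun ([:0, 0, 1:] * (p - pderiv p)) t * v)) (at t)" for t
        using flat_fun_has_derivative by (simp add: has_field_derivative_def)
      show "Ck_on k UNIV (\<lambda>t. flat_fun ([:0, 0, 1:] * (p - pderiv p)) t * v)" for v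
        using Suc by (intro Ck_on_bilinear [OF bounded_bilinear_mult] Ck_on_const) auto
    qed auto
  qed
  then show ?thesis unfolding smooth_at_def smooth_on_def by blast
qed

lemma exists_bump_euclidean:
  fixes t :: "'e::euclidean_space"
  assumes r: "0 < r"
  obtains \<beta> :: "'e \<Rightarrow> real"
  where "\<And>s. smooth_at s \<beta>" "\<And>s. dist s t < r / 2 \<Longrightarrow> \<beta> s = 1" "\<And>s. dist s t \<ge> r \<Longrightarrow> \<beta> s = 0"
proof -
  \<comment> \<open>The squared distance is smooth at the centre too; the factor makes
    \<open>g\<close> equal to 1 at distance r/2 and 4 at distance r. The numerator of
    \<open>\<beta>\<close> vanishes for g >= 2, the other summand of the denominator for g <= 1, and
    never both.\<close>
  define g where "g = (\<lambda>s. (4 / r\<^sup>2) * ((s - t) \<bullet> (s - t)))"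
  define \<beta> where "\<beta> = (\<lambda>s. flat_fun [:1:] (2 - g s) / (flat_fun [:1:] (2 - g s) + flat_fun [:1:] (g s - 1)))"
  have g: "smooth_at s g" for s
    unfolding g_def
    by (intro smooth_at_mult smooth_at_inner smooth_at_diff smooth_at_const smooth_at_ident)
  have gd: "g s = 4 * (dist s t / r)\<^sup>2" for s
    by (simp add: g_def dist_norm power2_norm_eq_inner power_divide)
  have pos: "flat_fun [:1:] (2 - x) + flat_fun [:1:] (x - 1) > 0" for x
    by (auto simp: flat_fun_def add_pos_pos)
  show ?thesis
  proof (rule that [of \<beta>])
    show "smooth_at s \<beta>" for s
      unfolding \<beta>_def using pos [of "g s"]
      by (intro smooth_at_divide smooth_at_add
          smooth_at_compose [of s "\<lambda>s. 2 - g s" "flat_fun [:1:]"]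
          smooth_at_compose [of s "\<lambda>s. g s - 1" "flat_fun [:1:]"]
          smooth_at_diff smooth_at_flat_fun smooth_at_const g) auto
    show "\<beta> s = 1" if "dist s t < r / 2" for s
    proof -
      have "dist s t / r \<le> 1 / 2" using that r by (simp add: field_simps)
      then have "(dist s t / r)\<^sup>2 \<le> (1 / 2)\<^sup>2" using r by (intro power_mono) auto
      then have "g s \<le> 1" unfolding gd by (simp add: power_one_over)
      then show ?thesis by (simp add: \<beta>_def flat_fun_def)
    qed
    show "\<beta> s = 0" if "dist s t \<ge> r" for s
    proof -
      have "1 \<le> dist s t / r" using that r by (simp add: field_simps)
      then have "1\<^sup>2 \<le> (dist s t / r)\<^sup>2" by (intro power_mono) auto
      then have "g s \<ge> 2" by (simp add: gd)
      then show ?thesis by (simp add: \<beta>_def flat_fun_def)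
    qed
  qed
qed

subsection \<open>Alternating forms on lists of vectors\<close>

lemma alt_forms_linear:
  assumes "\<omega> \<in> alt_forms k S" "length vs = k" "set vs \<subseteq> S" "i < k" "u \<in> S" "v \<in> S"
  shows "\<omega> (vs[i := a *\<^sub>R u + b *\<^sub>R v]) = a * \<omega> (vs[i := u]) + b * \<omega> (vs[i := v])"
  using assms by (simp add: alt_forms_def)

lemma alt_forms_repeat:
  assumes "\<omega> \<in> alt_forms k S" "i < length vs" "j < length vs" "i \<noteq> j" "vs ! i = vs ! j"
  shows "\<omega> vs = 0"
proof (cases "length vs = k \<and> set vs \<subseteq> S")
  case True
  then have "\<forall>i<k. \<forall>j<k. i \<noteq> j \<and> vs ! i = vs ! j \<longrightarrow> \<omega> vs = 0"
    using assms(1) by (simp add: alt_forms_def)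
  then show ?thesis using True assms(2-) by blast
qed (use assms(1) in \<open>simp add: alt_forms_def\<close>)

lemma alt_forms_outside:
  assumes "\<omega> \<in> alt_forms k S" "\<not> (length vs = k \<and> set vs \<subseteq> S)"
  shows "\<omega> vs = 0"
  using assms by (simp add: alt_forms_def)

lemma alt_formsI:
  assumes "\<And>vs i u v a b. length vs = k \<Longrightarrow> set vs \<subseteq> S \<Longrightarrow> i < k \<Longrightarrow> u \<in> S \<Longrightarrow> v \<in> S \<Longrightarrow>
      \<omega> (vs[i := a *\<^sub>R u + b *\<^sub>R v]) = a * \<omega> (vs[i := u]) + b * \<omega> (vs[i := v])"
    and "\<And>vs i j. length vs = k \<Longrightarrow> set vs \<subseteq> S \<Longrightarrow> i < j \<Longrightarrow> j < k \<Longrightarrow> vs ! i = vs ! j \<Longrightarrow> \<omega> vs = 0"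
    and "\<And>vs. \<not> (length vs = k \<and> set vs \<subseteq> S) \<Longrightarrow> \<omega> vs = 0"
  shows "\<omega> \<in> alt_forms k S"
  unfolding alt_forms_def
proof (intro CollectI conjI allI impI ballI)
  fix vs i j assume "length vs = k \<and> set vs \<subseteq> S" "i < k" "j < k" "i \<noteq> j \<and> vs ! i = vs ! j"
  then show "\<omega> vs = 0"
    by (cases "i < j") (auto intro: assms(2) [of vs i j] assms(2) [of vs j i])
qed (use assms in auto)

lemma alt_forms_lincomb:
  assumes \<omega>: "\<omega> \<in> alt_forms k S" and \<eta>: "\<eta> \<in> alt_forms k S"
  shows "(\<lambda>vs. c * \<omega> vs + d * \<eta> vs) \<in> alt_forms k S"
proof (rule alt_formsI)
  fix vs i u v a b assume "length vs = k" "set vs \<subseteq> S" "i < k" "u \<in> S" "v \<in> S"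
  then show "c * \<omega> (vs[i := a *\<^sub>R u + b *\<^sub>R v]) + d * \<eta> (vs[i := a *\<^sub>R u + b *\<^sub>R v]) =
      a * (c * \<omega> (vs[i := u]) + d * \<eta> (vs[i := u])) + b * (c * \<omega> (vs[i := v]) + d * \<eta> (vs[i := v]))"
    by (simp add: alt_forms_linear [OF \<omega>] alt_forms_linear [OF \<eta>] algebra_simps)
next
  fix vs :: "'a list" and i j assume vs: "length vs = k" "i < j" "j < k" "vs ! i = vs ! j"
  have "\<omega> vs = 0" "\<eta> vs = 0"
    using vs by (intro alt_forms_repeat [OF \<omega>, of i _ j] alt_forms_repeat [OF \<eta>, of i _ j]; simp)+
  then show "c * \<omega> vs + d * \<eta> vs = 0" by simp
next
  fix vs assume "\<not> (length vs = k \<and> set vs \<subseteq> S)"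
  then show "c * \<omega> vs + d * \<eta> vs = 0"
    using alt_forms_outside [OF \<omega>] alt_forms_outside [OF \<eta>] by fastforce
qed

lemma alt_forms_scale: "\<omega> \<in> alt_forms k S \<Longrightarrow> (\<lambda>vs. c * \<omega> vs) \<in> alt_forms k S"
  using alt_forms_lincomb [of \<omega> k S \<omega> c 0] by simp

text \<open>Forms are extended by zero off the subspace, so lists that leave \<open>S\<close> have
  to be sent to lists that leave \<open>T\<close>; hence an equivalence in the last
  assumption.\<close>

lemma alt_forms_pullback:
  assumes \<omega>: "\<omega> \<in> alt_forms k T" and L: "linear L" and ST: "\<And>u. L u \<in> T \<longleftrightarrow> u \<in> S"
  shows "(\<lambda>us. \<omega> (map L us)) \<in> alt_forms k S"
proof (rule alt_formsI)
  fix vs i u v a b assume "length vs = k" "set vs \<subseteq> S" "i < k" "u \<in> S" "v \<in> S"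
  then show "\<omega> (map L (vs[i := a *\<^sub>R u + b *\<^sub>R v])) =
      a * \<omega> (map L (vs[i := u])) + b * \<omega> (map L (vs[i := v]))"
    using ST by (simp add: map_update linear_add [OF L] linear_cmul [OF L])
      (intro alt_forms_linear [OF \<omega>], auto)
next
  fix vs i j assume "length vs = k" "set vs \<subseteq> S" "i < j" "j < k" "vs ! i = vs ! j"
  then show "\<omega> (map L vs) = 0"
    by (intro alt_forms_repeat [OF \<omega>, of i _ j]) auto
next
  fix vs assume "\<not> (length vs = k \<and> set vs \<subseteq> S)"
  then show "\<omega> (map L vs) = 0"
    using ST by (intro alt_forms_outside [OF \<omega>]) auto
qed

lemma alt_forms_slot_linear:
  assumes "\<omega> \<in> alt_forms k UNIV" "i < k"
  shows "linear (\<lambda>u. \<omega> (vs[i := u]))"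
proof (cases "length vs = k")
  case True
  have *: "\<omega> (vs[i := a *\<^sub>R u + b *\<^sub>R v]) = a * \<omega> (vs[i := u]) + b * \<omega> (vs[i := v])" for a b u v
    using alt_forms_linear [OF assms(1) True _ assms(2)] by simp
  show ?thesis
    by (rule linearI) (use * [of 1 _ 1] * [of _ _ 0 0] in auto)
next
  case False
  then have "\<omega> (vs[i := u]) = 0" for u
    by (intro alt_forms_outside [OF assms(1)]) simp
  then show ?thesis by (simp add: linear_iff)
qed

lemma linear_real_sum_Basis:
  fixes f :: "'e::euclidean_space \<Rightarrow> real"
  assumes "linear f"
  shows "f u = (\<Sum>b\<in>Basis. (u \<bullet> b) * f b)"
proof -
  have "f u = f (\<Sum>b\<in>Basis. (u \<bullet> b) *\<^sub>R b)" by (simp add: euclidean_representation)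
  also have "\<dots> = (\<Sum>b\<in>Basis. (u \<bullet> b) * f b)"
    by (simp only: linear_sum [OF assms] linear_cmul [OF assms] real_scaleR_def)
  finally show ?thesis .
qed

text \<open>Polarisation: expand the value 0 that is taken when x + y stands in both slots.\<close>

lemma alt_forms_swap:
  assumes \<omega>: "\<omega> \<in> alt_forms k S" and S: "subspace S"
    and vs: "length vs = k" "set vs \<subseteq> S" and ij: "i < k" "j < k" "i \<noteq> j"
  shows "\<omega> (vs[i := vs ! j, j := vs ! i]) = - \<omega> vs"
proof -
  define x y where "x = vs ! i" "y = vs ! j"
  have xy: "x \<in> S" "y \<in> S" using vs ij by (auto simp: x_y_def)
  have xyS: "x + y \<in> S" using subspace_add [OF S xy] .
  define f where "f = (\<lambda>a b. \<omega> (vs[i := a, j := b]))"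
  have upd: "set (vs[i := a]) \<subseteq> S" if "a \<in> S" for a i
    using vs(2) that set_update_subset_insert by fastforce
  have l1: "f (a + a') b = f a b + f a' b" if "a \<in> S" "a' \<in> S" "b \<in> S" for a a' b
    using alt_forms_linear [OF \<omega>, of "vs[j := b]" i a a' 1 1] that vs ij upd
    by (simp add: f_def list_update_swap [of i j])
  have l2: "f a (b + b') = f a b + f a b'" if "a \<in> S" "b' \<in> S" "b \<in> S" for a b' b
    using alt_forms_linear [OF \<omega>, of "vs[i := a]" j b b' 1 1] that vs ij upd
    by (simp add: f_def)
  have rep: "f a a = 0" for a
    unfolding f_def using vs ij by (intro alt_forms_repeat [OF \<omega>, of i _ j]) auto
  have "f y x + f x y = 0"
    using rep [of "x + y"] rep [of x] rep [of y] xy xyS by (simp add: l1 l2)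
  moreover have "f x y = \<omega> vs" by (simp add: f_def x_y_def)
  ultimately show ?thesis by (simp add: f_def x_y_def)
qed

text \<open>Only vanishing has to be propagated, so the permutation is broken into transpositions
  without keeping track of signs.\<close>

lemma alt_forms_permute:
  assumes \<omega>: "\<omega> \<in> alt_forms k S" and S: "subspace S" and len: "length B = k" and p: "p permutes {..<k}"
    and 0: "\<omega> B = 0"
  shows "\<omega> (permute_list p B) = 0"
  using finite_lessThan p
proof (induction p rule: permutes_rev_induct)
  case id
  then show ?case using 0 by simp
next
  case (swap a b p)
  define vs where "vs = permute_list p B"
  have lvs: "length vs = k" by (simp add: vs_def len)
  have "permute_list (p \<circ> Transposition.transpose a b) B = permute_list (Transposition.transpose a b) vs"
    unfolding vs_def
    by (rule permute_list_compose) (use swap len in \<open>auto intro: permutes_swap_id\<close>)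
  also have "\<dots> = vs[a := vs ! b, b := vs ! a]"
    by (rule nth_equalityI)
      (use swap lvs in \<open>auto simp: permute_list_def nth_list_update Transposition.transpose_def\<close>)
  finally have eq: "permute_list (p \<circ> Transposition.transpose a b) B = vs[a := vs ! b, b := vs ! a]" .
  show ?case
  proof (cases "set vs \<subseteq> S")
    case True
    then show ?thesis
      unfolding eq using alt_forms_swap [OF \<omega> S lvs True] swap by (simp add: vs_def)
  next
    case False
    have "set (vs[a := vs ! b, b := vs ! a]) = set vs"
      using swap lvs by (intro set_swap) auto
    then show ?thesis unfolding eq using False by (intro alt_forms_outside [OF \<omega>]) simp
  qed
qed

lemma alt_forms_eq_0_distinct:
  assumes \<omega>: "\<omega> \<in> alt_forms k S" and S: "subspace S" and C: "span C = S"
    and 0: "\<And>vs. length vs = k \<Longrightarrow> set vs \<subseteq> C \<Longrightarrow> distinct vs \<Longrightarrow> \<omega> vs = 0"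
  shows "\<omega> vs = 0"
proof -
  have CS: "C \<subseteq> S" using C span_superset by blast
  \<comment> \<open>Slots from \<open>j\<close> on are restricted to generators, those before
    \<open>j\<close> are free in \<open>S\<close>. Each induction step frees one more slot, since
    the vectors for which the value vanishes form a subspace containing \<open>C\<close>.\<close>
  have "\<omega> vs = 0" if "length vs = k" "set vs \<subseteq> S" "\<forall>i<k. j \<le> i \<longrightarrow> vs ! i \<in> C" "j \<le> k" for j vs
    using that
  proof (induction j arbitrary: vs)
    case 0
    then have "set vs \<subseteq> C" by (auto simp: in_set_conv_nth)
    then show ?case
      using assms(4) alt_forms_repeat [OF \<omega>] 0 by (metis distinct_conv_nth)
  next
    case (Suc j)
    have upd: "set (vs[j := a]) \<subseteq> S" if "a \<in> S" for a
      using Suc.prems(2) that set_update_subset_insert by fastforce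
    define U where "U = {u \<in> S. \<omega> (vs[j := u]) = 0}"
    have lin: "\<omega> (vs[j := a *\<^sub>R u + b *\<^sub>R v]) = a * \<omega> (vs[j := u]) + b * \<omega> (vs[j := v])"
      if "u \<in> S" "v \<in> S" for a b u v
      using alt_forms_linear [OF \<omega> Suc.prems(1,2) _ that] Suc.prems(4) by simp
    have "C \<subseteq> U"
    proof
      fix c assume c: "c \<in> C"
      have "\<omega> (vs[j := c]) = 0"
      proof (rule Suc.IH)
        show "\<forall>i<k. j \<le> i \<longrightarrow> vs[j := c] ! i \<in> C"
          using c Suc.prems by (auto simp: nth_list_update)
      qed (use Suc.prems c CS upd [of c] in auto)
      then show "c \<in> U" using c CS by (auto simp: U_def)
    qed
    moreover have "subspace U"
      unfolding subspace_def
    proof (intro conjI ballI allI)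
      show "0 \<in> U" using lin [of 0 0 0 0] subspace_0 [OF S] by (simp add: U_def)
      show "x + y \<in> U" if "x \<in> U" "y \<in> U" for x y
        using lin [of x y 1 1] that subspace_add [OF S] by (simp add: U_def)
      show "c *\<^sub>R x \<in> U" if "x \<in> U" for c x
        using lin [of x x c 0] that subspace_scale [OF S] by (simp add: U_def)
    qed
    ultimately have "S \<subseteq> U" using C span_minimal by blast
    moreover have "vs ! j \<in> S" using Suc.prems by auto
    ultimately show ?case by (auto simp: U_def)
  qed
  from this [of vs k] show ?thesis
    using alt_forms_outside [OF \<omega>] by fastforce
qed

text \<open>A form that annihilates \<open>N\<close> descends to the quotient by its span, where
  \<open>B\<close> is a generating list of exactly the degree of the form; by counting, the only
  distinct lists left to test are rearrangements of \<open>B\<close>. Used with \<open>N\<close>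
  empty for forms of top degree and with \<open>N\<close> the leaf direction for \<sigma>.\<close>

lemma alt_forms_eq_0:
  assumes \<omega>: "\<omega> \<in> alt_forms (length B) S" and S: "subspace S" and C: "span (N \<union> set B) = S"
    and N: "\<And>vs v. v \<in> N \<Longrightarrow> v \<in> set vs \<Longrightarrow> \<omega> vs = 0" and 0: "\<omega> B = 0"
  shows "\<omega> vs = 0"
proof (rule alt_forms_eq_0_distinct [OF \<omega> S C])
  fix vs assume vs: "length vs = length B" "set vs \<subseteq> N \<union> set B" "distinct vs"
  show "\<omega> vs = 0"
  proof (cases "set vs \<inter> N = {}")
    case True
    then have sub: "set vs \<subseteq> set B" using vs by auto
    have "card (set vs) = length B" using vs distinct_card by fastforce
    then have "card (set B) \<le> card (set vs)" by (simp add: card_length)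
    then have eq: "set vs = set B" using sub by (simp add: card_seteq)
    then have "distinct B" using \<open>card (set vs) = length B\<close> by (simp add: card_distinct)
    then have "mset vs = mset B" using eq vs(3) by (simp add: set_eq_iff_mset_eq_distinct)
    then obtain p where "p permutes {..<length B}" "permute_list p B = vs"
      by (metis mset_eq_permutation)
    then show ?thesis using alt_forms_permute [OF \<omega> S refl _ 0] by auto
  next
    case False
    then show ?thesis using N by auto
  qed
qed

text \<open>The combination of the two forms that vanishes on \<open>B\<close> vanishes everywhere.
  Cross-multiplied, the relation stays valid when a value on \<open>B\<close> is zero.\<close>

lemma alt_forms_proportional:
  assumes "\<omega> \<in> alt_forms (length B) S" "\<eta> \<in> alt_forms (length B) S"
    and "subspace S" "span (N \<union> set B) = S"
    and "\<And>vs v. v \<in> N \<Longrightarrow> v \<in> set vs \<Longrightarrow> \<omega> vs = 0" "\<And>vs v. v \<in> N \<Longrightarrow> v \<in> set vs \<Longrightarrow> \<eta> vs = 0"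
  shows "\<omega> B * \<eta> vs = \<eta> B * \<omega> vs"
proof -
  have "(\<lambda>vs. \<omega> B * \<eta> vs + (- \<eta> B) * \<omega> vs) \<in> alt_forms (length B) S"
    by (rule alt_forms_lincomb [OF assms(2,1)])
  from alt_forms_eq_0 [OF this assms(3,4)] show ?thesis
    using assms(5,6) by (simp add: mult.commute)
qed

text \<open>The derivation by which \<open>A\<close> acts on forms, an infinitesimal pullback. If
  two arguments coincide, the two summands that change one of them differ by a transposition and
  cancel, while all others still contain the repetition.\<close>

lemma alt_forms_derivation:
  assumes \<omega>: "\<omega> \<in> alt_forms k UNIV" and A: "linear A"
  shows "(\<lambda>us. \<Sum>i<length us. \<omega> (us[i := A (us ! i)])) \<in> alt_forms k UNIV"
proof (rule alt_formsI)
  fix vs :: "'a list" and u v :: 'a and i a b assume vs: "length vs = k" and i: "i < k"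
  have "\<omega> (vs[i := a *\<^sub>R u + b *\<^sub>R v, m := A (vs[i := a *\<^sub>R u + b *\<^sub>R v] ! m)]) =
      a * \<omega> (vs[i := u, m := A (vs[i := u] ! m)]) + b * \<omega> (vs[i := v, m := A (vs[i := v] ! m)])" for m
  proof (cases "m = i")
    case True
    then show ?thesis
      using alt_forms_linear [OF \<omega> vs _ i, of "A u" "A v" a b] vs i
      by (simp add: linear_add [OF A] linear_cmul [OF A])
  next
    case False
    then show ?thesis
      using alt_forms_linear [OF \<omega> _ _ i, of "vs[m := A (vs ! m)]" u v a b] vs i
      by (simp add: list_update_swap [of i m])
  qed
  then show "(\<Sum>m<length (vs[i := a *\<^sub>R u + b *\<^sub>R v]).
        \<omega> (vs[i := a *\<^sub>R u + b *\<^sub>R v, m := A (vs[i := a *\<^sub>R u + b *\<^sub>R v] ! m)])) =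
      a * (\<Sum>m<length (vs[i := u]). \<omega> (vs[i := u, m := A (vs[i := u] ! m)])) +
      b * (\<Sum>m<length (vs[i := v]). \<omega> (vs[i := v, m := A (vs[i := v] ! m)]))"
    by (simp add: sum.distrib sum_distrib_left)
next
  fix vs :: "'a list" and i j assume vs: "length vs = k" and ij: "i < j" "j < k" "vs ! i = vs ! j"
  have 0: "\<omega> (vs[m := A (vs ! m)]) = 0" if "m \<in> {..<k} - {i, j}" for m
    using that ij vs by (intro alt_forms_repeat [OF \<omega>, of i _ j]) auto
  have "\<omega> (vs[j := A (vs ! j)]) = - \<omega> (vs[i := A (vs ! i)])"
  proof -
    have "vs[j := A (vs ! j)] = vs[i := A (vs ! i), i := vs ! j, j := A (vs ! i)]"
      using ij vs by simp (metis list_update_id)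
    then show ?thesis
      using alt_forms_swap [OF \<omega> subspace_UNIV, of "vs[i := A (vs ! i)]" i j] ij vs by simp
  qed
  moreover have "(\<Sum>m<k. \<omega> (vs[m := A (vs ! m)])) = (\<Sum>m\<in>{i, j}. \<omega> (vs[m := A (vs ! m)]))"
    by (rule sum.mono_neutral_right) (use ij 0 in auto)
  ultimately show "(\<Sum>m<length vs. \<omega> (vs[m := A (vs ! m)])) = 0"
    using ij vs by simp
next
  fix vs assume "\<not> (length vs = k \<and> set vs \<subseteq> (UNIV :: 'a set))"
  then show "(\<Sum>m<length vs. \<omega> (vs[m := A (vs ! m)])) = 0"
    by (intro sum.neutral ballI alt_forms_outside [OF \<omega>]) auto
qed

lemma alt_forms_move:
  assumes \<omega>: "\<omega> \<in> alt_forms k S" and S: "subspace S"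
    and "length (pre @ x # mid @ post) = k" "set (pre @ x # mid @ post) \<subseteq> S"
  shows "\<omega> (pre @ mid @ x # post) = (-1) ^ length mid * \<omega> (pre @ x # mid @ post)"
  using assms(3,4)
proof (induction mid arbitrary: pre)
  case Nil
  then show ?case by simp
next
  case (Cons y mid)
  have "\<omega> (pre @ (y # mid) @ x # post) = (-1) ^ length mid * \<omega> ((pre @ [y]) @ x # mid @ post)"
    using Cons.IH [of "pre @ [y]"] Cons.prems by simp
  also have "(pre @ [y]) @ x # mid @ post =
      (let vs = pre @ x # y # mid @ post; i = length pre in vs[i := vs ! Suc i, Suc i := vs ! i])"
    by (simp add: Let_def nth_append list_update_append)
  also have "\<omega> \<dots> = - \<omega> (pre @ x # y # mid @ post)"
    unfolding Let_def using Cons.prems by (intro alt_forms_swap [OF \<omega> S]) auto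
  finally show ?case by simp
qed

text \<open>This is the exterior product of \<alpha> and \<omega>, expanded along the argument given
  to \<alpha>; the \<open>if\<close> keeps the convention of extension by zero off
  \<open>S\<close>.\<close>

lemma alt_forms_wedge_functional:
  assumes \<omega>: "\<omega> \<in> alt_forms k S" and S: "subspace S" and \<alpha>: "linear \<alpha>"
  shows "(\<lambda>w. if set w \<subseteq> S then \<Sum>m<length w. (-1) ^ m * \<alpha> (w ! m) * \<omega> (take m w @ drop (Suc m) w) else 0)
    \<in> alt_forms (Suc k) S" (is "?\<Psi> \<in> _")
proof (rule alt_formsI)
  fix vs i u v a b assume vs: "length vs = Suc k" "set vs \<subseteq> S" and i: "i < Suc k" and uv: "u \<in> S" "v \<in> S"
  have abS: "a *\<^sub>R u + b *\<^sub>R v \<in> S" using uv S by (simp add: subspace_add subspace_scale)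
  have upd: "set (vs[i := x]) \<subseteq> S" if "x \<in> S" for x
    using vs(2) that set_update_subset_insert by fastforce
  define del where "del = (\<lambda>m w :: 'a list. take m w @ drop (Suc m) w)"
  have "\<alpha> (vs[i := a *\<^sub>R u + b *\<^sub>R v] ! m) * \<omega> (del m (vs[i := a *\<^sub>R u + b *\<^sub>R v])) =
      a * (\<alpha> (vs[i := u] ! m) * \<omega> (del m (vs[i := u]))) + b * (\<alpha> (vs[i := v] ! m) * \<omega> (del m (vs[i := v])))"
    if m: "m < Suc k" for m
  proof (cases "m = i")
    case True
    then show ?thesis
      using vs i by (simp add: del_def linear_add [OF \<alpha>] linear_cmul [OF \<alpha>] algebra_simps)
  next
    case False
    \<comment> \<open>Position of slot \<open>i\<close> in the list from which entry
      \<open>m\<close> has been deleted.\<close>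
    define i' where "i' = (if i < m then i else i - 1)"
    have "del m (vs[i := x]) = (del m vs)[i' := x]" for x
      using False vs i m
      by (auto simp: del_def i'_def list_update_append drop_update_swap take_update_swap drop_update_cancel list_update_beyond min_def)
    moreover have "set (del m vs) \<subseteq> S"
      using vs(2) set_take_subset [of m vs] set_drop_subset [of "Suc m" vs] by (auto simp: del_def)
    moreover have "length (del m vs) = k" "i' < k"
      using False vs i m by (auto simp: del_def i'_def)
    ultimately show ?thesis
      using False uv by (simp add: alt_forms_linear [OF \<omega>] algebra_simps)
  qed
  then have "(\<Sum>m<Suc k. (-1) ^ m * (\<alpha> (vs[i := a *\<^sub>R u + b *\<^sub>R v] ! m) * \<omega> (del m (vs[i := a *\<^sub>R u + b *\<^sub>R v])))) =
      (\<Sum>m<Suc k. a * ((-1) ^ m * (\<alpha> (vs[i := u] ! m) * \<omega> (del m (vs[i := u])))) +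
        b * ((-1) ^ m * (\<alpha> (vs[i := v] ! m) * \<omega> (del m (vs[i := v])))))"
    by (intro sum.cong) (auto simp: algebra_simps)
  then show "?\<Psi> (vs[i := a *\<^sub>R u + b *\<^sub>R v]) = a * ?\<Psi> (vs[i := u]) + b * ?\<Psi> (vs[i := v])"
    using upd uv abS vs by (simp add: del_def sum.distrib sum_distrib_left mult.assoc del: sum.lessThan_Suc)
next
  fix vs i j assume vs: "length vs = Suc k" "set vs \<subseteq> S" and ij: "i < j" "j < Suc k" "vs ! i = vs ! j"
  define del where "del = (\<lambda>m w :: 'a list. take m w @ drop (Suc m) w)"
  define x where "x = vs ! i"
  define pre mid post where "pre = take i vs" "mid = take (j - Suc i) (drop (Suc i) vs)" "post = drop (Suc j) vs"
  have "drop (Suc i) vs = mid @ x # post"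
  proof -
    have "drop (Suc i) vs ! (j - Suc i) = x" using ij vs by (simp add: x_def)
    then have "drop (Suc i) vs = mid @ x # drop (Suc (j - Suc i)) (drop (Suc i) vs)"
      using ij vs by (subst id_take_nth_drop [of "j - Suc i" "drop (Suc i) vs"]) (auto simp: pre_mid_post_def)
    then show ?thesis using ij by (simp add: pre_mid_post_def)
  qed
  then have dec: "vs = pre @ x # mid @ x # post"
    using id_take_nth_drop [of i vs] ij vs by (simp add: pre_mid_post_def x_def)
  have lens: "length pre = i" "length mid = j - Suc i" using ij vs by (auto simp: pre_mid_post_def)
  have di: "del i vs = pre @ mid @ x # post" unfolding del_def dec using lens by simp
  have dj: "del j vs = pre @ x # mid @ post"
    unfolding del_def dec using lens ij by (simp add: take_Cons' drop_Cons')
  \<comment> \<open>Deleting any other entry leaves both equal entries in the list.\<close>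
  have 0: "\<omega> (del m vs) = 0" if m: "m \<in> {..<Suc k} - {i, j}" for m
  proof -
    define i' j' where "i' = (if i < m then i else i - 1)" "j' = (if j < m then j else j - 1)"
    have "i' < length (del m vs)" "j' < length (del m vs)" "i' \<noteq> j'"
      using m ij vs by (auto simp: del_def i'_j'_def)
    moreover have "del m vs ! i' = vs ! i" "del m vs ! j' = vs ! j"
      using m ij vs by (auto simp: del_def i'_j'_def nth_append)
    ultimately show ?thesis using ij(3) alt_forms_repeat [OF \<omega>] by metis
  qed
  \<comment> \<open>Deleting \<open>i\<close> or \<open>j\<close> leaves the same entries, except
    that \<open>x\<close> has moved across \<open>mid\<close>; together with the signs of the
    expansion the two summands become opposite.\<close>
  have "\<omega> (del i vs) = (-1) ^ (j - Suc i) * \<omega> (del j vs)"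
    unfolding di dj lens(2) [symmetric] using vs dec by (intro alt_forms_move [OF \<omega> S]) auto
  moreover have "(-1::real) ^ j = - ((-1) ^ i * (-1) ^ (j - Suc i))"
  proof -
    have "j = Suc (i + (j - Suc i))" using ij by simp
    then show ?thesis by (metis power_Suc power_add mult_minus1)
  qed
  moreover have "((-1::real) ^ (j - Suc i)) * (-1) ^ (j - Suc i) = 1"
    by (simp add: power_mult_distrib [symmetric])
  ultimately have "(\<Sum>m\<in>{i, j}. (-1) ^ m * \<alpha> (vs ! m) * \<omega> (del m vs)) = 0"
    using ij by (simp add: algebra_simps)
  moreover have "(\<Sum>m<Suc k. (-1) ^ m * \<alpha> (vs ! m) * \<omega> (del m vs)) =
      (\<Sum>m\<in>{i, j}. (-1) ^ m * \<alpha> (vs ! m) * \<omega> (del m vs))"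
    by (rule sum.mono_neutral_right) (use ij 0 in auto)
  ultimately show "?\<Psi> vs = 0" using vs by (simp add: del_def del: sum.lessThan_Suc)
next
  fix vs assume "\<not> (length vs = Suc k \<and> set vs \<subseteq> S)"
  then show "?\<Psi> vs = 0"
    by (auto intro!: sum.neutral alt_forms_outside [OF \<omega>])
qed

text \<open>The exterior product has degree one more than the number of generators, so there is no
  list of distinct generators on which to test it.\<close>

lemma top_form_wedge_functional_eq_0:
  assumes \<omega>: "\<omega> \<in> alt_forms (length B) S" and S: "subspace S" and \<alpha>: "linear \<alpha>"
    and B: "span (set B) = S" and w: "set w \<subseteq> S"
  shows "(\<Sum>m<length w. (-1) ^ m * \<alpha> (w ! m) * \<omega> (take m w @ drop (Suc m) w)) = 0"
proof -
  have "(if set w \<subseteq> S then \<Sum>m<length w. (-1) ^ m * \<alpha> (w ! m) * \<omega> (take m w @ drop (Suc m) w) else 0) = 0"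
  proof (rule alt_forms_eq_0_distinct [OF alt_forms_wedge_functional [OF \<omega> S \<alpha>] S B])
    fix vs :: "'a list" assume "length vs = Suc (length B)" "set vs \<subseteq> set B" "distinct vs"
    then have "Suc (length B) \<le> card (set B)" by (metis card_mono distinct_card finite_set)
    then show "(if set vs \<subseteq> S then \<Sum>m<length vs. (-1) ^ m * \<alpha> (vs ! m) * \<omega> (take m vs @ drop (Suc m) vs) else 0) = 0"
      using card_length [of B] by simp
  qed
  then show ?thesis using w by simp
qed

subsection \<open>Exterior products of covectors\<close>

lemma alt_forms_wedge_covectors:
  assumes lin: "\<And>\<alpha>. \<alpha> \<in> set \<alpha>s \<Longrightarrow> linear \<alpha>"
  shows "wedge_covectors \<alpha>s \<in> alt_forms (length \<alpha>s) UNIV"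
proof (rule alt_formsI)
  define k where "k = length \<alpha>s"
  fix vs :: "'a list" and u v :: 'a and i a b assume vs: "length vs = length \<alpha>s" and i: "i < length \<alpha>s"
  have *: "(\<Prod>j<k. (\<alpha>s ! j) (vs[i := a *\<^sub>R u + b *\<^sub>R v] ! \<sigma> j)) =
      a * (\<Prod>j<k. (\<alpha>s ! j) (vs[i := u] ! \<sigma> j)) + b * (\<Prod>j<k. (\<alpha>s ! j) (vs[i := v] ! \<sigma> j))"
    if \<sigma>: "\<sigma> permutes {..<k}" for \<sigma>
  proof -
    \<comment> \<open>The index of the factor whose argument is slot \<open>i\<close>; this factor
      alone depends on the new entry.\<close>
    define m where "m = inv_into UNIV \<sigma> i"
    have m: "m < k" "\<sigma> m = i"
      using \<sigma> i permutes_in_image [OF permutes_inv [OF \<sigma>], of i] by (auto simp: m_def k_def permutes_inverses)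
    have other: "\<sigma> j \<noteq> i" if "j \<noteq> m" for j
      using \<sigma> that m(2) by (metis permutes_inj injD)
    have sp: "(\<Prod>j<k. (\<alpha>s ! j) (vs[i := x] ! \<sigma> j)) =
        (\<alpha>s ! m) x * (\<Prod>j\<in>{..<k} - {m}. (\<alpha>s ! j) (vs ! \<sigma> j))" for x
    proof -
      have "(\<Prod>j\<in>{..<k} - {m}. (\<alpha>s ! j) (vs[i := x] ! \<sigma> j)) = (\<Prod>j\<in>{..<k} - {m}. (\<alpha>s ! j) (vs ! \<sigma> j))"
      proof (intro prod.cong refl)
        fix j assume "j \<in> {..<k} - {m}"
        then have "\<sigma> j \<noteq> i" using other by auto
        then show "(\<alpha>s ! j) (vs[i := x] ! \<sigma> j) = (\<alpha>s ! j) (vs ! \<sigma> j)" by simp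
      qed
      then show ?thesis using m i vs by (subst prod.remove [of _ m]) auto
    qed
    have "linear (\<alpha>s ! m)" using m lin by (simp add: k_def)
    then show ?thesis unfolding sp by (simp add: linear_add linear_cmul algebra_simps)
  qed
  show "wedge_covectors \<alpha>s (vs[i := a *\<^sub>R u + b *\<^sub>R v]) =
      a * wedge_covectors \<alpha>s (vs[i := u]) + b * wedge_covectors \<alpha>s (vs[i := v])"
    using vs * by (simp add: wedge_covectors_def k_def sum_distrib_left sum.distrib [symmetric] algebra_simps)
next
  define k where "k = length \<alpha>s"
  fix vs :: "'a list" and i j assume vs: "length vs = length \<alpha>s" and ij: "i < j" "j < length \<alpha>s" "vs ! i = vs ! j"
  let ?t = "Transposition.transpose i j"
  have tp: "?t permutes {..<k}" using ij by (auto intro: permutes_swap_id simp: k_def)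
  define F where "F = (\<lambda>\<sigma>. of_int (sign \<sigma>) * (\<Prod>m<k. (\<alpha>s ! m) (vs ! \<sigma> m)))"
  \<comment> \<open>Composition with the transposition of the two equal slots keeps the product and
    reverses the sign, so the sum equals its own negative.\<close>
  have "F (?t \<circ> \<sigma>) = - F \<sigma>" if \<sigma>: "\<sigma> permutes {..<k}" for \<sigma>
  proof -
    have "permutation \<sigma>" "permutation ?t" using \<sigma> tp permutation_permutes by blast+
    then have "sign (?t \<circ> \<sigma>) = - sign \<sigma>" using ij by (simp add: sign_compose sign_swap_id)
    moreover have "vs ! ?t m = vs ! m" for m using ij by (auto simp: Transposition.transpose_def)
    ultimately show ?thesis by (simp add: F_def)
  qed
  then have "(\<Sum>\<sigma> | \<sigma> permutes {..<k}. F \<sigma>) = (\<Sum>\<sigma> | \<sigma> permutes {..<k}. - F \<sigma>)"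
    by (intro sum.reindex_bij_witness [where i = "(\<circ>) ?t" and j = "(\<circ>) ?t"])
      (auto simp: o_assoc [symmetric] fun_eq_iff intro: permutes_compose tp)
  then have "(\<Sum>\<sigma> | \<sigma> permutes {..<k}. F \<sigma>) = 0" by (simp add: sum_negf)
  then show "wedge_covectors \<alpha>s vs = 0" using vs by (simp add: wedge_covectors_def F_def k_def)
qed (auto simp: wedge_covectors_def)

lemma wedge_covectors_kill:
  assumes "v \<in> set vs" "\<And>\<alpha>. \<alpha> \<in> set \<alpha>s \<Longrightarrow> \<alpha> v = 0"
  shows "wedge_covectors \<alpha>s vs = 0"
proof (cases "length vs = length \<alpha>s")
  case True
  obtain i where i: "i < length \<alpha>s" "vs ! i = v" using assms(1) True by (auto simp: in_set_conv_nth)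
  have "(\<Prod>j<length \<alpha>s. (\<alpha>s ! j) (vs ! \<sigma> j)) = 0" if \<sigma>: "\<sigma> permutes {..<length \<alpha>s}" for \<sigma>
  proof -
    have "inv_into UNIV \<sigma> i < length \<alpha>s" "\<sigma> (inv_into UNIV \<sigma> i) = i"
      using \<sigma> i permutes_in_image [OF permutes_inv [OF \<sigma>], of i] by (auto simp: permutes_inverses)
    then show ?thesis using assms(2) i by (intro prod_zero bexI [of _ "inv_into UNIV \<sigma> i"]) auto
  qed
  then have "(\<Sum>\<sigma> | \<sigma> permutes {..<length \<alpha>s}.
      of_int (sign \<sigma>) * (\<Prod>j<length \<alpha>s. (\<alpha>s ! j) (vs ! \<sigma> j))) = 0"
    by (intro sum.neutral ballI) simp
  then show ?thesis by (simp only: wedge_covectors_def if_cancel)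
qed (simp add: wedge_covectors_def)

text \<open>Membership of \<sigma> in \<open>ext_power\<close> enters the proof in this form: a
  single argument tangent to the leaves already makes \<sigma> vanish.\<close>

lemma ext_power_kill:
  assumes "\<omega> \<in> ext_power k N" "v \<in> set vs" "\<And>\<alpha>. \<alpha> \<in> N \<Longrightarrow> \<alpha> v = 0"
  shows "\<omega> vs = 0"
proof -
  obtain ws where ws: "\<forall>(a, \<alpha>s)\<in>set ws. length \<alpha>s = k \<and> set \<alpha>s \<subseteq> N"
    "\<omega> vs = (\<Sum>(a, \<alpha>s)\<leftarrow>ws. a * wedge_covectors \<alpha>s vs)"
    using assms(1) by (auto simp: ext_power_def)
  have "(case w of (a, \<alpha>s) \<Rightarrow> a * wedge_covectors \<alpha>s vs) = 0" if "w \<in> set ws" for w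
  proof -
    obtain a \<alpha>s where w: "w = (a, \<alpha>s)" by fastforce
    then have "set \<alpha>s \<subseteq> N" using ws(1) that by auto
    with w show ?thesis using wedge_covectors_kill [OF assms(2), of \<alpha>s] assms(3) by auto
  qed
  then have "map (\<lambda>(a, \<alpha>s). a * wedge_covectors \<alpha>s vs) ws = map (\<lambda>_. 0) ws" by (intro map_cong) auto
  then have "(\<Sum>(a, \<alpha>s)\<leftarrow>ws. a * wedge_covectors \<alpha>s vs) = (\<Sum>_\<leftarrow>ws. 0)" by (simp only:)
  then show ?thesis using ws(2) by (simp add: sum_list_triv)
qed

subsection \<open>Orthonormal bases as lists\<close>

text \<open>Lists, because forms are evaluated on \<open>B\<close> itself; arbitrary orthonormal
  bases, because one adapted to the leaf direction has to take the place of
  \<open>Basis\<close>.\<close>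

definition onb :: "'e::euclidean_space list \<Rightarrow> bool" where
  "onb B \<longleftrightarrow> distinct B \<and> span (set B) = UNIV \<and>
     (\<forall>b\<in>set B. \<forall>b'\<in>set B. b \<bullet> b' = (if b = b' then 1 else 0))"

lemma onb_representation:
  assumes "onb B"
  shows "(\<Sum>b\<in>set B. (v \<bullet> b) *\<^sub>R b) = v"
proof -
  define w where "w = v - (\<Sum>b\<in>set B. (v \<bullet> b) *\<^sub>R b)"
  have "w \<bullet> c = 0" if "c \<in> set B" for c
  proof -
    have "(\<Sum>b\<in>set B. (v \<bullet> b) * (b \<bullet> c)) = (\<Sum>b\<in>set B. if b = c then v \<bullet> c else 0)"
      using assms that by (intro sum.cong) (auto simp: onb_def)
    then show ?thesis using that by (simp add: w_def inner_diff_left inner_sum_left)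
  qed
  then have "w \<bullet> x = 0" if "x \<in> span (set B)" for x
  proof -
    have "subspace {x. w \<bullet> x = 0}" by (auto simp: subspace_def inner_add_right)
    then have "span (set B) \<subseteq> {x. w \<bullet> x = 0}"
      using \<open>\<And>c. c \<in> set B \<Longrightarrow> w \<bullet> c = 0\<close> by (intro span_minimal) auto
    then show ?thesis using that by auto
  qed
  then have "w \<bullet> w = 0" using assms by (simp add: onb_def)
  then show ?thesis by (simp add: w_def)
qed

lemma onb_linear:
  fixes f :: "'e::euclidean_space \<Rightarrow> 'f::real_vector"
  assumes "onb B" "linear f"
  shows "f v = (\<Sum>b\<in>set B. (v \<bullet> b) *\<^sub>R f b)"
proof -
  have "f v = f (\<Sum>b\<in>set B. (v \<bullet> b) *\<^sub>R b)" by (simp only: onb_representation [OF assms(1)])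
  also have "\<dots> = (\<Sum>b\<in>set B. (v \<bullet> b) *\<^sub>R f b)"
    by (simp only: linear_sum [OF assms(2)] linear_cmul [OF assms(2)])
  finally show ?thesis .
qed

lemma onb_eqI:
  assumes "onb B" "\<And>b. b \<in> set B \<Longrightarrow> v \<bullet> b = w \<bullet> b"
  shows "v = w"
proof -
  have "(\<Sum>b\<in>set B. (v \<bullet> b) *\<^sub>R b) = (\<Sum>b\<in>set B. (w \<bullet> b) *\<^sub>R b)"
    using assms(2) by (intro sum.cong) auto
  then show ?thesis by (simp only: onb_representation [OF assms(1)])
qed

lemma onb_inner_sum:
  assumes "onb B" "b \<in> set B"
  shows "(\<Sum>c\<in>set B. f c *\<^sub>R c) \<bullet> b = f b"
proof -
  have "(\<Sum>c\<in>set B. f c * (c \<bullet> b)) = (\<Sum>c\<in>set B. if c = b then f b else 0)"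
    using assms by (intro sum.cong) (auto simp: onb_def)
  then show ?thesis using assms(2) by (simp add: inner_sum_left)
qed

lemma onb_length:
  assumes "onb (B :: 'e::euclidean_space list)"
  shows "length B = DIM('e)" "independent (set B)"
proof -
  have "b \<bullet> b = 1" if "b \<in> set B" for b using assms that by (simp add: onb_def)
  then have "0 \<notin> set B" by (metis inner_zero_left zero_neq_one)
  moreover have "pairwise orthogonal (set B)"
    using assms by (auto simp: onb_def pairwise_def orthogonal_def)
  ultimately show i: "independent (set B)" by (intro pairwise_orthogonal_independent)
  have "card (set B) = DIM('e)"
    using assms i by (metis dim_UNIV dim_eq_card onb_def span_UNIV)
  then show "length B = DIM('e)" using assms by (simp add: onb_def distinct_card)
qed

lemma exists_adapted_onb:
  fixes L :: "'e::euclidean_space set"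
  assumes L: "subspace L"
  obtains B1 B2 where "onb (B1 @ B2)" "span (set B1) = L" "length B1 = dim L"
    "length B2 = DIM('e) - dim L"
proof -
  define M where "M = {v. \<forall>x\<in>L. x \<bullet> v = 0}"
  have M: "subspace M" by (auto simp: M_def subspace_def inner_add_right)
  obtain C1 where C1: "C1 \<subseteq> L" "pairwise orthogonal C1" "\<And>x. x \<in> C1 \<Longrightarrow> norm x = 1"
    "independent C1" "card C1 = dim L" "span C1 = L"
    using orthonormal_basis_subspace [OF L] by metis
  obtain C2 where C2: "C2 \<subseteq> M" "pairwise orthogonal C2" "\<And>x. x \<in> C2 \<Longrightarrow> norm x = 1"
    "independent C2" "card C2 = dim M" "span C2 = M"
    using orthonormal_basis_subspace [OF M] by metis
  obtain B1 where B1: "set B1 = C1" "distinct B1"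
    using finite_distinct_list [OF independent_imp_finite [OF C1(4)]] by blast
  obtain B2 where B2: "set B2 = C2" "distinct B2"
    using finite_distinct_list [OF independent_imp_finite [OF C2(4)]] by blast
  have cross: "b \<bullet> c = 0" if "b \<in> C1" "c \<in> C2" for b c
    using that C1(1) C2(1) by (auto simp: M_def)
  then have cross': "c \<bullet> b = 0" if "b \<in> C1" "c \<in> C2" for b c
    using that by (simp add: inner_commute)
  have "b \<noteq> c" if "b \<in> C1" "c \<in> C2" for b c
    using cross [OF that] C1(3) [OF that(1)] by (auto simp: norm_eq_1)
  then have dist: "distinct (B1 @ B2)" using B1 B2 by auto
  have "v \<in> span (C1 \<union> C2)" for v
  proof -
    obtain y z where yz: "y \<in> span L" "\<And>w. w \<in> span L \<Longrightarrow> orthogonal z w" "v = y + z"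
      using orthogonal_subspace_decomp_exists [of L v] by metis
    have "z \<in> M" using yz(2) span_superset by (fastforce simp: M_def orthogonal_def inner_commute)
    moreover have "y \<in> L" using yz(1) L by (metis span_eq_iff)
    ultimately have "y \<in> span C1" "z \<in> span C2" using C1 C2 by auto
    then show ?thesis unfolding yz(3) by (meson span_add span_mono subsetD sup_ge1 sup_ge2)
  qed
  then have onb: "onb (B1 @ B2)"
    using dist B1 B2 C1(2,3) C2(2,3) cross cross'
    by (auto simp: onb_def pairwise_def orthogonal_def norm_eq_1)
  have l1: "length B1 = dim L" using B1 C1 distinct_card by metis
  have "length B2 = DIM('e) - dim L" using onb_length(1) [OF onb] l1 by simp
  then show ?thesis using that onb l1 B1 C1 by blast
qed

lemma exists_onb: "\<exists>B :: 'e::euclidean_space list. onb B"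
  by (rule exists_adapted_onb [OF subspace_UNIV]) blast

text \<open>Both sides have top degree, so comparison on \<open>B\<close> suffices. There
  \<open>A (B ! i)\<close> is expanded in \<open>B\<close>, and every coefficient but the diagonal
  one multiplies a list with a repetition. This is the origin of the trace in the
  divergence.\<close>

lemma trace_form:
  assumes B: "onb B" and \<omega>: "\<omega> \<in> alt_forms (length B) UNIV" and A: "linear A"
  shows "(\<Sum>i<length us. \<omega> (us[i := A (us ! i)])) = (\<Sum>b\<in>set B. A b \<bullet> b) * \<omega> us"
proof -
  have BI: "b \<bullet> b' = (if b = b' then 1 else 0)" if "b \<in> set B" "b' \<in> set B" for b b'
    using B that by (auto simp: onb_def)
  have dB: "distinct B" using B by (simp add: onb_def)
  have slot: "\<omega> (B[i := A (B ! i)]) = (A (B ! i) \<bullet> (B ! i)) * \<omega> B" if i: "i < length B" for i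
  proof -
    have "\<omega> (B[i := A (B ! i)]) = (\<Sum>b\<in>set B. (A (B ! i) \<bullet> b) * \<omega> (B[i := b]))"
      using onb_linear [OF B alt_forms_slot_linear [OF \<omega> i, of B], of "A (B ! i)"] by simp
    also have "\<dots> = (\<Sum>b\<in>set B. if b = B ! i then (A (B ! i) \<bullet> b) * \<omega> B else 0)"
    proof (rule sum.cong [OF refl])
      fix b assume "b \<in> set B"
      then obtain j where j: "j < length B" "B ! j = b" by (auto simp: in_set_conv_nth)
      show "(A (B ! i) \<bullet> b) * \<omega> (B[i := b]) = (if b = B ! i then (A (B ! i) \<bullet> b) * \<omega> B else 0)"
      proof (cases "j = i")
        case False
        then have "\<omega> (B[i := b]) = 0" using i j by (intro alt_forms_repeat [OF \<omega>, of i _ j]) auto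
        moreover have "b \<noteq> B ! i" using False i j dB by (auto simp: nth_eq_iff_index_eq)
        ultimately show ?thesis by simp
      qed (use j in auto)
    qed
    also have "\<dots> = (A (B ! i) \<bullet> (B ! i)) * \<omega> B" using i by simp
    finally show ?thesis .
  qed
  have tr: "(\<Sum>i<length B. A (B ! i) \<bullet> (B ! i)) = (\<Sum>b\<in>set B. A b \<bullet> b)"
    using sum.reindex_bij_betw [OF bij_betw_nth [OF dB refl refl]] .
  have "(\<lambda>us. 1 * (\<Sum>i<length us. \<omega> (us[i := A (us ! i)])) + (- (\<Sum>b\<in>set B. A b \<bullet> b)) * \<omega> us) \<in> alt_forms (length B) UNIV"
    by (rule alt_forms_lincomb [OF alt_forms_derivation [OF \<omega> A] \<omega>])
  from alt_forms_eq_0 [OF this subspace_UNIV, of "{}" us]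
  show ?thesis using B slot tr by (simp add: onb_def sum_distrib_right [symmetric])
qed

subsection \<open>Differentiation of forms along varying arguments\<close>

text \<open>Product rule for a form whose coefficients and arguments all vary with \<open>s\<close>.
  Smoothness of \<open>F\<close> is known for constant arguments only, so the slots are made
  variable one at a time: those below \<open>j\<close> carry \<open>w i s\<close>, the others stay
  at \<open>us ! i\<close>.\<close>

lemma multilinear_smooth_aux:
  fixes F :: "'e::euclidean_space list \<Rightarrow> 's::real_normed_vector \<Rightarrow> real" and w :: "nat \<Rightarrow> 's \<Rightarrow> 'e"
  assumes F: "\<forall>\<^sub>F s in nhds t. (\<lambda>us. F us s) \<in> alt_forms k UNIV" and sm: "\<And>us. smooth_at t (F us)"
    and w: "\<And>i. i < k \<Longrightarrow> smooth_at t (w i)" and us: "length us = k"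
  shows "j \<le> k \<Longrightarrow> smooth_at t (\<lambda>s. F (map (\<lambda>i. if i < j then w i s else us ! i) [0..<k]) s) \<and>
    ((\<lambda>s. F (map (\<lambda>i. if i < j then w i s else us ! i) [0..<k]) s) has_derivative
      (\<lambda>h. fd (F (map (\<lambda>i. if i < j then w i t else us ! i) [0..<k])) t h +
        (\<Sum>i<j. F ((map (\<lambda>i. if i < j then w i t else us ! i) [0..<k])[i := fd (w i) t h]) t))) (at t)"
  using us
proof (induction j arbitrary: us)
  case 0
  then have "map (\<lambda>i. if i < 0 then w i s else us ! i) [0..<k] = us" for s
    using map_nth by auto
  moreover have "(F us has_derivative (\<lambda>h. fd (F us) t h)) (at t)"
    using smooth_at_has_derivative [OF sm, of us] by simp
  ultimately show ?case using sm by simp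
next
  case (Suc j)
  define l where "l = (\<lambda>j us s. map (\<lambda>i. if i < j then w i s else us ! i) [0..<k])"
  have jk: "j < k" using Suc.prems by simp
  have l_Suc: "l (Suc j) us s = (l j us s)[j := w j s]" for s
    using jk by (intro nth_equalityI) (auto simp: l_def nth_list_update)
  have l_upd: "l j (us[j := b]) s = (l j us s)[j := b]" for s b
    using jk Suc.prems by (intro nth_equalityI) (auto simp: l_def nth_list_update)
  have len: "length (l j us s) = k" for j us s by (simp add: l_def)
  define G where "G = (\<lambda>b s. F (l j (us[j := b]) s) s)"
  define DG where "DG = (\<lambda>b h. fd (F (l j (us[j := b]) t)) t h +
      (\<Sum>i<j. F ((l j (us[j := b]) t)[i := fd (w i) t h]) t))"
  have G: "smooth_at t (G b)" "(G b has_derivative DG b) (at t)" for b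
    using Suc.IH [of "us[j := b]"] Suc.prems unfolding G_def DG_def l_def by auto
  have Ft: "(\<lambda>us. F us t) \<in> alt_forms k UNIV" using eventually_nhds_x_imp_x [OF F] .
  have expand: "F ((l j us s)[j := u]) s = (\<Sum>b\<in>Basis. (u \<bullet> b) * F ((l j us s)[j := b]) s)"
    if "(\<lambda>us. F us s) \<in> alt_forms k UNIV" for s u
    using linear_real_sum_Basis [OF alt_forms_slot_linear [OF that jk]] .
  have ev: "\<forall>\<^sub>F s in nhds t. (\<Sum>b\<in>Basis. (w j s \<bullet> b) * G b s) = F (l (Suc j) us s) s"
    using F by eventually_elim (unfold G_def l_upd l_Suc, rule expand [symmetric])
  have "smooth_at t (\<lambda>s. \<Sum>b\<in>Basis. (w j s \<bullet> b) * G b s)"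
    using w [OF jk] G(1) by (intro smooth_at_sum smooth_at_mult smooth_at_inner) auto
  from smooth_at_cong [OF ev this] have 1: "smooth_at t (\<lambda>s. F (l (Suc j) us s) s)" .
  \<comment> \<open>The derivative of \<open>F\<close> in \<open>s\<close> is again linear in slot
    \<open>j\<close>; this reassembles the first summand after the expansion in
    \<open>Basis\<close>.\<close>
  have fd_slot: "fd (F (vs[j := u])) t h = (\<Sum>b\<in>Basis. (u \<bullet> b) * fd (F (vs[j := b])) t h)" for vs u h
  proof -
    have ev': "\<forall>\<^sub>F s in nhds t. (\<Sum>b\<in>Basis. (u \<bullet> b) * F (vs[j := b]) s) = F (vs[j := u]) s"
      using F by eventually_elim
        (rule linear_real_sum_Basis [OF alt_forms_slot_linear [OF _ jk], symmetric])
    have d': "((\<lambda>s. \<Sum>b\<in>Basis. (u \<bullet> b) * F (vs[j := b]) s) has_derivative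
        (\<lambda>h. \<Sum>b\<in>Basis. (u \<bullet> b) * fd (F (vs[j := b])) t h)) (at t)"
      by (intro has_derivative_sum has_derivative_mult_right smooth_at_has_derivative sm)
    show ?thesis by (rule fun_cong [OF fd_eqI [OF has_derivative_cong_nhds [OF ev' d']]])
  qed
  have "((\<lambda>s. \<Sum>b\<in>Basis. (w j s \<bullet> b) * G b s) has_derivative
      (\<lambda>h. \<Sum>b\<in>Basis. (w j t \<bullet> b) * DG b h + (fd (w j) t h \<bullet> b) * G b t)) (at t)"
    by (intro has_derivative_sum has_derivative_mult has_derivative_inner_left G(2)
        smooth_at_has_derivative [OF w [OF jk]])
  moreover have "(\<Sum>b\<in>Basis. (w j t \<bullet> b) * DG b h + (fd (w j) t h \<bullet> b) * G b t) =
      fd (F (l (Suc j) us t)) t h + (\<Sum>i<Suc j. F ((l (Suc j) us t)[i := fd (w i) t h]) t)" for h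
  proof -
    have c1: "(\<Sum>b\<in>Basis. (w j t \<bullet> b) * fd (F (l j (us[j := b]) t)) t h) = fd (F (l (Suc j) us t)) t h"
      unfolding l_upd l_Suc by (rule fd_slot [symmetric])
    have slot: "(\<Sum>b\<in>Basis. (w j t \<bullet> b) * F ((l j (us[j := b]) t)[i := u]) t) =
        F ((l (Suc j) us t)[i := u]) t" if "i < j" for i u
      unfolding l_upd l_Suc
      using linear_real_sum_Basis [OF alt_forms_slot_linear [OF Ft jk, of "(l j us t)[i := u]"], of "w j t"] that
      by (simp add: list_update_swap [of i j])
    have c3: "(\<Sum>b\<in>Basis. (fd (w j) t h \<bullet> b) * G b t) = F ((l (Suc j) us t)[j := fd (w j) t h]) t"
      unfolding G_def l_upd l_Suc list_update_overwrite by (rule expand [OF Ft, symmetric])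
    have c2: "(\<Sum>b\<in>Basis. (w j t \<bullet> b) * (\<Sum>i<j. F ((l j (us[j := b]) t)[i := fd (w i) t h]) t)) =
        (\<Sum>i<j. F ((l (Suc j) us t)[i := fd (w i) t h]) t)"
      unfolding sum_distrib_left by (subst sum.swap, rule sum.cong [OF refl], rule slot) simp
    show ?thesis
      unfolding DG_def by (simp only: sum.distrib distrib_left c1 c2 c3 sum.lessThan_Suc add.assoc)
  qed
  ultimately have "((\<lambda>s. \<Sum>b\<in>Basis. (w j s \<bullet> b) * G b s) has_derivative
      (\<lambda>h. fd (F (l (Suc j) us t)) t h + (\<Sum>i<Suc j. F ((l (Suc j) us t)[i := fd (w i) t h]) t))) (at t)"
    by (rule has_derivative_eq_rhs [OF _ ext])
  from has_derivative_cong_nhds [OF ev this] 1 show ?case unfolding l_def by blast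
qed

lemma multilinear_smooth:
  fixes F :: "'e::euclidean_space list \<Rightarrow> 's::real_normed_vector \<Rightarrow> real"
  assumes F: "\<forall>\<^sub>F s in nhds t. (\<lambda>us. F us s) \<in> alt_forms k UNIV" and sm: "\<And>us. smooth_at t (F us)"
    and w: "\<And>u. u \<in> set us \<Longrightarrow> smooth_at t (w u)" and us: "length us = k"
  shows "smooth_at t (\<lambda>s. F (map (\<lambda>u. w u s) us) s)"
    and "((\<lambda>s. F (map (\<lambda>u. w u s) us) s) has_derivative
      (\<lambda>h. fd (F (map (\<lambda>u. w u t) us)) t h +
        (\<Sum>i<k. F ((map (\<lambda>u. w u t) us)[i := fd (w (us ! i)) t h]) t))) (at t)"
proof -
  have *: "map (\<lambda>i. if i < k then w (us ! i) s else v ! i) [0..<k] = map (\<lambda>u. w u s) us" for s and v :: "'e list"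
    using us by (intro nth_equalityI) auto
  have "smooth_at t (w (us ! i))" if "i < k" for i using w us that by auto
  \<comment> \<open>For \<open>j = k\<close> no slot is left fixed, so the list of zeros is a mere
    placeholder.\<close>
  from multilinear_smooth_aux [OF F sm this, of "\<lambda>i. i" "replicate k 0" k] *
  show "smooth_at t (\<lambda>s. F (map (\<lambda>u. w u s) us) s)"
    and "((\<lambda>s. F (map (\<lambda>u. w u s) us) s) has_derivative
      (\<lambda>h. fd (F (map (\<lambda>u. w u t) us)) t h +
        (\<Sum>i<k. F ((map (\<lambda>u. w u t) us)[i := fd (w (us ! i)) t h]) t))) (at t)"
    by auto
qed

subsection \<open>Charts and transition maps\<close>

text \<open>Differentiating a vector pushed forward by \<phi> produces, besides the push-forward of
  its derivative, a second derivative of \<phi>; this is the term that makes derivatives of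
  components depend on the chart.\<close>

lemma smooth_at_fd_apply:
  fixes \<phi> :: "'e::euclidean_space \<Rightarrow> 'f::euclidean_space" and w :: "'e \<Rightarrow> 'e"
  assumes \<phi>: "smooth_at t \<phi>" and w: "smooth_at t w"
  shows "smooth_at t (\<lambda>s. fd \<phi> s (w s))"
    and "fd (\<lambda>s. fd \<phi> s (w s)) t h = fd (\<lambda>s. fd \<phi> s (w t)) t h + fd \<phi> t (fd w t h)"
proof -
  have rep: "fd \<phi> s v = (\<Sum>b\<in>Basis. (v \<bullet> b) *\<^sub>R fd \<phi> s b)" if "smooth_at s \<phi>" for s v
  proof -
    have "fd \<phi> s v = fd \<phi> s (\<Sum>b\<in>Basis. (v \<bullet> b) *\<^sub>R b)" by (simp add: euclidean_representation)
    then show ?thesis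
      by (simp only: linear_sum [OF smooth_at_linear_fd [OF that]] linear_cmul [OF smooth_at_linear_fd [OF that]])
  qed
  have ev: "\<forall>\<^sub>F s in nhds t. (\<Sum>b\<in>Basis. (w s \<bullet> b) *\<^sub>R fd \<phi> s b) = fd \<phi> s (w s)"
    using eventually_smooth_at [OF \<phi>] by eventually_elim (rule rep [symmetric])
  have "smooth_at t (\<lambda>s. \<Sum>b\<in>Basis. (w s \<bullet> b) *\<^sub>R fd \<phi> s b)"
    by (intro smooth_at_sum smooth_at_scaleR smooth_at_inner smooth_at_fd \<phi> w smooth_at_const)
  from smooth_at_cong [OF ev this] show "smooth_at t (\<lambda>s. fd \<phi> s (w s))" .
  have ev': "\<forall>\<^sub>F s in nhds t. (\<Sum>b\<in>Basis. (w t \<bullet> b) *\<^sub>R fd \<phi> s b) = fd \<phi> s (w t)"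
    using eventually_smooth_at [OF \<phi>] by eventually_elim (rule rep [symmetric])
  have d': "((\<lambda>s. \<Sum>b\<in>Basis. (w t \<bullet> b) *\<^sub>R fd \<phi> s b) has_derivative
      (\<lambda>h. \<Sum>b\<in>Basis. (w t \<bullet> b) *\<^sub>R fd (\<lambda>s. fd \<phi> s b) t h)) (at t)"
    by (intro has_derivative_sum has_derivative_scaleR_right smooth_at_has_derivative smooth_at_fd \<phi>)
  have d: "((\<lambda>s. \<Sum>b\<in>Basis. (w s \<bullet> b) *\<^sub>R fd \<phi> s b) has_derivative
      (\<lambda>h. \<Sum>b\<in>Basis. (w t \<bullet> b) *\<^sub>R fd (\<lambda>s. fd \<phi> s b) t h + (fd w t h \<bullet> b) *\<^sub>R fd \<phi> t b)) (at t)"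
    by (intro has_derivative_sum has_derivative_scaleR has_derivative_inner_left
        smooth_at_has_derivative smooth_at_fd \<phi> w)
  show "fd (\<lambda>s. fd \<phi> s (w s)) t h = fd (\<lambda>s. fd \<phi> s (w t)) t h + fd \<phi> t (fd w t h)"
    unfolding fd_eqI [OF has_derivative_cong_nhds [OF ev d]] fd_eqI [OF has_derivative_cong_nhds [OF ev' d']]
      sum.distrib rep [OF \<phi>, of "fd w t h"] by (rule refl)
qed

lemma fd_compose:
  fixes f :: "'a::euclidean_space \<Rightarrow> 'b::euclidean_space"
  assumes "smooth_at t f" "smooth_at (f t) g"
  shows "fd (\<lambda>s. g (f s)) t v = fd g (f t) (fd f t v)"
  using fd_eqI [OF has_derivative_compose [OF smooth_at_has_derivative [OF assms(1)]
        smooth_at_has_derivative [OF assms(2)]]] by simp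

context
  fixes c :: "('a::t2_space, 'e::euclidean_space) chart"
  assumes c: "is_chart c"
begin

lemma chart_inv_map [simp]: "x \<in> chart_dom c \<Longrightarrow> chart_inv c (chart_map c x) = x"
  using c by (auto simp: is_chart_def homeomorphism_def)

lemma chart_map_inv: "s \<in> chart_img c \<Longrightarrow> chart_map c (chart_inv c s) = s"
  using c by (auto simp: is_chart_def homeomorphism_def)

lemma chart_inv_in: "s \<in> chart_img c \<Longrightarrow> chart_inv c s \<in> chart_dom c"
  using c by (auto simp: is_chart_def homeomorphism_def)

lemma chart_map_in: "x \<in> chart_dom c \<Longrightarrow> chart_map c x \<in> chart_img c"
  by (auto simp: chart_img_def)

lemma eventually_chart_map:
  assumes "x \<in> chart_dom c" "\<forall>\<^sub>F s in nhds (chart_map c x). P s"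
  shows "\<forall>\<^sub>F y in nhds x. P (chart_map c y)"
proof -
  have "continuous_on (chart_dom c) (chart_map c)" "open (chart_dom c)"
    using c by (auto simp: is_chart_def homeomorphism_def)
  then have "isCont (chart_map c) x" using assms(1) by (simp add: continuous_on_eq_continuous_at)
  then have "filterlim (chart_map c) (nhds (chart_map c x)) (nhds x)"
    by (simp add: isCont_def tendsto_at_iff_tendsto_nhds)
  then show ?thesis using assms(2) by (rule eventually_compose_filterlim [rotated])
qed

lemma eventually_chart_dom: "x \<in> chart_dom c \<Longrightarrow> \<forall>\<^sub>F y in nhds x. y \<in> chart_dom c"
  using c by (auto simp: is_chart_def eventually_nhds)

lemma eventually_chart_img: "x \<in> chart_dom c \<Longrightarrow> \<forall>\<^sub>F s in nhds (chart_map c x). s \<in> chart_img c"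
  using c chart_map_in by (auto simp: is_chart_def eventually_nhds)

text \<open>The bridge from the manifold to coordinates. The predicate has two arguments so that the
  point and its coordinate can both be mentioned.\<close>

lemma eventually_chart:
  assumes x: "x \<in> chart_dom c" and P: "\<forall>\<^sub>F y in nhds x. P y (chart_map c y)"
  shows "\<forall>\<^sub>F s in nhds (chart_map c x). P (chart_inv c s) s"
proof -
  have "continuous_on (chart_img c) (chart_inv c)" "open (chart_img c)"
    using c by (auto simp: is_chart_def homeomorphism_def)
  then have "isCont (chart_inv c) (chart_map c x)"
    using x chart_map_in by (simp add: continuous_on_eq_continuous_at)
  then have "filterlim (chart_inv c) (nhds (chart_inv c (chart_map c x))) (nhds (chart_map c x))"
    unfolding isCont_def tendsto_at_iff_tendsto_nhds .
  then have "filterlim (chart_inv c) (nhds x) (nhds (chart_map c x))" using x by simp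
  from eventually_compose_filterlim [OF P this] eventually_chart_img [OF x]
  show ?thesis by eventually_elim (simp add: chart_map_inv)
qed

lemma open_overlap:
  assumes "is_chart c'"
  shows "open (overlap c c')"
proof -
  have "overlap c c' = chart_inv c -` chart_dom c' \<inter> chart_img c"
    by (auto simp: overlap_def chart_map_in chart_map_inv chart_inv_in intro!: rev_image_eqI)
  moreover have "continuous_on (chart_img c) (chart_inv c)" "open (chart_img c)" "open (chart_dom c')"
    using c assms by (auto simp: is_chart_def homeomorphism_def)
  ultimately show ?thesis by (simp add: continuous_on_open_vimage)
qed

end

text \<open>Foliated charts need not belong to \<open>A\<close>, only be compatible with it; the
  coordinate formulas are proved for all such charts.\<close>

definition admissible :: "('a::topological_space, 'e::euclidean_space) chart set \<Rightarrow> ('a, 'e) chart \<Rightarrow> bool" where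
  "admissible A c \<longleftrightarrow> is_chart c \<and> (\<forall>a\<in>A. compatible c a)"

locale atlas =
  fixes A :: "('a::t2_space, 'e::euclidean_space) chart set"
  assumes atlas: "smooth_atlas A"
begin

abbreviation "adm \<equiv> admissible A"

lemma adm_atlas: "c \<in> A \<Longrightarrow> adm c"
  using atlas by (auto simp: admissible_def smooth_atlas_def)

lemma adm_chart: "adm c \<Longrightarrow> is_chart c"
  by (simp add: admissible_def)

lemma base_chart: "base_chart A x \<in> A" "x \<in> chart_dom (base_chart A x)" "adm (base_chart A x)"
proof -
  have "\<exists>c. c \<in> A \<and> x \<in> chart_dom c" using atlas by (auto simp: smooth_atlas_def)
  from someI_ex [OF this] show "base_chart A x \<in> A" "x \<in> chart_dom (base_chart A x)"
    by (auto simp: base_chart_def)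
  then show "adm (base_chart A x)" by (simp add: adm_atlas)
qed

lemmas inv_map [simp] = chart_inv_map [OF adm_chart]
lemmas map_in = chart_map_in [OF adm_chart]
lemmas map_inv = chart_map_inv [OF adm_chart]
lemmas inv_in = chart_inv_in [OF adm_chart]
lemmas ev_dom = eventually_chart_dom [OF adm_chart]
lemmas ev_img = eventually_chart_img [OF adm_chart]
lemmas ev_chart = eventually_chart [OF adm_chart]
lemmas ev_map = eventually_chart_map [OF adm_chart]

lemma transition_map: "adm c \<Longrightarrow> x \<in> chart_dom c \<Longrightarrow> transition c c' (chart_map c x) = chart_map c' x"
  by (simp add: transition_def)

lemma transition_transition:
  assumes "adm c" "adm c'" "x \<in> chart_dom c" "x \<in> chart_dom c'"
  shows "\<forall>\<^sub>F s in nhds (chart_map c x). transition c' c'' (transition c c' s) = transition c c'' s"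
  by (rule ev_chart [OF assms(1,3)], use ev_dom [OF assms(1,3)] ev_dom [OF assms(2,4)] in eventually_elim)
    (use assms in \<open>simp add: transition_map transition_def\<close>)

text \<open>Admissible charts are compatible with those of \<open>A\<close>, not by assumption with
  one another, so the transition is factored through the base chart.\<close>

lemma smooth_transition:
  assumes c: "adm c" "x \<in> chart_dom c" and c': "adm c'" "x \<in> chart_dom c'"
  shows "smooth_at (chart_map c x) (transition c c')"
proof -
  define b where "b = base_chart A x"
  have b: "b \<in> A" "adm b" "x \<in> chart_dom b" using base_chart by (auto simp: b_def)
  have 1: "smooth_at (chart_map c x) (transition c b)"
    using c b open_overlap [OF adm_chart [OF c(1)] adm_chart [OF b(2)]]
    by (intro smooth_atI [of "overlap c b"]) (auto simp: admissible_def compatible_def overlap_def)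
  have 2: "smooth_at (chart_map b x) (transition b c')"
    using c' b open_overlap [OF adm_chart [OF b(2)] adm_chart [OF c'(1)]]
    by (intro smooth_atI [of "overlap b c'"]) (auto simp: admissible_def compatible_def overlap_def)
  have "smooth_at (chart_map c x) (\<lambda>s. transition b c' (transition c b s))"
    by (rule smooth_at_compose [OF 1]) (use 2 c in \<open>simp add: transition_map\<close>)
  from smooth_at_cong [OF transition_transition [OF c(1) b(2) c(2) b(3)] this] show ?thesis .
qed

lemma fd_transition_compose:
  assumes "adm c" "adm c'" "adm c''" "x \<in> chart_dom c" "x \<in> chart_dom c'" "x \<in> chart_dom c''"
  shows "fd (transition c' c'') (chart_map c' x) (fd (transition c c') (chart_map c x) v) =
    fd (transition c c'') (chart_map c x) v"
proof -
  have "fd (transition c c'') (chart_map c x) v = fd (\<lambda>s. transition c' c'' (transition c c' s)) (chart_map c x) v"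
    using fd_cong [OF transition_transition [OF assms(1,2,4,5)]] by simp
  also have "\<dots> = fd (transition c' c'') (chart_map c' x) (fd (transition c c') (chart_map c x) v)"
    using assms fd_compose [OF smooth_transition [of c x c'], of "transition c' c''"]
    by (simp add: transition_map smooth_transition)
  finally show ?thesis by simp
qed

lemma fd_transition_self:
  assumes "adm c" "x \<in> chart_dom c"
  shows "fd (transition c c) (chart_map c x) v = v"
proof -
  have "\<forall>\<^sub>F s in nhds (chart_map c x). s = transition c c s"
    by (rule ev_chart [OF assms], use ev_dom [OF assms] in eventually_elim)
      (use assms in \<open>simp add: transition_def\<close>)
  from fd_cong [OF this] show ?thesis by (metis frechet_derivative_ident)
qed

lemma chart_diff_eq: "chart_diff A c x = fd (transition (base_chart A x) c) (chart_map (base_chart A x) x)"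
  by (simp add: chart_diff_def base_pt_def)

lemma linear_chart_diff: "adm c \<Longrightarrow> x \<in> chart_dom c \<Longrightarrow> linear (chart_diff A c x)"
  unfolding chart_diff_eq by (intro smooth_at_linear_fd smooth_transition base_chart)

lemma linear_chart_frame: "adm c \<Longrightarrow> x \<in> chart_dom c \<Longrightarrow> linear (chart_frame A c x)"
  unfolding chart_frame_def by (intro smooth_at_linear_fd smooth_transition base_chart)

lemma chart_frame_diff [simp]: "adm c \<Longrightarrow> x \<in> chart_dom c \<Longrightarrow> chart_frame A c x (chart_diff A c x v) = v"
  unfolding chart_frame_def chart_diff_eq using base_chart
  by (simp add: fd_transition_compose fd_transition_self)

lemma chart_diff_frame [simp]: "adm c \<Longrightarrow> x \<in> chart_dom c \<Longrightarrow> chart_diff A c x (chart_frame A c x v) = v"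
  unfolding chart_frame_def chart_diff_eq using base_chart
  by (simp add: fd_transition_compose fd_transition_self)

lemma chart_diff_base [simp]: "chart_diff A (base_chart A x) x v = v"
  unfolding chart_diff_eq by (intro fd_transition_self base_chart)

lemma chart_frame_base [simp]: "chart_frame A (base_chart A x) x v = v"
  unfolding chart_frame_def by (intro fd_transition_self base_chart)

lemma chart_diff_transition:
  assumes "adm c" "adm c'" "x \<in> chart_dom c" "x \<in> chart_dom c'"
  shows "fd (transition c c') (chart_map c x) (chart_diff A c x v) = chart_diff A c' x v"
  unfolding chart_diff_eq using assms base_chart by (intro fd_transition_compose)

lemma chart_frame_transition:
  assumes "adm c" "adm c'" "x \<in> chart_dom c" "x \<in> chart_dom c'"
  shows "chart_frame A c' x (fd (transition c c') (chart_map c x) v) = chart_frame A c x v"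
  unfolding chart_frame_def using assms base_chart by (intro fd_transition_compose)

subsection \<open>Independence of smoothness from the chart\<close>

lemma smooth_fun_indep:
  fixes g :: "'a \<Rightarrow> 'f::real_normed_vector"
  assumes c: "adm c" "x \<in> chart_dom c" and c': "adm c'" "x \<in> chart_dom c'"
    and "smooth_at (chart_map c x) (g \<circ> chart_inv c)"
  shows "smooth_at (chart_map c' x) (g \<circ> chart_inv c')"
proof -
  have "smooth_at (chart_map c' x) (\<lambda>s. (g \<circ> chart_inv c) (transition c' c s))"
    by (rule smooth_at_compose [OF smooth_transition [OF c' c]]) (use assms in \<open>simp add: transition_map o_def\<close>)
  moreover have "\<forall>\<^sub>F s in nhds (chart_map c' x). (g \<circ> chart_inv c) (transition c' c s) = (g \<circ> chart_inv c') s"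
    by (rule ev_chart [OF c'], use ev_dom [OF c] ev_dom [OF c'] in eventually_elim)
      (use assms in \<open>simp add: transition_map\<close>)
  ultimately show ?thesis by (rule smooth_at_cong [rotated])
qed

definition smooth_fun_at :: "'a \<Rightarrow> ('a \<Rightarrow> 'f::real_normed_vector) \<Rightarrow> bool" where
  "smooth_fun_at x g \<longleftrightarrow> smooth_at (base_pt A x) (g \<circ> chart_inv (base_chart A x))"

lemma smooth_fun_at_iff:
  assumes "adm c" "x \<in> chart_dom c"
  shows "smooth_fun_at x g \<longleftrightarrow> smooth_at (chart_map c x) (g \<circ> chart_inv c)"
  unfolding smooth_fun_at_def base_pt_def using smooth_fun_indep base_chart assms by metis

lemma smooth_fun_at_cong:
  assumes "\<forall>\<^sub>F y in nhds x. f y = g y" "smooth_fun_at x f"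
  shows "smooth_fun_at x g"
proof -
  have "\<forall>\<^sub>F s in nhds (base_pt A x). (f \<circ> chart_inv (base_chart A x)) s = (g \<circ> chart_inv (base_chart A x)) s"
    unfolding base_pt_def o_def
    by (rule ev_chart [OF base_chart(3,2)], use assms(1) in eventually_elim) simp
  then show ?thesis using assms(2) smooth_at_cong unfolding smooth_fun_at_def by blast
qed

lemma smooth_functions_iff: "f \<in> smooth_functions A \<longleftrightarrow> (\<forall>x. smooth_fun_at x f)"
proof
  assume f: "f \<in> smooth_functions A"
  have "smooth_fun_at x f" for x
  proof -
    have "smooth_on (chart_img (base_chart A x)) (f \<circ> chart_inv (base_chart A x))" "open (chart_img (base_chart A x))"
      using f base_chart adm_chart by (auto simp: smooth_functions_def is_chart_def)
    then show ?thesis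
      using base_chart map_in unfolding smooth_fun_at_def base_pt_def by (blast intro: smooth_atI)
  qed
  then show "\<forall>x. smooth_fun_at x f" ..
next
  assume f: "\<forall>x. smooth_fun_at x f"
  have "smooth_on (chart_img c) (f \<circ> chart_inv c)" if "c \<in> A" for c
  proof -
    have c: "adm c" "open (chart_img c)" using that adm_atlas adm_chart by (auto simp: is_chart_def)
    have "smooth_at s (f \<circ> chart_inv c)" if "s \<in> chart_img c" for s
      using f smooth_fun_at_iff [OF c(1) inv_in [OF c(1) that]] map_inv [OF c(1) that] by metis
    then show ?thesis using c by (simp add: smooth_on_iff)
  qed
  then show "f \<in> smooth_functions A" by (simp add: smooth_functions_def)
qed

lemma smooth_fun_atD:
  "smooth_fun_at x g \<Longrightarrow> adm c \<Longrightarrow> x \<in> chart_dom c \<Longrightarrow> smooth_at (chart_map c x) (g \<circ> chart_inv c)"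
  using smooth_fun_at_iff by blast

lemma eventually_smooth_fun_at:
  assumes "smooth_fun_at x g"
  shows "\<forall>\<^sub>F y in nhds x. smooth_fun_at y g"
proof -
  let ?b = "base_chart A x"
  have "\<forall>\<^sub>F s in nhds (chart_map ?b x). smooth_at s (g \<circ> chart_inv ?b)"
    using assms eventually_smooth_at unfolding smooth_fun_at_def base_pt_def by blast
  from ev_map [OF base_chart(3,2) this] ev_dom [OF base_chart(3,2)]
  show ?thesis by eventually_elim (use smooth_fun_at_iff [OF base_chart(3)] in blast)
qed

section \<open>The differential of a function in an arbitrary chart\<close>

lemma differential_chart:
  assumes f: "smooth_fun_at x f" and c: "adm c" "x \<in> chart_dom c"
  shows "differential A f x v = fd (f \<circ> chart_inv c) (chart_map c x) (chart_diff A c x v)"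
proof -
  let ?b = "base_chart A x"
  have "\<forall>\<^sub>F s in nhds (chart_map ?b x). (f \<circ> chart_inv c) (transition ?b c s) = (f \<circ> chart_inv ?b) s"
    by (rule ev_chart [OF base_chart(3,2)], use ev_dom [OF base_chart(3,2)] ev_dom [OF c] in eventually_elim)
      (use c in \<open>simp add: transition_map base_chart\<close>)
  from fd_cong [OF this] show ?thesis
    using fd_compose [OF smooth_transition [OF base_chart(3,2) c], of "f \<circ> chart_inv c" v]
      smooth_fun_atD [OF f c]
    by (simp add: differential_def base_pt_def transition_map base_chart chart_diff_eq o_def)
qed

lemma differential_frame:
  assumes f: "smooth_fun_at x f" and c: "adm c" "x \<in> chart_dom c"
  shows "fd (f \<circ> chart_inv c) (chart_map c x) u = differential A f x (chart_frame A c x u)"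
  using differential_chart [OF assms] c by simp

lemma linear_differential: "smooth_fun_at x f \<Longrightarrow> linear (differential A f x)"
  unfolding differential_def smooth_fun_at_def by (rule smooth_at_linear_fd)

lemma differential_cong:
  assumes "\<forall>\<^sub>F y in nhds x. f y = g y"
  shows "differential A f x = differential A g x"
  unfolding differential_def
proof (rule fd_cong)
  show "\<forall>\<^sub>F s in nhds (base_pt A x). (f \<circ> chart_inv (base_chart A x)) s = (g \<circ> chart_inv (base_chart A x)) s"
    unfolding base_pt_def o_def
    by (rule ev_chart [OF base_chart(3,2)], use assms(1) in eventually_elim) simp
qed


lemma smooth_fun_at_const: "smooth_fun_at x (\<lambda>_. c)"
  by (simp add: smooth_fun_at_def o_def)

lemma smooth_fun_at_mult:
  fixes f g :: "'a \<Rightarrow> real"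
  shows "smooth_fun_at x f \<Longrightarrow> smooth_fun_at x g \<Longrightarrow> smooth_fun_at x (\<lambda>y. f y * g y)"
  unfolding smooth_fun_at_def o_def by (rule smooth_at_mult)

subsection \<open>Smoothness of vector fields, forms and bivector fields at a point\<close>

lemma vec_in_map: "adm c \<Longrightarrow> y \<in> chart_dom c \<Longrightarrow> vec_in A c X (chart_map c y) = chart_diff A c y (X y)"
  by (simp add: vec_in_def)

lemma form_in_map:
  "adm c \<Longrightarrow> y \<in> chart_dom c \<Longrightarrow> form_in A c \<omega> us (chart_map c y) = \<omega> y (map (chart_frame A c y) us)"
  by (simp add: form_in_def)

lemma bivec_in_map:
  "adm c \<Longrightarrow> y \<in> chart_dom c \<Longrightarrow>
    bivec_in A c P \<alpha> \<beta> (chart_map c y) = P y (\<alpha> \<circ> chart_diff A c y) (\<beta> \<circ> chart_diff A c y)"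
  by (simp add: bivec_in_def)

lemma vec_in_transition:
  assumes c: "adm c" "x \<in> chart_dom c" and c': "adm c'" "x \<in> chart_dom c'"
  shows "\<forall>\<^sub>F s in nhds (chart_map c x).
    fd (transition c c') s (vec_in A c X s) = vec_in A c' X (transition c c' s)"
proof (rule eventually_mono [OF ev_chart [OF c, of "\<lambda>y s.
    fd (transition c c') s (chart_diff A c y (X y)) = vec_in A c' X (transition c c' s)"]])
  show "\<forall>\<^sub>F y in nhds x. fd (transition c c') (chart_map c y) (chart_diff A c y (X y)) =
      vec_in A c' X (transition c c' (chart_map c y))"
    using ev_dom [OF c] ev_dom [OF c']
    by eventually_elim (use c c' in \<open>simp add: chart_diff_transition transition_map vec_in_map\<close>)
qed (simp add: vec_in_def)

lemma smooth_vec_indep: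
  assumes c: "adm c" "x \<in> chart_dom c" and c': "adm c'" "x \<in> chart_dom c'"
    and "smooth_at (chart_map c x) (vec_in A c X)"
  shows "smooth_at (chart_map c' x) (vec_in A c' X)"
proof -
  let ?h = "\<lambda>s. fd (transition c c') s (vec_in A c X s)"
  have "smooth_at (chart_map c x) ?h"
    by (intro smooth_at_fd_apply smooth_transition assms)
  then have "smooth_at (chart_map c' x) (\<lambda>s. ?h (transition c' c s))"
    by (intro smooth_at_compose [OF smooth_transition [OF c' c]]) (use c c' in \<open>simp add: transition_map\<close>)
  moreover have "\<forall>\<^sub>F s in nhds (chart_map c' x). ?h (transition c' c s) = vec_in A c' X s"
    by (rule ev_chart [OF c'], use ev_dom [OF c] ev_dom [OF c'] in eventually_elim)
      (use c c' in \<open>simp add: transition_map vec_in_map chart_diff_transition\<close>)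
  ultimately show ?thesis by (rule smooth_at_cong [rotated])
qed

definition smooth_vec_at :: "'a \<Rightarrow> ('a \<Rightarrow> 'e) \<Rightarrow> bool" where
  "smooth_vec_at x X \<longleftrightarrow> smooth_at (base_pt A x) (vec_in A (base_chart A x) X)"

lemma smooth_vec_at_iff:
  assumes "adm c" "x \<in> chart_dom c"
  shows "smooth_vec_at x X \<longleftrightarrow> smooth_at (chart_map c x) (vec_in A c X)"
  unfolding smooth_vec_at_def base_pt_def using smooth_vec_indep base_chart assms by metis

lemma vec_in_cong:
  assumes "\<forall>\<^sub>F y in nhds x. X y = Y y" "adm c" "x \<in> chart_dom c"
  shows "\<forall>\<^sub>F s in nhds (chart_map c x). vec_in A c X s = vec_in A c Y s"
  unfolding vec_in_def by (rule ev_chart [OF assms(2,3)], use assms(1) in eventually_elim) simp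

lemma smooth_vec_at_cong:
  assumes "\<forall>\<^sub>F y in nhds x. X y = Y y" "smooth_vec_at x X"
  shows "smooth_vec_at x Y"
  using smooth_at_cong [OF vec_in_cong [OF assms(1) base_chart(3,2)]] assms(2)
  unfolding smooth_vec_at_def base_pt_def by blast

lemma smooth_on_chart_iff:
  assumes "adm c"
  shows "smooth_on (chart_img c) g \<longleftrightarrow> (\<forall>x\<in>chart_dom c. smooth_at (chart_map c x) g)"
proof -
  have "open (chart_img c)" using adm_chart [OF assms] by (simp add: is_chart_def)
  then show ?thesis by (simp add: smooth_on_iff chart_img_def)
qed

lemma vector_fields_iff: "X \<in> vector_fields A \<longleftrightarrow> (\<forall>x. smooth_vec_at x X)"
proof
  show "\<forall>x. smooth_vec_at x X" if "X \<in> vector_fields A"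
    using that base_chart smooth_on_chart_iff
    unfolding vector_fields_def smooth_vec_at_def base_pt_def by blast
  show "X \<in> vector_fields A" if "\<forall>x. smooth_vec_at x X"
    using that smooth_on_chart_iff smooth_vec_at_iff adm_atlas unfolding vector_fields_def by blast
qed

lemma alt_forms_frame:
  assumes "\<omega> y \<in> alt_forms k UNIV" "adm c" "y \<in> chart_dom c"
  shows "(\<lambda>us. \<omega> y (map (chart_frame A c y) us)) \<in> alt_forms k UNIV"
  by (rule alt_forms_pullback [OF assms(1) linear_chart_frame [OF assms(2,3)]]) simp

lemma form_in_transition:
  assumes c: "adm c" "x \<in> chart_dom c" and c': "adm c'" "x \<in> chart_dom c'"
  shows "\<forall>\<^sub>F s in nhds (chart_map c x).
    form_in A c' \<omega> (map (\<lambda>u. fd (transition c c') s u) us) (transition c c' s) = form_in A c \<omega> us s"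
proof (rule eventually_mono [OF ev_chart [OF c, of "\<lambda>y s.
    form_in A c' \<omega> (map (\<lambda>u. fd (transition c c') s u) us) (transition c c' s) =
    \<omega> y (map (chart_frame A c y) us)"]])
  show "\<forall>\<^sub>F y in nhds x. form_in A c' \<omega> (map (\<lambda>u. fd (transition c c') (chart_map c y) u) us)
      (transition c c' (chart_map c y)) = \<omega> y (map (chart_frame A c y) us)"
    using ev_dom [OF c] ev_dom [OF c']
    by eventually_elim (use c c' in \<open>simp add: chart_frame_transition transition_map form_in_map o_def\<close>)
qed (simp add: form_in_def)

lemma form_in_transition_alt:
  assumes "\<And>y. \<omega> y \<in> alt_forms k UNIV" and c: "adm c" "x \<in> chart_dom c" and c': "adm c'" "x \<in> chart_dom c'"
  shows "\<forall>\<^sub>F s in nhds (chart_map c x). (\<lambda>us. form_in A c' \<omega> us (transition c c' s)) \<in> alt_forms k UNIV"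
  unfolding form_in_def
  by (rule ev_chart [OF c], use ev_dom [OF c'] ev_dom [OF c] in eventually_elim)
    (use alt_forms_frame [OF assms(1) c'(1)] c c' in \<open>simp add: transition_map\<close>)

text \<open>The frames of two charts differ by the derivative of the transition, so arguments that
  are constant in one chart vary with the point in the other; hence the appeal to
  \<open>multilinear_smooth\<close>.\<close>

lemma smooth_form_indep:
  assumes \<omega>: "\<And>y. \<omega> y \<in> alt_forms k UNIV" and c: "adm c" "x \<in> chart_dom c" and c': "adm c'" "x \<in> chart_dom c'"
    and sm: "\<And>us. length us = k \<Longrightarrow> smooth_at (chart_map c' x) (form_in A c' \<omega> us)"
  shows "smooth_at (chart_map c x) (form_in A c \<omega> us)"
proof (cases "length us = k")
  case True
  have "smooth_at (chart_map c' x) (form_in A c' \<omega> us)" for us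
  proof (cases "length us = k")
    case False
    then have "form_in A c' \<omega> us = (\<lambda>s. 0)"
      unfolding form_in_def by (intro ext alt_forms_outside [OF \<omega>]) simp
    then show ?thesis by simp
  qed (rule sm)
  then have F: "smooth_at (chart_map c x) (\<lambda>s. form_in A c' \<omega> us (transition c c' s))" for us
    by (intro smooth_at_compose [OF smooth_transition [OF c c']]) (use c in \<open>simp add: transition_map\<close>)
  show ?thesis
    by (rule smooth_at_cong [OF form_in_transition [OF c c']
          multilinear_smooth(1) [OF form_in_transition_alt [OF \<omega> c c'] F _ True]])
      (intro smooth_at_fd smooth_transition c c')
next
  case False
  then have "form_in A c \<omega> us = (\<lambda>s. 0)"
    unfolding form_in_def by (intro ext alt_forms_outside [OF \<omega>]) simp
  then show ?thesis by simp
qed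

lemma formsD:
  assumes "\<omega> \<in> forms A k"
  shows "\<omega> y \<in> alt_forms k UNIV" and "adm c \<Longrightarrow> x \<in> chart_dom c \<Longrightarrow> smooth_at (chart_map c x) (form_in A c \<omega> us)"
proof -
  show alt: "\<omega> y \<in> alt_forms k UNIV" for y using assms by (simp add: forms_def)
  assume c: "adm c" "x \<in> chart_dom c"
  have "smooth_at (chart_map (base_chart A x) x) (form_in A (base_chart A x) \<omega> us)" if "length us = k" for us
    using that assms base_chart smooth_on_chart_iff unfolding forms_def by blast
  then show "smooth_at (chart_map c x) (form_in A c \<omega> us)"
    by (rule smooth_form_indep [of \<omega> k, OF alt c base_chart(3,2)])
qed

text \<open>One admissible chart per point is enough, so that the product volume may be examined in
  foliated charts alone.\<close>

lemma formsI:
  assumes "\<And>y. \<omega> y \<in> alt_forms k UNIV"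
    and "\<And>x. \<exists>c. adm c \<and> x \<in> chart_dom c \<and> (\<forall>us. length us = k \<longrightarrow> smooth_at (chart_map c x) (form_in A c \<omega> us))"
  shows "\<omega> \<in> forms A k"
  unfolding forms_def
proof (intro CollectI conjI ballI allI impI)
  fix c us assume c: "c \<in> A"
  have "smooth_at (chart_map c x) (form_in A c \<omega> us)" if x: "x \<in> chart_dom c" for x
  proof -
    obtain c' where "adm c'" "x \<in> chart_dom c'"
      "\<forall>us. length us = k \<longrightarrow> smooth_at (chart_map c' x) (form_in A c' \<omega> us)"
      using assms(2) by blast
    then show ?thesis
      by (intro smooth_form_indep [of \<omega> k, OF assms(1) adm_atlas [OF c] x, of c']) simp_all
  qed
  then show "smooth_on (chart_img c) (form_in A c \<omega> us)" using smooth_on_chart_iff adm_atlas c by blast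
qed (use assms in auto)

lemma form_in_zero:
  assumes "\<And>y. \<omega> y \<in> alt_forms k UNIV" "length us \<noteq> k"
  shows "form_in A c \<omega> us = (\<lambda>s. 0)"
  unfolding form_in_def using assms(2) by (intro ext alt_forms_outside [OF assms(1)]) simp

text \<open>The second derivatives of the transition map that arise from the two terms of the Lie
  derivative cancel, since they are symmetric.\<close>

lemma lie_form_chart:
  fixes vs :: "'e list"
  assumes \<omega>: "\<omega> \<in> forms A k" and X: "smooth_vec_at x X" and c: "adm c" "x \<in> chart_dom c"
  defines "us \<equiv> map (chart_diff A c x) vs"
  shows "lie_form A X \<omega> x vs =
    fd (form_in A c \<omega> us) (chart_map c x) (chart_diff A c x (X x)) +
    (\<Sum>i<length vs. form_in A c \<omega> (us[i := fd (vec_in A c X) (chart_map c x) (us ! i)]) (chart_map c x))"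
proof (cases "length vs = k")
  case False
  have "length us \<noteq> k" using False by (simp add: us_def)
  then show ?thesis
    using False by (simp add: lie_form_def Let_def form_in_zero [OF formsD(1) [OF \<omega>]]
        alt_forms_outside [OF formsD(1) [OF \<omega>]])
next
  case True
  define b where "b = base_chart A x"
  define t where "t = chart_map b x"
  define \<phi> where "\<phi> = transition b c"
  have b: "adm b" "x \<in> chart_dom b" using base_chart by (auto simp: b_def)
  have \<phi>: "smooth_at t \<phi>" "\<phi> t = chart_map c x"
    unfolding \<phi>_def t_def using smooth_transition [OF b c] b by (auto simp: transition_map)
  have D: "chart_diff A c x = fd \<phi> t" by (simp add: chart_diff_eq \<phi>_def t_def b_def)
  note alt = formsD(1) [OF \<omega>]
  have G: "smooth_at (chart_map c x) (form_in A c \<omega> us)" for us by (rule formsD(2) [OF \<omega> c])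
  have F: "smooth_at t (\<lambda>s. form_in A c \<omega> us (\<phi> s))" for us
    by (rule smooth_at_compose [OF \<phi>(1)]) (simp add: \<phi>(2) G)
  have ev1: "\<forall>\<^sub>F s in nhds t. form_in A c \<omega> (map (\<lambda>u. fd \<phi> s u) vs) (\<phi> s) = form_in A b \<omega> vs s"
    unfolding t_def \<phi>_def by (rule form_in_transition [OF b c])
  have w: "smooth_at t (\<lambda>s. fd \<phi> s u)" for u by (rule smooth_at_fd [OF \<phi>(1)])
  have Fd: "fd (\<lambda>s. form_in A c \<omega> us (\<phi> s)) t h = fd (form_in A c \<omega> us) (chart_map c x) (fd \<phi> t h)" for us h
    using fd_compose [OF \<phi>(1), of "form_in A c \<omega> us" h] G by (simp add: \<phi>(2))
  have us: "map (\<lambda>u. fd \<phi> t u) vs = us" by (simp add: us_def D)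
  have 1: "fd (form_in A b \<omega> vs) t h = fd (form_in A c \<omega> us) (chart_map c x) (fd \<phi> t h) +
      (\<Sum>i<k. form_in A c \<omega> (us[i := fd (\<lambda>s. fd \<phi> s (vs ! i)) t h]) (chart_map c x))" for h
    using fun_cong [OF fd_eqI [OF has_derivative_cong_nhds [OF ev1
        multilinear_smooth(2) [OF form_in_transition_alt [OF alt b c, folded t_def \<phi>_def] F w True]]], of h]
    unfolding us Fd \<phi>(2) .
  \<comment> \<open>Differentiating the transformation rule of the components of \<open>X\<close>
    yields a second derivative of \<phi>; symmetry makes \<open>u\<close> its inner direction, the
    shape in which it occurs in fact \<open>1\<close>.\<close>
  have DX: "fd (vec_in A c X) (chart_map c x) (fd \<phi> t u) =
      fd (\<lambda>s. fd \<phi> s u) t (X x) + fd \<phi> t (fd (vec_in A b X) t u)" for u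
  proof -
    have Xb: "smooth_at t (vec_in A b X)" and Xc: "smooth_at (\<phi> t) (vec_in A c X)"
      using X smooth_vec_at_iff [OF b] smooth_vec_at_iff [OF c] unfolding t_def \<phi>(2) [unfolded t_def] by auto
    have "fd (vec_in A c X) (\<phi> t) (fd \<phi> t u) = fd (\<lambda>s. vec_in A c X (\<phi> s)) t u"
      by (rule fd_compose [OF \<phi>(1) Xc, symmetric])
    also have "\<dots> = fd (\<lambda>s. fd \<phi> s (vec_in A b X s)) t u"
      using fd_cong [OF vec_in_transition [OF b c, of X]] by (simp add: t_def \<phi>_def)
    also have "\<dots> = fd (\<lambda>s. fd \<phi> s (vec_in A b X t)) t u + fd \<phi> t (fd (vec_in A b X) t u)"
      by (rule smooth_at_fd_apply(2) [OF \<phi>(1) Xb])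
    also have "vec_in A b X t = X x" using b by (simp add: t_def vec_in_map) (simp add: b_def)
    also have "fd (\<lambda>s. fd \<phi> s (X x)) t u = fd (\<lambda>s. fd \<phi> s u) t (X x)"
      by (rule second_derivative_symmetric [OF \<phi>(1)])
    finally show ?thesis by (simp add: \<phi>(2))
  qed
  have ins: "\<omega> x (vs[i := u]) = form_in A c \<omega> (us[i := fd \<phi> t u]) (chart_map c x)" for i u
  proof -
    have "map (chart_frame A c x) (us[i := chart_diff A c x u]) = vs[i := u]"
      using c by (simp add: us_def map_update o_def)
    then show ?thesis using c by (simp add: form_in_map D)
  qed
  have lin: "form_in A c \<omega> (us[i := u + v]) (chart_map c x) =
      form_in A c \<omega> (us[i := u]) (chart_map c x) + form_in A c \<omega> (us[i := v]) (chart_map c x)" if "i < k" for i u v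
  proof -
    have "(\<lambda>us. form_in A c \<omega> us (chart_map c x)) \<in> alt_forms k UNIV"
      using alt_forms_frame [OF alt c] c by (simp add: form_in_map)
    from linear_add [OF alt_forms_slot_linear [OF this that]] show ?thesis .
  qed
  have nth: "us ! i = fd \<phi> t (vs ! i)" if "i < k" for i using that True by (simp add: us_def D)
  have "lie_form A X \<omega> x vs = fd (form_in A b \<omega> vs) t (X x) +
      (\<Sum>i<k. form_in A c \<omega> (us[i := fd \<phi> t (fd (vec_in A b X) t (vs ! i))]) (chart_map c x))"
    using True by (simp add: lie_form_def Let_def base_pt_def b_def t_def ins [unfolded t_def b_def])
  also have "\<dots> = fd (form_in A c \<omega> us) (chart_map c x) (fd \<phi> t (X x)) +
      (\<Sum>i<k. form_in A c \<omega> (us[i := fd (\<lambda>s. fd \<phi> s (vs ! i)) t (X x)]) (chart_map c x) +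
        form_in A c \<omega> (us[i := fd \<phi> t (fd (vec_in A b X) t (vs ! i))]) (chart_map c x))"
    unfolding 1 by (simp add: sum.distrib)
  also have "(\<Sum>i<k. form_in A c \<omega> (us[i := fd (\<lambda>s. fd \<phi> s (vs ! i)) t (X x)]) (chart_map c x) +
        form_in A c \<omega> (us[i := fd \<phi> t (fd (vec_in A b X) t (vs ! i))]) (chart_map c x)) =
      (\<Sum>i<k. form_in A c \<omega> (us[i := fd (vec_in A c X) (chart_map c x) (us ! i)]) (chart_map c x))"
    by (rule sum.cong) (simp_all add: nth DX lin)
  finally show ?thesis using True by (simp add: D)
qed

subsection \<open>Bump functions on the manifold and extension of germs\<close>

text \<open>Closedness of \<open>K\<close> is what permits gluing with zero outside; it comes from
  the compactness of a closed ball in the chart and the Hausdorff property.\<close>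

lemma exists_bump:
  assumes W: "open W" "x \<in> W"
  obtains \<eta> K where "\<eta> \<in> smooth_functions A" "closed K" "K \<subseteq> W" "\<And>y. y \<notin> K \<Longrightarrow> \<eta> y = 0"
    "\<forall>\<^sub>F y in nhds x. \<eta> y = 1"
proof -
  define c where "c = base_chart A x"
  define t where "t = chart_map c x"
  have c: "adm c" "x \<in> chart_dom c" using base_chart by (auto simp: c_def)
  have "\<forall>\<^sub>F s in nhds t. s \<in> chart_img c \<and> chart_inv c s \<in> W"
    using ev_img [OF c] ev_chart [OF c, of "\<lambda>y _. y \<in> W"] W eventually_nhds_in_open
    unfolding t_def by (auto simp: eventually_conj_iff)
  then obtain e where e: "e > 0" "\<And>s. dist s t < e \<Longrightarrow> s \<in> chart_img c \<and> chart_inv c s \<in> W"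
    by (auto simp: eventually_nhds_metric)
  \<comment> \<open>Half of \<open>e\<close>, so that the closed ball stays inside the open
    one.\<close>
  define r where "r = e / 2"
  have r: "r > 0" "\<And>s. s \<in> cball t r \<Longrightarrow> s \<in> chart_img c \<and> chart_inv c s \<in> W"
    using e by (auto simp: r_def dist_commute)
  obtain \<beta> :: "'e \<Rightarrow> real" where \<beta>: "\<And>s. smooth_at s \<beta>" "\<And>s. dist s t < r / 2 \<Longrightarrow> \<beta> s = 1"
    "\<And>s. dist s t \<ge> r \<Longrightarrow> \<beta> s = 0"
    using exists_bump_euclidean [OF r(1)] by blast
  define \<eta> where "\<eta> = (\<lambda>y. if y \<in> chart_dom c then \<beta> (chart_map c y) else 0)"
  define K where "K = chart_inv c ` cball t r"
  have "continuous_on (chart_img c) (chart_inv c)"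
    using adm_chart [OF c(1)] by (auto simp: is_chart_def homeomorphism_def)
  then have "compact K"
    unfolding K_def using r(2) by (intro compact_continuous_image) (auto elim: continuous_on_subset)
  then have K: "closed K" by (rule compact_imp_closed)
  have 0: "\<eta> y = 0" if "y \<notin> K" for y
  proof (cases "y \<in> chart_dom c")
    case True
    have "chart_map c y \<notin> cball t r"
      using that True c by (auto simp: K_def intro!: rev_image_eqI [of "chart_map c y"])
    then show ?thesis using True \<beta>(3) by (simp add: \<eta>_def dist_commute)
  qed (simp add: \<eta>_def)
  have "smooth_fun_at y \<eta>" for y
  proof (cases "y \<in> chart_dom c")
    case True
    have "\<forall>\<^sub>F s in nhds (chart_map c y). \<beta> s = (\<eta> \<circ> chart_inv c) s"
      unfolding o_def
      by (rule ev_chart [OF c(1) True], use ev_dom [OF c(1) True] in eventually_elim) (simp add: \<eta>_def)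
    then show ?thesis using smooth_at_cong \<beta>(1) smooth_fun_at_iff [OF c(1) True] by blast
  next
    case False
    have "K \<subseteq> chart_dom c" using r(2) inv_in [OF c(1)] by (auto simp: K_def)
    then have "\<forall>\<^sub>F z in nhds y. z \<in> - K"
      using False K by (intro eventually_nhds_in_open) auto
    then have "\<forall>\<^sub>F z in nhds y. 0 = \<eta> z" by eventually_elim (simp add: 0)
    then show ?thesis by (rule smooth_fun_at_cong [OF _ smooth_fun_at_const])
  qed
  then have "\<eta> \<in> smooth_functions A" by (simp add: smooth_functions_iff)
  moreover have "\<forall>\<^sub>F y in nhds x. \<eta> y = 1"
  proof -
    have "\<forall>\<^sub>F s in nhds t. s \<in> ball t (r / 2)"
      using r by (intro eventually_nhds_in_open) auto
    from ev_map [OF c this [unfolded t_def]] ev_dom [OF c]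
    show ?thesis by eventually_elim (simp add: \<eta>_def \<beta>(2) t_def dist_commute)
  qed
  moreover have "K \<subseteq> W" using r(2) by (auto simp: K_def)
  ultimately show ?thesis using that 0 K by blast
qed

text \<open>The definitions quantify over globally smooth functions, while coordinates and
  logarithms of coefficients live in one chart; the cut-off keeps the germ at
  \<open>x\<close>.\<close>

lemma extend_germ:
  fixes g :: "'a \<Rightarrow> real"
  assumes "smooth_fun_at x g"
  obtains f where "f \<in> smooth_functions A" "\<forall>\<^sub>F y in nhds x. f y = g y"
proof -
  obtain W where W: "open W" "x \<in> W" "\<And>y. y \<in> W \<Longrightarrow> smooth_fun_at y g"
    using eventually_smooth_fun_at [OF assms] by (auto simp: eventually_nhds)
  obtain \<eta> K where \<eta>: "\<eta> \<in> smooth_functions A" "closed K" "K \<subseteq> W" "\<And>y. y \<notin> K \<Longrightarrow> \<eta> y = 0"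
    "\<forall>\<^sub>F y in nhds x. \<eta> y = 1"
    using exists_bump [OF W(1,2)] by blast
  have "smooth_fun_at y (\<lambda>y. \<eta> y * g y)" for y
  proof (cases "y \<in> W")
    case True
    then show ?thesis using \<eta>(1) W(3) by (intro smooth_fun_at_mult) (auto simp: smooth_functions_iff)
  next
    case False
    then have "\<forall>\<^sub>F z in nhds y. z \<in> - K" using \<eta> by (intro eventually_nhds_in_open) auto
    then have "\<forall>\<^sub>F z in nhds y. 0 = \<eta> z * g z" by eventually_elim (simp add: \<eta>(4))
    then show ?thesis by (rule smooth_fun_at_cong [OF _ smooth_fun_at_const])
  qed
  then have "(\<lambda>y. \<eta> y * g y) \<in> smooth_functions A" by (simp add: smooth_functions_iff)
  moreover have "\<forall>\<^sub>F y in nhds x. \<eta> y * g y = g y" using \<eta>(5) by eventually_elim simp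
  ultimately show ?thesis using that by blast
qed

text \<open>Exhibiting the field as a multiple of a coordinate field, and not only its value at
  \<open>x\<close>, lets tangency to a foliation be checked at every point.\<close>

lemma extend_chart_vector:
  assumes c: "adm c" "x \<in> chart_dom c"
  obtains X \<eta> where "X \<in> vector_fields A" "\<And>y. y \<in> chart_dom c \<Longrightarrow> X y = \<eta> y *\<^sub>R chart_frame A c y u"
    "\<And>y. y \<notin> chart_dom c \<Longrightarrow> X y = 0" "\<eta> x = 1"
proof -
  have "open (chart_dom c)" using adm_chart [OF c(1)] by (simp add: is_chart_def)
  then obtain \<eta> K where \<eta>: "\<eta> \<in> smooth_functions A" "closed K" "K \<subseteq> chart_dom c"
    "\<And>y. y \<notin> K \<Longrightarrow> \<eta> y = 0" "\<forall>\<^sub>F y in nhds x. \<eta> y = 1"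
    using exists_bump c(2) by blast
  define X where "X = (\<lambda>y. if y \<in> chart_dom c then \<eta> y *\<^sub>R chart_frame A c y u else 0)"
  have "smooth_vec_at y X" for y
  proof (cases "y \<in> chart_dom c")
    case True
    have "\<forall>\<^sub>F s in nhds (chart_map c y). (\<eta> \<circ> chart_inv c) s *\<^sub>R u = vec_in A c X s"
      unfolding o_def vec_in_def
      by (rule ev_chart [OF c(1) True], use ev_dom [OF c(1) True] in eventually_elim)
        (use c in \<open>simp add: X_def linear_cmul [OF linear_chart_diff]\<close>)
    moreover have "smooth_at (chart_map c y) (\<lambda>s. (\<eta> \<circ> chart_inv c) s *\<^sub>R u)"
      by (rule smooth_at_scaleR [OF smooth_fun_atD [OF _ c(1) True] smooth_at_const])
        (use \<eta>(1) in \<open>simp add: smooth_functions_iff\<close>)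
    ultimately show ?thesis
      unfolding smooth_vec_at_iff [OF c(1) True] by (rule smooth_at_cong)
  next
    case False
    then have "\<forall>\<^sub>F z in nhds y. z \<in> - K" using \<eta> by (intro eventually_nhds_in_open) auto
    then have ev: "\<forall>\<^sub>F z in nhds y. 0 = X z" by eventually_elim (simp add: \<eta>(4) X_def)
    have "\<forall>\<^sub>F s in nhds (base_pt A y). 0 = vec_in A (base_chart A y) (\<lambda>_. 0) s"
      unfolding vec_in_def base_pt_def
      by (rule ev_chart [OF base_chart(3,2)], use ev_dom [OF base_chart(3,2)] in eventually_elim)
        (simp add: linear_0 [OF linear_chart_diff] base_chart)
    then have "smooth_vec_at y (\<lambda>_. 0)"
      unfolding smooth_vec_at_def by (rule smooth_at_cong [OF _ smooth_at_const])
    then show ?thesis by (rule smooth_vec_at_cong [OF ev])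
  qed
  then have "X \<in> vector_fields A" by (simp add: vector_fields_iff)
  then show ?thesis
    using that [of X \<eta>] eventually_nhds_x_imp_x [OF \<eta>(5)] by (simp add: X_def)
qed

text \<open>A linear function of the coordinates, extended from its germ. The formula holds on a
  neighbourhood, so it may be differentiated once more.\<close>

lemma exists_coordinate_function:
  fixes \<alpha> :: "'e \<Rightarrow> real"
  assumes c: "adm c" "x \<in> chart_dom c" and \<alpha>: "linear \<alpha>"
  obtains f where "f \<in> smooth_functions A"
    "\<forall>\<^sub>F y in nhds x. differential A f y = \<alpha> \<circ> chart_diff A c y"
proof -
  let ?g = "\<lambda>y. \<alpha> (chart_map c y)"
  have *: "\<forall>\<^sub>F s in nhds (chart_map c y). \<alpha> s = (?g \<circ> chart_inv c) s" if "y \<in> chart_dom c" for y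
    unfolding o_def by (rule ev_chart [OF c(1) that]) simp
  have "smooth_at s \<alpha>" for s using smooth_at_linear [OF \<alpha> smooth_at_ident] .
  then have g: "smooth_fun_at y ?g" if "y \<in> chart_dom c" for y
    using smooth_at_cong [OF * [OF that]] smooth_fun_at_iff [OF c(1) that] by blast
  have fd\<alpha>: "fd \<alpha> s v = \<alpha> v" for s v
    using fun_cong [OF fd_eqI [OF fd_linear [OF \<alpha> has_derivative_ident]]] .
  obtain f where f: "f \<in> smooth_functions A" "\<forall>\<^sub>F y in nhds x. f y = ?g y"
    using extend_germ [OF g [OF c(2)]] by blast
  have "\<forall>\<^sub>F y in nhds x. \<forall>\<^sub>F z in nhds y. f z = ?g z"
    using f(2) by (simp add: eventually_eventually)
  then have "\<forall>\<^sub>F y in nhds x. differential A f y = \<alpha> \<circ> chart_diff A c y"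
    using ev_dom [OF c]
  proof eventually_elim
    case (elim y)
    have "differential A f y v = \<alpha> (chart_diff A c y v)" for v
      using differential_cong [OF elim(1)] differential_chart [OF g [OF elim(2)] c(1) elim(2)]
        fun_cong [OF fd_cong [OF * [OF elim(2)]], of "chart_diff A c y v"] fd\<alpha> by metis
    then show ?case by auto
  qed
  then show ?thesis using that f(1) by blast
qed

text \<open>The coordinate functions extend globally and separate tangent vectors; the uniqueness of
  the modular field rests on this.\<close>

lemma vector_eqI:
  assumes "\<And>f. f \<in> smooth_functions A \<Longrightarrow> differential A f x v = differential A f x w"
  shows "v = w"
proof -
  have "v \<bullet> u = w \<bullet> u" for u
  proof -
    have "linear (\<lambda>z. z \<bullet> u)" by (simp add: bounded_linear.linear bounded_linear_inner_left)
    then obtain f where f: "f \<in> smooth_functions A"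
      "\<forall>\<^sub>F y in nhds x. differential A f y = (\<lambda>z. z \<bullet> u) \<circ> chart_diff A (base_chart A x) y"
      using exists_coordinate_function [OF base_chart(3,2)] by blast
    from assms [OF f(1)] eventually_nhds_x_imp_x [OF f(2)] show ?thesis by simp
  qed
  then show ?thesis by (metis euclidean_eqI)
qed

end

subsection \<open>Bivectors\<close>

abbreviation co :: "'e::euclidean_space \<Rightarrow> 'e \<Rightarrow> real" where
  "co b \<equiv> (\<lambda>v. v \<bullet> b)"

lemma linear_co: "linear (co b)"
  by (simp add: bounded_linear.linear bounded_linear_inner_left)

lemma bivectors_mono: "S \<subseteq> T \<Longrightarrow> bivectors S \<subseteq> bivectors T"
  unfolding bivectors_def by blast

lemma wedge_sumD:
  "wedge_sum p ps \<Longrightarrow> linear \<alpha> \<Longrightarrow> linear \<beta> \<Longrightarrow> p \<alpha> \<beta> = (\<Sum>(X, Y)\<leftarrow>ps. \<alpha> X * \<beta> Y - \<alpha> Y * \<beta> X)"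
  unfolding wedge_sum_def by blast

lemma bivector_antisym:
  assumes p: "p \<in> bivectors S" and "linear \<alpha>" "linear \<beta>"
  shows "p \<beta> \<alpha> = - p \<alpha> \<beta>"
proof -
  obtain ps where "set ps \<subseteq> S \<times> S" and w: "wedge_sum p ps"
    using p by (auto simp: bivectors_def)
  note ps = wedge_sumD [OF w]
  have "(\<Sum>(X, Y)\<leftarrow>ps. \<beta> X * \<alpha> Y - \<beta> Y * \<alpha> X) = - (\<Sum>(X, Y)\<leftarrow>ps. \<alpha> X * \<beta> Y - \<alpha> Y * \<beta> X)"
    by (induction ps) (auto simp: algebra_simps)
  then show ?thesis using ps assms by simp
qed

text \<open>With \<open>S\<close> the tangent space of the leaf: a leafwise bivector depends on a
  covector only through its restriction to the leaf.\<close>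

lemma bivector_cong:
  assumes p: "p \<in> bivectors S" and "linear \<alpha>" "linear \<alpha>'" "linear \<beta>" "\<And>v. v \<in> S \<Longrightarrow> \<alpha> v = \<alpha>' v"
  shows "p \<alpha> \<beta> = p \<alpha>' \<beta>"
proof -
  obtain ps where sub: "set ps \<subseteq> S \<times> S" and w: "wedge_sum p ps"
    using p by (auto simp: bivectors_def)
  note ps = sub wedge_sumD [OF w]
  have "map (\<lambda>(X, Y). \<alpha> X * \<beta> Y - \<alpha> Y * \<beta> X) ps = map (\<lambda>(X, Y). \<alpha>' X * \<beta> Y - \<alpha>' Y * \<beta> X) ps"
    using ps(1) assms(5) by (intro map_cong) auto
  then show ?thesis unfolding ps(2) [OF assms(2,4)] ps(2) [OF assms(3,4)] by (rule arg_cong)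
qed

lemma bivector_lincomb:
  assumes p: "p \<in> bivectors S" and "linear \<alpha>" "linear \<alpha>'" "linear \<beta>"
  shows "p (\<lambda>v. a * \<alpha> v + b * \<alpha>' v) \<beta> = a * p \<alpha> \<beta> + b * p \<alpha>' \<beta>"
proof -
  obtain ps where "set ps \<subseteq> S \<times> S" and w: "wedge_sum p ps"
    using p by (auto simp: bivectors_def)
  note ps = wedge_sumD [OF w]
  have l: "linear (\<lambda>v. a * \<alpha> v + b * \<alpha>' v)"
    using assms(2,3) by (intro linear_compose_add linear_compose_scale_right [where 'b = real, simplified]) auto
  have "(\<Sum>(X, Y)\<leftarrow>ps. (a * \<alpha> X + b * \<alpha>' X) * \<beta> Y - (a * \<alpha> Y + b * \<alpha>' Y) * \<beta> X) =
      a * (\<Sum>(X, Y)\<leftarrow>ps. \<alpha> X * \<beta> Y - \<alpha> Y * \<beta> X) + b * (\<Sum>(X, Y)\<leftarrow>ps. \<alpha>' X * \<beta> Y - \<alpha>' Y * \<beta> X)"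
    by (induction ps) (auto simp: algebra_simps)
  then show ?thesis using ps [OF l assms(4)] ps assms by simp
qed

lemma bivector_expand_left:
  assumes p: "p \<in> bivectors S" and B: "onb B" and "linear D" "linear \<alpha>" "linear \<beta>"
  shows "p (\<alpha> \<circ> D) \<beta> = (\<Sum>i\<in>set B. \<alpha> i * p (co i \<circ> D) \<beta>)"
proof -
  obtain ps where "set ps \<subseteq> S \<times> S" and w: "wedge_sum p ps"
    using p by (auto simp: bivectors_def)
  note ps = wedge_sumD [OF w]
  have rep: "\<alpha> (D X) = (\<Sum>i\<in>set B. \<alpha> i * (D X \<bullet> i))" for X
    using onb_linear [OF B assms(4), of "D X"] by (simp add: mult.commute)
  have "(\<Sum>(X, Y)\<leftarrow>ps. \<alpha> (D X) * \<beta> Y - \<alpha> (D Y) * \<beta> X) =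
      (\<Sum>i\<in>set B. \<alpha> i * (\<Sum>(X, Y)\<leftarrow>ps. (D X \<bullet> i) * \<beta> Y - (D Y \<bullet> i) * \<beta> X))"
  proof (induction ps)
    case (Cons q ps)
    obtain X Y where q: "q = (X, Y)" by fastforce
    have "\<alpha> (D X) * \<beta> Y - \<alpha> (D Y) * \<beta> X = (\<Sum>i\<in>set B. \<alpha> i * ((D X \<bullet> i) * \<beta> Y - (D Y \<bullet> i) * \<beta> X))"
      unfolding rep sum_distrib_right sum_subtractf [symmetric]
      by (rule sum.cong) (auto simp: algebra_simps)
    then show ?case using Cons by (simp add: q distrib_left sum.distrib)
  qed simp
  then show ?thesis
    using ps [OF linear_compose [OF assms(3,4)] assms(5)]
      ps [OF linear_compose [OF assms(3) linear_co] assms(5)] by simp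
qed

lemma bivector_expand:
  assumes p: "p \<in> bivectors S" and B: "onb B" and D: "linear D" and \<alpha>: "linear \<alpha>" and \<beta>: "linear \<beta>"
  shows "p (\<alpha> \<circ> D) (\<beta> \<circ> D) = (\<Sum>i\<in>set B. \<Sum>j\<in>set B. \<alpha> i * \<beta> j * p (co i \<circ> D) (co j \<circ> D))"
proof -
  note l = linear_compose [OF D]
  have "p (co i \<circ> D) (\<beta> \<circ> D) = (\<Sum>j\<in>set B. \<beta> j * p (co i \<circ> D) (co j \<circ> D))" for i
  proof -
    have "p (co i \<circ> D) (\<beta> \<circ> D) = - p (\<beta> \<circ> D) (co i \<circ> D)"
      by (rule bivector_antisym [OF p l [OF \<beta>] l [OF linear_co]])
    also have "\<dots> = - (\<Sum>j\<in>set B. \<beta> j * p (co j \<circ> D) (co i \<circ> D))"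
      by (simp only: bivector_expand_left [OF p B D \<beta> l [OF linear_co], of i])
    also have "\<dots> = (\<Sum>j\<in>set B. \<beta> j * p (co i \<circ> D) (co j \<circ> D))"
      unfolding sum_negf [symmetric]
    proof (rule sum.cong [OF refl])
      fix j
      show "- (\<beta> j * p (co j \<circ> D) (co i \<circ> D)) = \<beta> j * p (co i \<circ> D) (co j \<circ> D)"
        using bivector_antisym [OF p l [OF linear_co] l [OF linear_co], of j i] by simp
    qed
    finally show ?thesis .
  qed
  then show ?thesis
    unfolding bivector_expand_left [OF p B D \<alpha> l [OF \<beta>]] by (simp only: sum_distrib_left mult.assoc)
qed

lemma linear_functional_eqI:
  fixes v w :: "'e::euclidean_space"
  assumes "\<And>\<beta> :: 'e \<Rightarrow> real. linear \<beta> \<Longrightarrow> \<beta> v = \<beta> w"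
  shows "v = w"
  using assms [OF linear_co] by (metis euclidean_eqI)

text \<open>For a sum of wedges of \<open>X\<close> and \<open>Y\<close> the witness is the sum of
  the vectors \<open>\<alpha> X *\<^sub>R Y - \<alpha> Y *\<^sub>R X\<close>. With uniqueness from
  \<open>linear_functional_eqI\<close> this resolves the description in
  \<open>sharp\<close>.\<close>

lemma sharp_exists:
  assumes p: "p \<in> bivectors S" and S: "subspace S" and \<alpha>: "linear \<alpha>"
  shows "\<exists>v\<in>S. \<forall>\<beta>. linear \<beta> \<longrightarrow> \<beta> v = p \<alpha> \<beta>"
proof -
  obtain ps where sub: "set ps \<subseteq> S \<times> S" and w: "wedge_sum p ps"
    using p by (auto simp: bivectors_def)
  note ps = sub wedge_sumD [OF w]
  define v where "v = (\<Sum>(X, Y)\<leftarrow>ps. \<alpha> X *\<^sub>R Y - \<alpha> Y *\<^sub>R X)"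
  have "v \<in> S" unfolding v_def using ps(1)
    by (induction ps) (auto simp: subspace_0 [OF S] intro!: subspace_add [OF S] subspace_diff [OF S] subspace_scale [OF S])
  moreover have "\<beta> v = p \<alpha> \<beta>" if \<beta>: "linear \<beta>" for \<beta>
  proof -
    have "\<beta> v = (\<Sum>(X, Y)\<leftarrow>ps. \<alpha> X * \<beta> Y - \<alpha> Y * \<beta> X)" unfolding v_def
      by (induction ps) (auto simp: linear_0 [OF \<beta>] linear_add [OF \<beta>] linear_diff [OF \<beta>] linear_cmul [OF \<beta>])
    then show ?thesis using ps(2) [OF \<alpha> \<beta>] by simp
  qed
  ultimately show ?thesis by blast
qed

lemma sharp_unique:
  fixes v :: "'e::euclidean_space"
  assumes "\<And>\<beta>. linear \<beta> \<Longrightarrow> \<beta> v = p \<alpha> \<beta>"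
  shows "sharp p \<alpha> = v"
  unfolding sharp_def
proof (rule the_equality)
  fix w assume "\<forall>\<beta>. linear \<beta> \<longrightarrow> \<beta> w = p \<alpha> \<beta>"
  then have "\<beta> w = \<beta> v" if "linear \<beta>" for \<beta> :: "'e \<Rightarrow> real"
    using assms [OF that] that by simp
  then show "w = v" by (rule linear_functional_eqI)
qed (use assms in auto)

lemma sharp_apply: "p \<in> bivectors S \<Longrightarrow> linear \<alpha> \<Longrightarrow> linear \<beta> \<Longrightarrow> \<beta> (sharp p \<alpha>) = p \<alpha> \<beta>"
  using sharp_exists [of p UNIV \<alpha>] sharp_unique [of _ p \<alpha>] bivectors_mono [of S UNIV] by fastforce

lemma sharp_cong:
  assumes "p \<in> bivectors S" "linear \<alpha>" "linear \<alpha>'" "\<And>v. v \<in> S \<Longrightarrow> \<alpha> v = \<alpha>' v"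
  shows "sharp p \<alpha> = sharp p \<alpha>'"
  by (rule linear_functional_eqI) (simp add: sharp_apply [OF assms(1)] assms bivector_cong [OF assms(1-3)])

lemma sharp_lincomb:
  assumes p: "p \<in> bivectors S" and "linear \<alpha>" "linear \<alpha>'"
  shows "sharp p (\<lambda>v. a * \<alpha> v + b * \<alpha>' v) = a *\<^sub>R sharp p \<alpha> + b *\<^sub>R sharp p \<alpha>'"
  by (rule sharp_unique)
    (simp add: bivector_lincomb [OF assms] sharp_apply [OF p] assms linear_add linear_cmul)

context atlas
begin

lemma differential_lincomb:
  assumes f: "smooth_fun_at x f" and g: "smooth_fun_at x g"
  shows "smooth_fun_at x (\<lambda>y. a * f y + b * g y)"
    and "differential A (\<lambda>y. a * f y + b * g y) x = (\<lambda>v. a * differential A f x v + b * differential A g x v)"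
proof -
  let ?b = "base_chart A x"
  have s: "smooth_at (base_pt A x) (f \<circ> chart_inv ?b)" "smooth_at (base_pt A x) (g \<circ> chart_inv ?b)"
    using f g by (auto simp: smooth_fun_at_def)
  show "smooth_fun_at x (\<lambda>y. a * f y + b * g y)"
    using s unfolding smooth_fun_at_def o_def by (intro smooth_at_add smooth_at_mult smooth_at_const)
  show "differential A (\<lambda>y. a * f y + b * g y) x = (\<lambda>v. a * differential A f x v + b * differential A g x v)"
    unfolding differential_def o_def
    by (intro fd_eqI has_derivative_add has_derivative_mult_right
        smooth_at_has_derivative s [unfolded o_def])
qed

end

subsection \<open>Hamiltonian vector fields\<close>

locale poisson_manifold = atlas A for A :: "('a::t2_space, 'e::euclidean_space) chart set" +
  fixes P :: "'a \<Rightarrow> ('e \<Rightarrow> real) \<Rightarrow> ('e \<Rightarrow> real) \<Rightarrow> real"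
  assumes poisson: "poisson_bivector A P"
begin

lemma bivector: "P x \<in> bivectors UNIV"
  using poisson by (simp add: poisson_bivector_def bivector_fields_def)

text \<open>Smoothness is postulated in the charts of \<open>A\<close>; an admissible chart inherits
  it because components in two charts are related by the derivative of the transition.\<close>

lemma smooth_bivec_in:
  assumes c: "adm c" "x \<in> chart_dom c" and \<alpha>: "linear \<alpha>" and \<beta>: "linear \<beta>"
  shows "smooth_at (chart_map c x) (bivec_in A c P \<alpha> \<beta>)"
proof -
  define b where "b = base_chart A x"
  have b: "adm b" "x \<in> chart_dom b" "b \<in> A" using base_chart by (auto simp: b_def)
  obtain B :: "'e list" where B: "onb B" using exists_onb by blast
  have sb: "smooth_at (chart_map b x) (bivec_in A b P (co i) (co j))" for i j
    using poisson b smooth_on_chart_iff linear_co unfolding poisson_bivector_def bivector_fields_def by blast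
  define \<phi> \<psi> where "\<phi> = transition c b" "\<psi> = transition b c"
  have \<phi>: "smooth_at (chart_map c x) \<phi>" "\<phi> (chart_map c x) = chart_map b x"
    using smooth_transition [OF c b(1,2)] c by (auto simp: \<phi>_\<psi>_def transition_map)
  have \<psi>: "smooth_at (chart_map b x) \<psi>"
    using smooth_transition [OF b(1,2) c] by (auto simp: \<phi>_\<psi>_def)
  have "smooth_at (chart_map c x) (\<lambda>s. \<Sum>i\<in>set B. \<Sum>j\<in>set B.
      \<alpha> (fd \<psi> (\<phi> s) i) * \<beta> (fd \<psi> (\<phi> s) j) * bivec_in A b P (co i) (co j) (\<phi> s))"
    by (intro smooth_at_sum smooth_at_mult smooth_at_linear [OF \<alpha>] smooth_at_linear [OF \<beta>]
        smooth_at_compose [OF \<phi>(1), of "\<lambda>s. fd \<psi> s i" for i] smooth_at_compose [OF \<phi>(1)])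
      (simp_all add: \<phi>(2) sb smooth_at_fd [OF \<psi>])
  moreover have "\<forall>\<^sub>F s in nhds (chart_map c x). (\<Sum>i\<in>set B. \<Sum>j\<in>set B.
      \<alpha> (fd \<psi> (\<phi> s) i) * \<beta> (fd \<psi> (\<phi> s) j) * bivec_in A b P (co i) (co j) (\<phi> s)) = bivec_in A c P \<alpha> \<beta> s"
  proof (rule eventually_mono [OF ev_chart [OF c, of "\<lambda>y s. (\<Sum>i\<in>set B. \<Sum>j\<in>set B.
        \<alpha> (fd \<psi> (\<phi> s) i) * \<beta> (fd \<psi> (\<phi> s) j) * bivec_in A b P (co i) (co j) (\<phi> s)) =
        P y (\<alpha> \<circ> chart_diff A c y) (\<beta> \<circ> chart_diff A c y)"]])
    show "\<forall>\<^sub>F y in nhds x. (\<Sum>i\<in>set B. \<Sum>j\<in>set B.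
        \<alpha> (fd \<psi> (\<phi> (chart_map c y)) i) * \<beta> (fd \<psi> (\<phi> (chart_map c y)) j) *
        bivec_in A b P (co i) (co j) (\<phi> (chart_map c y))) =
        P y (\<alpha> \<circ> chart_diff A c y) (\<beta> \<circ> chart_diff A c y)"
      using ev_dom [OF c] ev_dom [OF b(1,2)]
    proof eventually_elim
      case (elim y)
      have "smooth_at (chart_map b y) \<psi>" using smooth_transition b c elim by (simp add: \<phi>_\<psi>_def)
      then have l: "linear (fd \<psi> (chart_map b y))" by (rule smooth_at_linear_fd)
      have \<phi>y: "\<phi> (chart_map c y) = chart_map b y" using c elim by (simp add: \<phi>_\<psi>_def transition_map)
      have D: "chart_diff A c y = fd \<psi> (chart_map b y) \<circ> chart_diff A b y"
        using chart_diff_transition [OF b(1) c(1)] elim by (auto simp: \<phi>_\<psi>_def)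
      show ?case
        unfolding \<phi>y D bivec_in_map [OF b(1) elim(2)] o_assoc
          bivector_expand [OF bivector B linear_chart_diff [OF b(1) elim(2)]
            linear_compose [OF l \<alpha>] linear_compose [OF l \<beta>]]
        unfolding comp_apply [of \<alpha>] comp_apply [of \<beta>] by (rule refl)
    qed
  qed (simp add: bivec_in_def)
  ultimately show ?thesis by (rule smooth_at_cong [rotated])
qed

lemma ham_apply:
  assumes "smooth_fun_at x f" "linear \<beta>"
  shows "\<beta> (ham_field A P f x) = P x (differential A f x) \<beta>"
  unfolding ham_field_def using assms by (intro sharp_apply [OF bivector] linear_differential)

lemma bracket_ham:
  assumes "smooth_fun_at x f" "smooth_fun_at x g"
  shows "bracket A P f g x = differential A g x (ham_field A P f x)"
  using assms by (simp add: bracket_def ham_apply linear_differential)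

lemma bracket_antisym:
  assumes "smooth_fun_at x f" "smooth_fun_at x g"
  shows "bracket A P g f x = - bracket A P f g x"
  unfolding bracket_def
  by (rule bivector_antisym [OF bivector linear_differential [OF assms(1)] linear_differential [OF assms(2)]])

lemma sharp_chart_diff:
  assumes a: "linear a" and c: "adm c" "x \<in> chart_dom c" and B: "onb B"
  shows "chart_diff A c x (sharp (P x) (a \<circ> chart_diff A c x)) = (\<Sum>j\<in>set B.
    (\<Sum>i\<in>set B. a i * bivec_in A c P (co i) (co j) (chart_map c x)) *\<^sub>R j)"
proof (rule onb_eqI [OF B])
  fix j assume j: "j \<in> set B"
  note lD = linear_chart_diff [OF c]
  have "chart_diff A c x (sharp (P x) (a \<circ> chart_diff A c x)) \<bullet> j = P x (a \<circ> chart_diff A c x) (co j \<circ> chart_diff A c x)"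
    using sharp_apply [OF bivector [of x] linear_compose [OF lD a] linear_compose [OF lD linear_co [of j]]] by simp
  also have "\<dots> = (\<Sum>i\<in>set B. a i * bivec_in A c P (co i) (co j) (chart_map c x))"
    using bivector_expand_left [OF bivector B lD a linear_compose [OF lD linear_co]] c
    by (simp add: bivec_in_map)
  finally show "chart_diff A c x (sharp (P x) (a \<circ> chart_diff A c x)) \<bullet> j = (\<Sum>j\<in>set B.
    (\<Sum>i\<in>set B. a i * bivec_in A c P (co i) (co j) (chart_map c x)) *\<^sub>R j) \<bullet> j"
    by (simp only: onb_inner_sum [OF B j])
qed

lemma ham_chart_diff:
  assumes f: "smooth_fun_at x f" and c: "adm c" "x \<in> chart_dom c" and B: "onb B"
  shows "chart_diff A c x (ham_field A P f x) = (\<Sum>j\<in>set B.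
    (\<Sum>i\<in>set B. fd (f \<circ> chart_inv c) (chart_map c x) i * bivec_in A c P (co i) (co j) (chart_map c x)) *\<^sub>R j)"
proof -
  have "differential A f x = fd (f \<circ> chart_inv c) (chart_map c x) \<circ> chart_diff A c x"
    using differential_chart [OF f c] by auto
  then show ?thesis
    using sharp_chart_diff [OF smooth_at_linear_fd [OF smooth_fun_atD [OF f c]] c B]
    by (simp add: ham_field_def)
qed

lemma ham_in_chart:
  assumes f: "smooth_fun_at x f" and c: "adm c" "x \<in> chart_dom c" and B: "onb B"
  shows "\<forall>\<^sub>F s in nhds (chart_map c x). (\<Sum>j\<in>set B.
    (\<Sum>i\<in>set B. fd (f \<circ> chart_inv c) s i * bivec_in A c P (co i) (co j) s) *\<^sub>R j) = vec_in A c (ham_field A P f) s"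
  unfolding vec_in_def
proof (rule ev_chart [OF c])
  show "\<forall>\<^sub>F y in nhds x. (\<Sum>j\<in>set B. (\<Sum>i\<in>set B. fd (f \<circ> chart_inv c) (chart_map c y) i *
      bivec_in A c P (co i) (co j) (chart_map c y)) *\<^sub>R j) = chart_diff A c y (ham_field A P f y)"
    using ev_dom [OF c] eventually_smooth_fun_at [OF f]
    by eventually_elim (rule ham_chart_diff [OF _ c(1) _ B, symmetric])
qed

lemma smooth_ham:
  assumes f: "smooth_fun_at x f"
  shows "smooth_vec_at x (ham_field A P f)"
proof -
  define b where "b = base_chart A x"
  have b: "adm b" "x \<in> chart_dom b" using base_chart by (auto simp: b_def)
  obtain B :: "'e list" where B: "onb B" using exists_onb by blast
  have "smooth_at (chart_map b x) (\<lambda>s. \<Sum>j\<in>set B.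
      (\<Sum>i\<in>set B. fd (f \<circ> chart_inv b) s i * bivec_in A b P (co i) (co j) s) *\<^sub>R j)"
    by (intro smooth_at_sum smooth_at_scaleR smooth_at_mult smooth_at_const smooth_at_fd
        smooth_bivec_in [OF b] linear_co smooth_fun_atD [OF f b])
  from smooth_at_cong [OF ham_in_chart [OF f b B] this] show ?thesis
    by (simp add: smooth_vec_at_iff [OF b])
qed

lemma smooth_differential_apply:
  assumes g: "smooth_fun_at x g" and X: "smooth_vec_at x X"
  shows "smooth_fun_at x (\<lambda>y. differential A g y (X y))"
proof -
  define b where "b = base_chart A x"
  have b: "adm b" "x \<in> chart_dom b" using base_chart by (auto simp: b_def)
  have "smooth_at (chart_map b x) (\<lambda>s. fd (g \<circ> chart_inv b) s (vec_in A b X s))"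
    using X smooth_vec_at_iff [OF b] by (intro smooth_at_fd_apply smooth_fun_atD [OF g b]) blast
  moreover have "\<forall>\<^sub>F s in nhds (chart_map b x). fd (g \<circ> chart_inv b) s (vec_in A b X s) =
      ((\<lambda>y. differential A g y (X y)) \<circ> chart_inv b) s"
    unfolding vec_in_def o_def
    by (rule ev_chart [OF b], use ev_dom [OF b] eventually_smooth_fun_at [OF g] in eventually_elim)
      (simp add: differential_chart [OF _ b(1)] o_def)
  ultimately show ?thesis
    unfolding smooth_fun_at_iff [OF b] by (rule smooth_at_cong [rotated])
qed

lemma bracket_smooth:
  assumes f: "f \<in> smooth_functions A" and g: "g \<in> smooth_functions A"
  shows "bracket A P f g \<in> smooth_functions A"
proof -
  have sm: "smooth_fun_at x f" "smooth_fun_at x g" for x using f g by (auto simp: smooth_functions_iff)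
  have "bracket A P f g = (\<lambda>y. differential A g y (ham_field A P f y))"
    using bracket_ham [OF sm] by auto
  then show ?thesis
    unfolding smooth_functions_iff using smooth_differential_apply [OF sm(2) smooth_ham [OF sm(1)]] by simp
qed

lemma ham_lincomb:
  assumes "smooth_fun_at x f" "smooth_fun_at x g"
  shows "ham_field A P (\<lambda>y. a * f y + b * g y) x = a *\<^sub>R ham_field A P f x + b *\<^sub>R ham_field A P g x"
  unfolding ham_field_def differential_lincomb(2) [OF assms]
  by (intro sharp_lincomb [OF bivector] linear_differential assms)

lemma ham_cong:
  assumes "\<forall>\<^sub>F y in nhds x. f y = g y"
  shows "\<forall>\<^sub>F y in nhds x. ham_field A P f y = ham_field A P g y"
proof -
  have "\<forall>\<^sub>F y in nhds x. \<forall>\<^sub>F z in nhds y. f z = g z" using assms by (simp add: eventually_eventually)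
  then show ?thesis by eventually_elim (simp add: ham_field_def differential_cong)
qed

subsection \<open>Poisson vector fields\<close>

lemma lie_bivec_cong:
  assumes "\<forall>\<^sub>F y in nhds x. X y = Y y"
  shows "lie_bivec A X P x = lie_bivec A Y P x"
  using fd_cong [OF vec_in_cong [OF assms base_chart(3,2)]] eventually_nhds_x_imp_x [OF assms]
  by (intro ext) (simp add: lie_bivec_def Let_def base_pt_def)

text \<open>Evaluated on coordinate functions \<open>g\<close> and \<open>h\<close> whose differentials have the constant
  components \<open>\<alpha>\<close> and \<open>\<beta>\<close>, the equation \<open>L\<^bsub>X\<^esub> P = 0\<close> for \<open>X = X\<^sub>f\<close> is the Jacobi identity
  for \<open>f\<close>, \<open>g\<close>, \<open>h\<close>.\<close>

lemma lie_bivec_ham: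
  assumes f: "f \<in> smooth_functions A" and \<alpha>: "linear \<alpha>" and \<beta>: "linear \<beta>"
  shows "lie_bivec A (ham_field A P f) P x \<alpha> \<beta> = 0"
proof -
  define b where "b = base_chart A x"
  define t where "t = chart_map b x"
  define X where "X = ham_field A P f"
  have b: "adm b" "x \<in> chart_dom b" using base_chart by (auto simp: b_def)
  obtain g where g: "g \<in> smooth_functions A" "\<forall>\<^sub>F y in nhds x. differential A g y = \<alpha> \<circ> chart_diff A b y"
    using exists_coordinate_function [OF b \<alpha>] by blast
  obtain h where h: "h \<in> smooth_functions A" "\<forall>\<^sub>F y in nhds x. differential A h y = \<beta> \<circ> chart_diff A b y"
    using exists_coordinate_function [OF b \<beta>] by blast
  have sm: "smooth_fun_at y k" if "k \<in> smooth_functions A" for y k using that by (simp add: smooth_functions_iff)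
  have idx: "\<gamma> \<circ> chart_diff A b x = \<gamma>" for \<gamma> :: "'e \<Rightarrow> real" by (auto simp: b_def)
  have gx: "differential A g x = \<alpha>" and hx: "differential A h x = \<beta>"
    using eventually_nhds_x_imp_x [OF g(2)] eventually_nhds_x_imp_x [OF h(2)] by (simp_all add: idx)
  have "\<forall>\<^sub>F s in nhds t. bivec_in A b P \<alpha> \<beta> s = (bracket A P g h \<circ> chart_inv b) s"
    unfolding t_def bivec_in_def o_def [of "bracket A P g h"]
    by (rule ev_chart [OF b], use g(2) h(2) in eventually_elim) (simp add: bracket_def o_def)
  then have 1: "fd (bivec_in A b P \<alpha> \<beta>) t = differential A (bracket A P g h) x"
    unfolding differential_def base_pt_def t_def b_def by (rule fd_cong)
  have Xb: "smooth_at t (vec_in A b X)"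
    unfolding t_def X_def using smooth_ham [OF sm [OF f]] smooth_vec_at_iff [OF b] by blast
  \<comment> \<open>Near \<open>x\<close> the component \<gamma> of the Hamiltonian field is its
    action on \<open>k\<close>, that is, the bracket of \<open>f\<close> and \<open>k\<close>;
    differentiation gives the claim.\<close>
  have 2: "\<gamma> \<circ> fd (vec_in A b X) t = differential A (bracket A P f k) x"
    if k: "k \<in> smooth_functions A" "\<forall>\<^sub>F y in nhds x. differential A k y = \<gamma> \<circ> chart_diff A b y" and \<gamma>: "linear \<gamma>" for \<gamma> k
  proof -
    have "\<forall>\<^sub>F s in nhds t. \<gamma> (vec_in A b X s) = (bracket A P f k \<circ> chart_inv b) s"
      unfolding t_def vec_in_def o_def [of "bracket A P f k"]
      by (rule ev_chart [OF b], use k(2) in eventually_elim)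
        (simp add: bracket_ham sm f k(1) X_def)
    then have "fd (\<lambda>s. \<gamma> (vec_in A b X s)) t = differential A (bracket A P f k) x"
      unfolding differential_def base_pt_def t_def b_def by (rule fd_cong)
    then show ?thesis using fd_eqI [OF fd_linear [OF \<gamma> smooth_at_has_derivative [OF Xb]]] by (simp add: o_def)
  qed
  have br: "bracket A P k l y = P y (differential A k y) (differential A l y)" for k l y by (simp add: bracket_def)
  note sf = sm [OF f] and sg = sm [OF g(1)] and sh = sm [OF h(1)]
  note sbr = sm [OF bracket_smooth]
  have "lie_bivec A X P x \<alpha> \<beta> = differential A (bracket A P g h) x (X x) -
      P x (differential A (bracket A P f g) x) \<beta> - P x \<alpha> (differential A (bracket A P f h) x)"
    using 1 2 [OF g \<alpha>] 2 [OF h \<beta>]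
    by (simp add: lie_bivec_def Let_def base_pt_def b_def t_def)
  also have "differential A (bracket A P g h) x (X x) = bracket A P f (bracket A P g h) x"
    using bracket_ham [OF sf sbr [OF g(1) h(1)]] by (simp add: X_def)
  also have "P x (differential A (bracket A P f g) x) \<beta> = - bracket A P h (bracket A P f g) x"
    using bracket_antisym [OF sh [of x] sbr [OF f g(1), of x]] by (simp add: br hx)
  also have "P x \<alpha> (differential A (bracket A P f h) x) = - bracket A P g (bracket A P h f) x"
  proof -
    have l: "linear (differential A (bracket A P h f) x)"
      by (rule linear_differential [OF sbr [OF h(1) f]])
    \<comment> \<open>The zero summand brings the negated bracket into the shape required by
      \<open>differential_lincomb\<close>.\<close>
    have "bracket A P f h = (\<lambda>y. (-1) * bracket A P h f y + 0 * bracket A P h f y)"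
      using bracket_antisym [OF sh sf] by auto
    then have "differential A (bracket A P f h) x = (\<lambda>v. (-1) * differential A (bracket A P h f) x v + 0 * differential A (bracket A P h f) x v)"
      using differential_lincomb(2) [OF sbr [OF h(1) f, of x] sbr [OF h(1) f, of x], of "-1" 0] by metis
    then have "P x \<alpha> (differential A (bracket A P f h) x) = - P x (\<lambda>v. (-1) * differential A (bracket A P h f) x v + 0 * differential A (bracket A P h f) x v) \<alpha>"
      using bivector_antisym [OF bivector [of x] linear_differential [OF sbr [OF f h(1), of x]] \<alpha>] by simp
    also have "\<dots> = P x (differential A (bracket A P h f) x) \<alpha>"
      using bivector_lincomb [OF bivector [of x] l l \<alpha>, of "-1" 0] by simp
    also have "\<dots> = - bracket A P g (bracket A P h f) x"
      using bracket_antisym [OF sg [of x] sbr [OF h(1) f, of x]] by (simp add: br gx)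
    finally show ?thesis .
  qed
  also have "bracket A P f (bracket A P g h) x - - bracket A P h (bracket A P f g) x - - bracket A P g (bracket A P h f) x = 0"
  proof -
    have "bracket A P f (bracket A P g h) x + bracket A P g (bracket A P h f) x + bracket A P h (bracket A P f g) x = 0"
      using poisson f g(1) h(1) unfolding poisson_bivector_def by blast
    then show ?thesis by simp
  qed
  finally show ?thesis by (simp add: X_def)
qed

text \<open>\<open>lie_bivec\<close> at a point depends only on the germ of the field there, so
  \<open>lie_bivec_ham\<close> can be applied with a different function around each point.\<close>

lemma Poiss_locally_ham:
  assumes "\<And>x. \<exists>f\<in>smooth_functions A. \<forall>\<^sub>F y in nhds x. ham_field A P f y = X y"
  shows "X \<in> Poiss A P"
proof -
  have "smooth_vec_at x X \<and> (\<forall>\<alpha> \<beta>. linear \<alpha> \<longrightarrow> linear \<beta> \<longrightarrow> lie_bivec A X P x \<alpha> \<beta> = 0)" for x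
  proof -
    obtain f where f: "f \<in> smooth_functions A" "\<forall>\<^sub>F y in nhds x. ham_field A P f y = X y"
      using assms by blast
    show ?thesis
      using smooth_vec_at_cong [OF f(2) smooth_ham] f(1) lie_bivec_ham [OF f(1)]
      unfolding lie_bivec_cong [OF f(2), symmetric] by (auto simp: smooth_functions_iff)
  qed
  then show ?thesis by (simp add: Poiss_def vector_fields_iff)
qed

lemma Ham_subset_Poiss: "Ham A P \<subseteq> Poiss A P"
proof
  fix X assume "X \<in> Ham A P"
  then obtain f where "f \<in> smooth_functions A" "X = ham_field A P f" by (auto simp: Ham_def)
  then show "X \<in> Poiss A P" by (intro Poiss_locally_ham) (auto intro!: bexI [of _ f])
qed

text \<open>A single statement provides sums, negatives and zero by the choice of the
  coefficients.\<close>

lemma Poiss_lincomb: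
  assumes X: "X \<in> Poiss A P" and Y: "Y \<in> Poiss A P"
  shows "(\<lambda>x. a *\<^sub>R X x + b *\<^sub>R Y x) \<in> Poiss A P"
proof -
  have sm: "smooth_vec_at x X" "smooth_vec_at x Y" for x using X Y by (auto simp: Poiss_def vector_fields_iff)
  let ?Z = "\<lambda>x. a *\<^sub>R X x + b *\<^sub>R Y x"
  have "smooth_vec_at x ?Z \<and> (\<forall>\<alpha> \<beta>. linear \<alpha> \<longrightarrow> linear \<beta> \<longrightarrow> lie_bivec A ?Z P x \<alpha> \<beta> = 0)" for x
  proof -
    define c where "c = base_chart A x"
    define t where "t = chart_map c x"
    have c: "adm c" "x \<in> chart_dom c" using base_chart by (auto simp: c_def)
    have s: "smooth_at t (vec_in A c X)" "smooth_at t (vec_in A c Y)"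
      using sm smooth_vec_at_iff [OF c] by (auto simp: t_def)
    have ev: "\<forall>\<^sub>F s in nhds t. a *\<^sub>R vec_in A c X s + b *\<^sub>R vec_in A c Y s = vec_in A c ?Z s"
      unfolding t_def vec_in_def
      by (rule ev_chart [OF c], use ev_dom [OF c] in eventually_elim)
        (simp add: linear_add [OF linear_chart_diff [OF c(1)]] linear_cmul [OF linear_chart_diff [OF c(1)]])
    have "smooth_at t (\<lambda>s. a *\<^sub>R vec_in A c X s + b *\<^sub>R vec_in A c Y s)"
      by (intro smooth_at_add smooth_at_scaleR smooth_at_const s)
    from smooth_at_cong [OF ev this] have 1: "smooth_vec_at x ?Z"
      using smooth_vec_at_iff [OF c] by (simp add: t_def)
    have "((\<lambda>s. a *\<^sub>R vec_in A c X s + b *\<^sub>R vec_in A c Y s) has_derivative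
        (\<lambda>h. a *\<^sub>R fd (vec_in A c X) t h + b *\<^sub>R fd (vec_in A c Y) t h)) (at t)"
      by (intro has_derivative_add has_derivative_scaleR_right smooth_at_has_derivative s)
    from fd_eqI [OF has_derivative_cong_nhds [OF ev this]]
    have D: "fd (vec_in A c ?Z) t = (\<lambda>h. a *\<^sub>R fd (vec_in A c X) t h + b *\<^sub>R fd (vec_in A c Y) t h)" .
    have "lie_bivec A ?Z P x \<alpha> \<beta> = a * lie_bivec A X P x \<alpha> \<beta> + b * lie_bivec A Y P x \<alpha> \<beta>"
      if \<alpha>: "linear \<alpha>" and \<beta>: "linear \<beta>" for \<alpha> \<beta>
    proof -
      have lX: "linear (fd (vec_in A c X) t)" and lY: "linear (fd (vec_in A c Y) t)"
        using s smooth_at_linear_fd by auto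
      have left: "P x (\<gamma> \<circ> fd (vec_in A c ?Z) t) \<delta> =
          a * P x (\<gamma> \<circ> fd (vec_in A c X) t) \<delta> + b * P x (\<gamma> \<circ> fd (vec_in A c Y) t) \<delta>"
        if "linear \<gamma>" "linear \<delta>" for \<gamma> \<delta>
        using bivector_lincomb [OF bivector linear_compose [OF lX that(1)] linear_compose [OF lY that(1)] that(2), of x a b]
        by (simp add: D o_def linear_add [OF that(1)] linear_cmul [OF that(1)])
      have lZ: "linear (fd (vec_in A c ?Z) t)"
        using smooth_at_linear_fd 1 smooth_vec_at_iff [OF c] by (auto simp: t_def)
      have right: "P x \<delta> (\<gamma> \<circ> fd (vec_in A c ?Z) t) =
          a * P x \<delta> (\<gamma> \<circ> fd (vec_in A c X) t) + b * P x \<delta> (\<gamma> \<circ> fd (vec_in A c Y) t)"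
        if "linear \<gamma>" "linear \<delta>" for \<gamma> \<delta>
        using left [OF that] bivector_antisym [OF bivector linear_compose [OF lZ that(1)] that(2)]
          bivector_antisym [OF bivector linear_compose [OF lX that(1)] that(2)]
          bivector_antisym [OF bivector linear_compose [OF lY that(1)] that(2)] by simp
      have lP: "linear (fd (bivec_in A c P \<alpha> \<beta>) t)"
        unfolding t_def by (intro smooth_at_linear_fd smooth_bivec_in c \<alpha> \<beta>)
      show ?thesis
        using left [OF \<alpha> \<beta>] right [OF \<beta> \<alpha>] linear_add [OF lP] linear_cmul [OF lP]
        by (simp add: lie_bivec_def Let_def base_pt_def t_def c_def algebra_simps)
    qed
    then show ?thesis using 1 X Y by (simp add: Poiss_def)
  qed
  then show ?thesis by (simp add: Poiss_def vector_fields_iff)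
qed

subsection \<open>The quotient group\<close>

lemma comm_group_Poiss: "comm_group (add_group (Poiss A P))"
proof -
  have z: "0 \<in> Poiss A P"
  proof -
    have "(\<lambda>_. 0) \<in> smooth_functions A" by (simp add: smooth_functions_iff smooth_fun_at_const)
    then have h: "ham_field A P (\<lambda>_. 0) \<in> Poiss A P" using Ham_subset_Poiss by (auto simp: Ham_def)
    have "(\<lambda>x. 0) \<in> Poiss A P" using Poiss_lincomb [OF h h, of 0 0] by simp
    then show ?thesis by (simp add: zero_fun_def)
  qed
  show ?thesis
  proof (rule comm_groupI)
    show "x \<otimes>\<^bsub>add_group (Poiss A P)\<^esub> y \<in> carrier (add_group (Poiss A P))"
      if "x \<in> carrier (add_group (Poiss A P))" "y \<in> carrier (add_group (Poiss A P))" for x y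
      using that Poiss_lincomb [of x y 1 1] by (simp add: add_group_def plus_fun_def)
    show "\<exists>y\<in>carrier (add_group (Poiss A P)). y \<otimes>\<^bsub>add_group (Poiss A P)\<^esub> x = \<one>\<^bsub>add_group (Poiss A P)\<^esub>"
      if "x \<in> carrier (add_group (Poiss A P))" for x
      using that Poiss_lincomb [of x x "-1" 0]
      by (intro bexI [of _ "- x"]) (simp_all add: add_group_def fun_Compl_def plus_fun_def zero_fun_def)
  qed (use z in \<open>auto simp: add_group_def add.assoc add.commute\<close>)
qed

lemma ham_add_Ham:
  assumes "X \<in> Ham A P" "Y \<in> Ham A P"
  shows "X + Y \<in> Ham A P" and "- X \<in> Ham A P"
proof -
  obtain f g where f: "f \<in> smooth_functions A" "X = ham_field A P f" and g: "g \<in> smooth_functions A" "Y = ham_field A P g"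
    using assms by (auto simp: Ham_def)
  have sm: "smooth_fun_at x f" "smooth_fun_at x g" for x using f g by (auto simp: smooth_functions_iff)
  have in_Ham: "(\<lambda>x. a *\<^sub>R X x + b *\<^sub>R Y x) \<in> Ham A P" for a b
  proof -
    have "(\<lambda>y. a * f y + b * g y) \<in> smooth_functions A"
      using differential_lincomb(1) [OF sm] by (simp add: smooth_functions_iff)
    moreover have "(\<lambda>x. a *\<^sub>R X x + b *\<^sub>R Y x) = ham_field A P (\<lambda>y. a * f y + b * g y)"
      using ham_lincomb [OF sm] by (auto simp: f g)
    ultimately show ?thesis by (auto simp: Ham_def)
  qed
  show "X + Y \<in> Ham A P" using in_Ham [of 1 1] by (simp add: plus_fun_def)
  show "- X \<in> Ham A P" using in_Ham [of "-1" 0] by (simp add: fun_Compl_def)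
qed

lemma normal_Ham: "Ham A P \<lhd> add_group (Poiss A P)"
proof -
  interpret comm_group "add_group (Poiss A P)" by (rule comm_group_Poiss)
  have sub: "subgroup (Ham A P) (add_group (Poiss A P))"
  proof (rule subgroupI)
    have "(\<lambda>_. 0) \<in> smooth_functions A" by (simp add: smooth_functions_iff smooth_fun_at_const)
    then show "Ham A P \<noteq> {}" by (auto simp: Ham_def)
    show "inv\<^bsub>add_group (Poiss A P)\<^esub> X \<in> Ham A P" if "X \<in> Ham A P" for X
    proof -
      have "inv\<^bsub>add_group (Poiss A P)\<^esub> X = - X"
        by (rule inv_equality) (use that ham_add_Ham [OF that that] Ham_subset_Poiss in \<open>auto simp: add_group_def\<close>)
      then show ?thesis using ham_add_Ham [OF that that] by simp
    qed
  qed (use Ham_subset_Poiss ham_add_Ham in \<open>auto simp: add_group_def\<close>)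
  then show ?thesis by (rule subgroup_imp_normal)
qed

lemma poisson_class_eq: "poisson_class A P X = (\<lambda>h. h + X) ` Ham A P"
  by (auto simp: poisson_class_def r_coset_def add_group_def)

text \<open>Cosets are formed by addition alone, so translates of \<open>Ham A P\<close> by
  arbitrary fields can be compared through their difference.\<close>

lemma poisson_class_cong:
  assumes "X - Y \<in> Ham A P"
  shows "poisson_class A P X = poisson_class A P Y"
proof -
  have *: "poisson_class A P X \<subseteq> poisson_class A P Y" if d: "X - Y \<in> Ham A P" for X Y
  proof
    fix Z assume "Z \<in> poisson_class A P X"
    then obtain h where h: "h \<in> Ham A P" "Z = h + X" by (auto simp: poisson_class_eq)
    then have "Z = (h + (X - Y)) + Y" by simp
    then show "Z \<in> poisson_class A P Y"
      using ham_add_Ham(1) [OF h(1) d] unfolding poisson_class_eq by (rule image_eqI)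
  qed
  have "Y - X \<in> Ham A P" using ham_add_Ham(2) [OF assms assms] by simp
  then show ?thesis using * assms by blast
qed

text \<open>The inverse in the quotient is a description over the carrier, which is why
  \<open>Y\<close> is taken from \<open>Poiss A P\<close>; the product is a sum of sets and is
  computed directly.\<close>

lemma H1_poisson_diff:
  assumes Y: "Y \<in> Poiss A P"
  shows "poisson_class A P X \<otimes>\<^bsub>H1_poisson A P\<^esub> inv\<^bsub>H1_poisson A P\<^esub> (poisson_class A P Y) =
    poisson_class A P (X - Y)"
proof -
  interpret N: normal "Ham A P" "add_group (Poiss A P)" by (rule normal_Ham)
  have Yc: "Y \<in> carrier (add_group (Poiss A P))" using Y by (simp add: add_group_def)
  have "- Y \<in> Poiss A P" using Poiss_lincomb [OF Y Y, of "-1" 0] by (simp add: fun_Compl_def)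
  then have inv: "inv\<^bsub>add_group (Poiss A P)\<^esub> Y = - Y"
    using Y by (intro N.inv_equality) (auto simp: add_group_def)
  have "poisson_class A P Y \<in> carrier (add_group (Poiss A P) Mod Ham A P)"
    using Yc by (auto simp: poisson_class_def FactGroup_def RCOSETS_def)
  then have "inv\<^bsub>H1_poisson A P\<^esub> (poisson_class A P Y) = set_inv\<^bsub>add_group (Poiss A P)\<^esub> (poisson_class A P Y)"
    unfolding H1_poisson_def by (rule N.inv_FactGroup)
  also have "\<dots> = poisson_class A P (- Y)"
    unfolding poisson_class_def using N.rcos_inv [OF Yc] inv by simp
  finally have i: "inv\<^bsub>H1_poisson A P\<^esub> (poisson_class A P Y) = poisson_class A P (- Y)" .
  have "poisson_class A P X \<otimes>\<^bsub>H1_poisson A P\<^esub> poisson_class A P Y' = poisson_class A P (X + Y')" for Y'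
  proof -
    have "poisson_class A P X \<otimes>\<^bsub>H1_poisson A P\<^esub> poisson_class A P Y' =
        (\<Union>h\<in>Ham A P. \<Union>k\<in>Ham A P. {(h + X) + (k + Y')})"
      by (simp add: H1_poisson_def FactGroup_def set_mult_def poisson_class_eq) (simp add: add_group_def)
    also have "\<dots> = (\<lambda>h. h + (X + Y')) ` Ham A P"
    proof (intro equalityI subsetI)
      fix Z assume "Z \<in> (\<Union>h\<in>Ham A P. \<Union>k\<in>Ham A P. {(h + X) + (k + Y')})"
      then obtain h k where hk: "h \<in> Ham A P" "k \<in> Ham A P" "Z = (h + X) + (k + Y')" by blast
      then have "Z = (h + k) + (X + Y')" by (simp add: algebra_simps)
      then show "Z \<in> (\<lambda>h. h + (X + Y')) ` Ham A P" using ham_add_Ham(1) hk by blast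
    next
      fix Z assume "Z \<in> (\<lambda>h. h + (X + Y')) ` Ham A P"
      then obtain h where h: "h \<in> Ham A P" "Z = h + (X + Y')" by blast
      \<comment> \<open>Zero splits the single Hamiltonian summand \<open>h\<close> into two, one
        for each coset.\<close>
      have "0 \<in> Ham A P" using ham_add_Ham [OF h(1) ham_add_Ham(2) [OF h(1) h(1)]] by simp
      moreover have "Z = (h + X) + (0 + Y')" using h by (simp add: algebra_simps)
      ultimately show "Z \<in> (\<Union>h\<in>Ham A P. \<Union>k\<in>Ham A P. {(h + X) + (k + Y')})" using h(1) by blast
    qed
    finally show ?thesis by (simp add: poisson_class_eq)
  qed
  then show ?thesis by (simp add: i)
qed

end

subsection \<open>Divergence\<close>

context atlas
begin

lemma form_in_alt_img:
  assumes "\<And>y. \<omega> y \<in> alt_forms k UNIV" "adm c" "s \<in> chart_img c"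
  shows "(\<lambda>us. form_in A c \<omega> us s) \<in> alt_forms k UNIV"
  unfolding form_in_def by (rule alt_forms_frame [OF assms(1,2) inv_in [OF assms(2,3)]])

text \<open>In a chart such a form is its coefficient on \<open>B\<close> times a constant form,
  hence its components have a common logarithmic derivative. \<open>N\<close> collects directions
  that it annihilates: none for a volume form, the leaf directions for \<sigma>.\<close>

lemma fd_form_in_proportional:
  assumes \<omega>: "\<omega> \<in> forms A (length B)" and c: "adm c" "x \<in> chart_dom c"
    and N: "\<And>s us u. s \<in> chart_img c \<Longrightarrow> u \<in> N \<Longrightarrow> u \<in> set us \<Longrightarrow> form_in A c \<omega> us s = 0"
    and B: "span (N \<union> set B) = UNIV"
  shows "form_in A c \<omega> B (chart_map c x) * fd (form_in A c \<omega> us) (chart_map c x) h =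
    form_in A c \<omega> us (chart_map c x) * fd (form_in A c \<omega> B) (chart_map c x) h"
proof -
  let ?t = "chart_map c x"
  note alt = form_in_alt_img [of \<omega> "length B", OF formsD(1) [OF \<omega>] c(1)]
  have "\<forall>\<^sub>F s in nhds ?t. form_in A c \<omega> B ?t * form_in A c \<omega> us s = form_in A c \<omega> us ?t * form_in A c \<omega> B s"
    using ev_img [OF c]
  proof eventually_elim
    case (elim s)
    then show ?case
      using alt_forms_proportional [OF alt [OF map_in [OF c]] alt [OF elim] subspace_UNIV B, of us]
        N [OF map_in [OF c]] N [OF elim] by (simp add: mult.commute)
  qed
  from fd_cong [OF this]
  have "fd (\<lambda>s. form_in A c \<omega> B ?t * form_in A c \<omega> us s) ?t h = fd (\<lambda>s. form_in A c \<omega> us ?t * form_in A c \<omega> B s) ?t h"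
    by simp
  then show ?thesis
    by (simp add: fd_eqI [OF has_derivative_mult_right [OF smooth_at_has_derivative [OF formsD(2) [OF \<omega> c]]]])
qed

lemma form_in_nonzero:
  assumes \<omega>: "\<omega> \<in> forms A (length B)" and c: "adm c" "x \<in> chart_dom c" and nz: "\<omega> x vs \<noteq> 0"
    and N: "\<And>us u. u \<in> N \<Longrightarrow> u \<in> set us \<Longrightarrow> form_in A c \<omega> us (chart_map c x) = 0"
    and B: "span (N \<union> set B) = UNIV"
  shows "form_in A c \<omega> B (chart_map c x) \<noteq> 0"
proof
  assume 0: "form_in A c \<omega> B (chart_map c x) = 0"
  have "form_in A c \<omega> (map (chart_diff A c x) vs) (chart_map c x) = 0"
    by (rule alt_forms_eq_0 [OF form_in_alt_img [of \<omega> "length B", OF formsD(1) [OF \<omega>] c(1) map_in [OF c]]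
          subspace_UNIV B _ 0]) (rule N)
  then show False using nz c by (simp add: form_in_map o_def)
qed

lemma volume_formsD:
  assumes "\<Omega> \<in> volume_forms A"
  shows "\<Omega> \<in> forms A DIM('e)" and "\<exists>vs. \<Omega> x vs \<noteq> 0"
  using assms by (auto simp: volume_forms_def nowhere_vanishing_def)

lemma volume_form_in_nonzero:
  assumes "\<Omega> \<in> volume_forms A" "onb (B :: 'e list)" "adm c" "x \<in> chart_dom c"
  shows "form_in A c \<Omega> B (chart_map c x) \<noteq> 0"
proof -
  obtain vs where "\<Omega> x vs \<noteq> 0" using volume_formsD(2) [OF assms(1)] by blast
  then show ?thesis
    using form_in_nonzero [of \<Omega> B c x vs "{}"] volume_formsD(1) [OF assms(1)] assms onb_length(1) [OF assms(2)]
    by (simp add: onb_def)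
qed

text \<open>The classical formula div X = X(ln |w|) + tr DX, with w the coefficient of \<Omega>:
  proportionality of the components gives the first summand, \<open>trace_form\<close> the
  second.\<close>

lemma lie_form_top:
  fixes B :: "'e list"
  assumes \<Omega>: "\<Omega> \<in> volume_forms A" and X: "smooth_vec_at x X" and B: "onb B" and c: "adm c" "x \<in> chart_dom c"
  defines "t \<equiv> chart_map c x"
  shows "lie_form A X \<Omega> x vs = (fd (form_in A c \<Omega> B) t (chart_diff A c x (X x)) / form_in A c \<Omega> B t +
    (\<Sum>b\<in>set B. fd (vec_in A c X) t b \<bullet> b)) * \<Omega> x vs"
proof -
  define us where "us = map (chart_diff A c x) vs"
  have len: "length B = DIM('e)" by (rule onb_length(1) [OF B])
  have \<Omega>f: "\<Omega> \<in> forms A (length B)" using volume_formsD(1) [OF \<Omega>] len by simp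
  have nz: "form_in A c \<Omega> B t \<noteq> 0" unfolding t_def by (rule volume_form_in_nonzero [OF \<Omega> B c])
  have sp: "span ({} \<union> set B) = UNIV" using B by (simp add: onb_def)
  have \<Omega>us: "form_in A c \<Omega> us t = \<Omega> x vs" using c by (simp add: t_def us_def form_in_map o_def)
  have "linear (fd (vec_in A c X) t)"
    unfolding t_def using X smooth_vec_at_iff [OF c] smooth_at_linear_fd by blast
  from trace_form [OF B form_in_alt_img [of \<Omega>, OF formsD(1) [OF \<Omega>f] c(1) map_in [OF c]] this, of us]
  have "(\<Sum>i<length vs. form_in A c \<Omega> (us[i := fd (vec_in A c X) t (us ! i)]) t) =
      (\<Sum>b\<in>set B. fd (vec_in A c X) t b \<bullet> b) * \<Omega> x vs"
    using \<Omega>us by (simp add: t_def us_def)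
  moreover have "fd (form_in A c \<Omega> us) t h = fd (form_in A c \<Omega> B) t h / form_in A c \<Omega> B t * \<Omega> x vs" for h
    using fd_form_in_proportional [OF \<Omega>f c _ sp, of us h] nz \<Omega>us
    by (simp add: t_def field_simps)
  ultimately show ?thesis
    using lie_form_chart [OF \<Omega>f X c, of vs] by (simp add: t_def us_def distrib_right)
qed

text \<open>At every point \<Omega> is nonzero on some list, so the factor in
  \<open>lie_form_top\<close> is unique. This resolves the description and shows at once that the
  expression is the same in all charts.\<close>

lemma divergence_eq:
  fixes B :: "'e list"
  assumes \<Omega>: "\<Omega> \<in> volume_forms A" and X: "X \<in> vector_fields A" and B: "onb B" and c: "adm c" "x \<in> chart_dom c"
  defines "t \<equiv> chart_map c x"
  shows "divergence A \<Omega> X x = fd (form_in A c \<Omega> B) t (chart_diff A c x (X x)) / form_in A c \<Omega> B t +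
    (\<Sum>b\<in>set B. fd (vec_in A c X) t b \<bullet> b)"
proof -
  define d where "d = (\<lambda>c x. fd (form_in A c \<Omega> B) (chart_map c x) (chart_diff A c x (X x)) / form_in A c \<Omega> B (chart_map c x) +
    (\<Sum>b\<in>set B. fd (vec_in A c X) (chart_map c x) b \<bullet> b))"
  have L: "lie_form A X \<Omega> x vs = d c x * \<Omega> x vs" if "adm c" "x \<in> chart_dom c" for c x vs
    unfolding d_def using lie_form_top [OF \<Omega> _ B that] X by (simp add: vector_fields_iff)
  define g where "g = (\<lambda>x. d (base_chart A x) x)"
  have g: "lie_form A X \<Omega> x vs = g x * \<Omega> x vs" for x vs
    unfolding g_def by (rule L [OF base_chart(3,2)])
  have uniq: "g' x = g x" if "\<And>vs. lie_form A X \<Omega> x vs = g' x * \<Omega> x vs" for g' x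
    using that g volume_formsD(2) [OF \<Omega>, of x] by (metis mult_cancel_right)
  have "divergence A \<Omega> X = g"
    unfolding divergence_def
  proof (rule the_equality)
    fix g' assume "\<forall>x vs. lie_form A X \<Omega> x vs = g' x * \<Omega> x vs"
    then show "g' = g" using uniq by blast
  qed (use g in blast)
  moreover have "d c x = g x" using uniq [of x "\<lambda>x. d c x"] L [OF c] by blast
  ultimately show ?thesis by (simp add: d_def t_def)
qed

end

subsection \<open>The modular vector field\<close>

context poisson_manifold
begin

text \<open>The components given in the overview with the product rule carried out, the density
  being the value of \<Omega> on \<open>B\<close>.\<close>

definition modular_chart :: "('a \<Rightarrow> 'e list \<Rightarrow> real) \<Rightarrow> 'e list \<Rightarrow> ('a, 'e) chart \<Rightarrow> 'e \<Rightarrow> 'e" where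
  "modular_chart \<Omega> B c s = (\<Sum>i\<in>set B. (\<Sum>j\<in>set B.
     fd (form_in A c \<Omega> B) s j / form_in A c \<Omega> B s * bivec_in A c P (co i) (co j) s +
     fd (bivec_in A c P (co i) (co j)) s j) *\<^sub>R i)"

lemma bivec_in_antisym:
  assumes "adm c" "s \<in> chart_img c"
  shows "bivec_in A c P (co j) (co i) s = - bivec_in A c P (co i) (co j) s"
  unfolding bivec_in_def
  by (intro bivector_antisym [OF bivector] linear_compose linear_co linear_chart_diff assms inv_in)

text \<open>The Hessian of \<open>f\<close> is symmetric and \<open>P\<close> antisymmetric, so
  second derivatives of \<open>f\<close> drop out of the divergence. What remains is of first order
  in \<open>f\<close>, which is why a modular vector field exists.\<close>

lemma divergence_ham:
  assumes \<Omega>: "\<Omega> \<in> volume_forms A" and f: "f \<in> smooth_functions A" and B: "onb B" and c: "adm c" "x \<in> chart_dom c"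
  shows "divergence A \<Omega> (ham_field A P f) x = fd (f \<circ> chart_inv c) (chart_map c x) (modular_chart \<Omega> B c (chart_map c x))"
proof -
  define t where "t = chart_map c x"
  define F where "F = f \<circ> chart_inv c"
  define Q where "Q = (\<lambda>i j. bivec_in A c P (co i) (co j))"
  define w where "w = form_in A c \<Omega> B"
  have sf: "smooth_fun_at x f" using f by (simp add: smooth_functions_iff)
  have F: "smooth_at t F" unfolding t_def F_def by (rule smooth_fun_atD [OF sf c])
  have Q: "smooth_at t (Q i j)" for i j unfolding t_def Q_def by (intro smooth_bivec_in c linear_co)
  have tin: "t \<in> chart_img c" unfolding t_def by (rule map_in [OF c])
  have w: "smooth_at t w"
    unfolding t_def w_def by (rule formsD(2) [OF volume_formsD(1) [OF \<Omega>] c])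
  have X: "ham_field A P f \<in> vector_fields A"
    using smooth_ham f by (simp add: vector_fields_iff smooth_functions_iff)
  have lF: "linear (fd F t)" and lw: "linear (fd w t)" using F w smooth_at_linear_fd by auto
  have Xx: "chart_diff A c x (ham_field A P f x) = (\<Sum>j\<in>set B. (\<Sum>i\<in>set B. fd F t i * Q i j t) *\<^sub>R j)"
    using ham_chart_diff [OF sf c B] by (simp add: t_def F_def Q_def)
  have ev: "\<forall>\<^sub>F s in nhds t. (\<Sum>j\<in>set B. (\<Sum>i\<in>set B. fd F s i * Q i j s) *\<^sub>R j) = vec_in A c (ham_field A P f) s"
    using ham_in_chart [OF sf c B] by (simp add: t_def F_def Q_def)
  have D: "((\<lambda>s. \<Sum>j\<in>set B. (\<Sum>i\<in>set B. fd F s i * Q i j s) *\<^sub>R j) has_derivative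
      (\<lambda>h. \<Sum>j\<in>set B. (\<Sum>i\<in>set B. fd F t i * fd (Q i j) t h + fd (\<lambda>s. fd F s i) t h * Q i j t) *\<^sub>R j)) (at t)"
    by (intro has_derivative_sum has_derivative_scaleR_left has_derivative_mult
        smooth_at_has_derivative Q smooth_at_fd F)
  have "(\<Sum>b\<in>set B. fd (vec_in A c (ham_field A P f)) t b \<bullet> b) =
      (\<Sum>b\<in>set B. \<Sum>i\<in>set B. fd F t i * fd (Q i b) t b + fd (\<lambda>s. fd F s i) t b * Q i b t)"
    unfolding fd_eqI [OF has_derivative_cong_nhds [OF ev D]]
    by (intro sum.cong refl onb_inner_sum [OF B])
  also have "\<dots> = (\<Sum>b\<in>set B. \<Sum>i\<in>set B. fd F t i * fd (Q i b) t b) +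
      (\<Sum>b\<in>set B. \<Sum>i\<in>set B. fd (\<lambda>s. fd F s i) t b * Q i b t)"
    by (simp add: sum.distrib)
  also have "(\<Sum>b\<in>set B. \<Sum>i\<in>set B. fd (\<lambda>s. fd F s i) t b * Q i b t) = 0"
  proof -
    define S where "S = (\<Sum>b\<in>set B. \<Sum>i\<in>set B. fd (\<lambda>s. fd F s i) t b * Q i b t)"
    have "S = (\<Sum>i\<in>set B. \<Sum>b\<in>set B. fd (\<lambda>s. fd F s i) t b * Q i b t)"
      unfolding S_def by (rule sum.swap)
    also have "\<dots> = (\<Sum>i\<in>set B. \<Sum>b\<in>set B. - (fd (\<lambda>s. fd F s b) t i * Q b i t))"
    proof (intro sum.cong refl)
      fix i b
      have "Q i b t = - Q b i t" unfolding Q_def by (rule bivec_in_antisym [OF c(1) tin])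
      then show "fd (\<lambda>s. fd F s i) t b * Q i b t = - (fd (\<lambda>s. fd F s b) t i * Q b i t)"
        using second_derivative_symmetric [OF F, of i b] by simp
    qed
    also have "\<dots> = - S" unfolding S_def by (simp add: sum_negf)
    finally show ?thesis by (simp add: S_def)
  qed
  finally have tr: "(\<Sum>b\<in>set B. fd (vec_in A c (ham_field A P f)) t b \<bullet> b) =
      (\<Sum>j\<in>set B. \<Sum>i\<in>set B. fd F t i * fd (Q i j) t j)" by simp
  have "fd w t (chart_diff A c x (ham_field A P f x)) / w t =
      (\<Sum>j\<in>set B. \<Sum>i\<in>set B. fd F t i * (fd w t j / w t * Q i j t))"
    unfolding Xx linear_sum [OF lw] linear_cmul [OF lw] real_scaleR_def sum_divide_distrib sum_distrib_right
    by (intro sum.cong refl) (simp add: ac_simps)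
  then have "divergence A \<Omega> (ham_field A P f) x =
      (\<Sum>j\<in>set B. \<Sum>i\<in>set B. fd F t i * (fd w t j / w t * Q i j t + fd (Q i j) t j))"
    using divergence_eq [OF \<Omega> X B c] tr
    by (simp add: w_def t_def sum.distrib distrib_left)
  also have "\<dots> = (\<Sum>i\<in>set B. \<Sum>j\<in>set B. fd F t i * (fd w t j / w t * Q i j t + fd (Q i j) t j))"
    by (rule sum.swap)
  also have "\<dots> = fd F t (modular_chart \<Omega> B c t)"
    unfolding modular_chart_def linear_sum [OF lF] linear_cmul [OF lF]
    by (simp add: w_def Q_def sum_distrib_left sum_distrib_right ac_simps)
  finally show ?thesis by (simp add: F_def t_def)
qed

lemma smooth_modular_chart:
  assumes \<Omega>: "\<Omega> \<in> volume_forms A" and B: "onb B" and c: "adm c" "x \<in> chart_dom c"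
  shows "smooth_at (chart_map c x) (modular_chart \<Omega> B c)"
  unfolding modular_chart_def
  by (intro smooth_at_sum smooth_at_scaleR smooth_at_add smooth_at_mult smooth_at_divide smooth_at_const
      smooth_at_fd smooth_bivec_in c linear_co formsD(2) [OF volume_formsD(1) [OF \<Omega>] c]
      volume_form_in_nonzero [OF \<Omega> B c])

text \<open>A vector is determined by its action on functions, and the divergence does not refer to
  a chart. So the formulas of all charts describe one and the same field; this takes the place of a
  transformation law for \<open>modular_chart\<close>.\<close>

lemma modular_field:
  assumes \<Omega>: "\<Omega> \<in> volume_forms A"
  shows modular_field_smooth: "modular_field A P \<Omega> \<in> vector_fields A"
    and modular_field_chart: "onb B \<Longrightarrow> adm c \<Longrightarrow> x \<in> chart_dom c \<Longrightarrow>
      chart_diff A c x (modular_field A P \<Omega> x) = modular_chart \<Omega> B c (chart_map c x)"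
proof -
  obtain B0 :: "'e list" where B0: "onb B0" using exists_onb by blast
  \<comment> \<open>In the base chart of \<open>x\<close> a tangent vector at \<open>x\<close>
    coincides with its components, so the chart formula is itself a vector at
    \<open>x\<close>.\<close>
  define Z where "Z = (\<lambda>x. modular_chart \<Omega> B0 (base_chart A x) (base_pt A x))"
  have Zdiff: "differential A f x (Z x) = divergence A \<Omega> (ham_field A P f) x" if "f \<in> smooth_functions A" for f x
    using divergence_ham [OF \<Omega> that B0 base_chart(3,2)] that
    by (simp add: Z_def base_pt_def differential_def)
  have Zc: "chart_diff A c x (Z x) = modular_chart \<Omega> B c (chart_map c x)"
    if B: "onb B" and c: "adm c" "x \<in> chart_dom c" for B c x
  proof -
    have "Z x = chart_frame A c x (modular_chart \<Omega> B c (chart_map c x))"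
    proof (rule vector_eqI)
      fix f assume f: "f \<in> smooth_functions A"
      then have "smooth_fun_at x f" by (simp add: smooth_functions_iff)
      from differential_frame [OF this c] divergence_ham [OF \<Omega> f B c] Zdiff [OF f]
      show "differential A f x (Z x) = differential A f x (chart_frame A c x (modular_chart \<Omega> B c (chart_map c x)))"
        by simp
    qed
    then show ?thesis using c by simp
  qed
  have "smooth_vec_at x Z" for x
  proof -
    let ?c = "base_chart A x"
    have "\<forall>\<^sub>F s in nhds (chart_map ?c x). modular_chart \<Omega> B0 ?c s = vec_in A ?c Z s"
      unfolding vec_in_def
      by (rule ev_chart [OF base_chart(3,2)], use ev_dom [OF base_chart(3,2)] in eventually_elim)
        (simp add: Zc [OF B0 base_chart(3)])
    from smooth_at_cong [OF this smooth_modular_chart [OF \<Omega> B0 base_chart(3,2)]]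
    show ?thesis by (simp add: smooth_vec_at_def base_pt_def)
  qed
  then have Zv: "Z \<in> vector_fields A" by (simp add: vector_fields_iff)
  have "modular_field A P \<Omega> = Z"
    unfolding modular_field_def
  proof (rule the_equality)
    fix Z' assume Z': "Z' \<in> vector_fields A \<and>
      (\<forall>f\<in>smooth_functions A. \<forall>x. differential A f x (Z' x) = divergence A \<Omega> (ham_field A P f) x)"
    show "Z' = Z"
    proof
      fix x show "Z' x = Z x" by (rule vector_eqI [of x]) (use Z' Zdiff in simp)
    qed
  qed (use Zv Zdiff in blast)
  then show "modular_field A P \<Omega> \<in> vector_fields A"
    and "onb B \<Longrightarrow> adm c \<Longrightarrow> x \<in> chart_dom c \<Longrightarrow>
      chart_diff A c x (modular_field A P \<Omega> x) = modular_chart \<Omega> B c (chart_map c x)"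
    using Zv Zc by auto
qed

text \<open>Multiplying \<Omega> by a function a adds X_f(ln |a|) to the divergence of the
  Hamiltonian field X_f, and by antisymmetry this is minus the Hamiltonian field of ln |a| applied
  to f.\<close>

lemma modular_field_indep:
  assumes \<Omega>: "\<Omega> \<in> volume_forms A" and \<Omega>': "\<Omega>' \<in> volume_forms A"
  shows "modular_field A P \<Omega> - modular_field A P \<Omega>' \<in> Ham A P"
proof -
  obtain B :: "'e list" where B: "onb B" using exists_onb by blast
  have len: "length B = DIM('e)" by (rule onb_length(1) [OF B])
  have sp: "span ({} \<union> set B) = UNIV" using B by (simp add: onb_def)
  \<comment> \<open>Top-degree forms have the same quotient on every list on which they do not
    vanish, so evaluation on \<open>B\<close> gives a function that does not depend on a
    chart.\<close>
  define h where "h = (\<lambda>y. ln \<bar>\<Omega>' y B / \<Omega> y B\<bar>)"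
  have hc: "h y = ln \<bar>form_in A c \<Omega>' B (chart_map c y)\<bar> - ln \<bar>form_in A c \<Omega> B (chart_map c y)\<bar>"
    if c: "adm c" "y \<in> chart_dom c" for c y
  proof -
    have nz: "form_in A c \<Omega> B (chart_map c y) \<noteq> 0" "form_in A c \<Omega>' B (chart_map c y) \<noteq> 0"
      "\<Omega> y B \<noteq> 0" "\<Omega>' y B \<noteq> 0"
      using volume_form_in_nonzero [OF \<Omega> B c] volume_form_in_nonzero [OF \<Omega>' B c]
        volume_form_in_nonzero [OF \<Omega> B base_chart(3,2)] volume_form_in_nonzero [OF \<Omega>' B base_chart(3,2)]
      by (simp_all add: form_in_map base_chart map_idI)
    have "\<Omega> y \<in> alt_forms (length B) UNIV" "\<Omega>' y \<in> alt_forms (length B) UNIV"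
      using formsD(1) volume_formsD(1) \<Omega> \<Omega>' len by metis+
    from alt_forms_proportional [OF this subspace_UNIV sp, of "map (chart_frame A c y) B"]
    have "\<Omega> y B * form_in A c \<Omega>' B (chart_map c y) = \<Omega>' y B * form_in A c \<Omega> B (chart_map c y)"
      using c by (simp add: form_in_map)
    then have eq: "\<Omega>' y B / \<Omega> y B = form_in A c \<Omega>' B (chart_map c y) / form_in A c \<Omega> B (chart_map c y)"
      using nz by (simp add: field_simps)
    have "h y = ln \<bar>form_in A c \<Omega>' B (chart_map c y) / form_in A c \<Omega> B (chart_map c y)\<bar>"
      by (simp only: h_def eq)
    then show ?thesis using nz by (simp add: abs_divide ln_div)
  qed
  have evh: "\<forall>\<^sub>F s in nhds (chart_map c y). ln \<bar>form_in A c \<Omega>' B s\<bar> - ln \<bar>form_in A c \<Omega> B s\<bar> = (h \<circ> chart_inv c) s"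
    if c: "adm c" "y \<in> chart_dom c" for c y
    unfolding o_def
    by (rule ev_chart [OF c], use ev_dom [OF c] in eventually_elim) (simp add: hc [OF c(1)])
  have w: "smooth_at (chart_map c y) (form_in A c \<Omega> B)" "smooth_at (chart_map c y) (form_in A c \<Omega>' B)"
    if c: "adm c" "y \<in> chart_dom c" for c y
    using formsD(2) [OF volume_formsD(1) [OF \<Omega>] c] formsD(2) [OF volume_formsD(1) [OF \<Omega>'] c] by auto
  have h: "smooth_fun_at y h" for y
  proof -
    note c = base_chart(3,2) [of y]
    have "smooth_at (chart_map (base_chart A y) y) (\<lambda>s. ln \<bar>form_in A (base_chart A y) \<Omega>' B s\<bar> - ln \<bar>form_in A (base_chart A y) \<Omega> B s\<bar>)"
      by (intro smooth_at_diff smooth_at_ln_abs w c volume_form_in_nonzero [OF \<Omega>' B c] volume_form_in_nonzero [OF \<Omega> B c])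
    from smooth_at_cong [OF evh [OF c] this] show ?thesis by (simp add: smooth_fun_at_def base_pt_def o_def)
  qed
  then have hs: "h \<in> smooth_functions A" by (simp add: smooth_functions_iff)
  have "modular_field A P \<Omega> x - modular_field A P \<Omega>' x = ham_field A P h x" for x
  proof -
    define c where "c = base_chart A x"
    define t where "t = chart_map c x"
    have c: "adm c" "x \<in> chart_dom c" using base_chart by (auto simp: c_def)
    have tin: "t \<in> chart_img c" unfolding t_def by (rule map_in [OF c])
    have id: "chart_diff A c x v = v" for v by (simp add: c_def)
    have "((\<lambda>s. ln \<bar>form_in A c \<Omega>' B s\<bar> - ln \<bar>form_in A c \<Omega> B s\<bar>) has_derivative
        (\<lambda>v. fd (form_in A c \<Omega>' B) t v / form_in A c \<Omega>' B t - fd (form_in A c \<Omega> B) t v / form_in A c \<Omega> B t)) (at t)"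
      unfolding t_def
      by (intro has_derivative_diff has_derivative_ln_abs smooth_at_has_derivative w c
          volume_form_in_nonzero [OF \<Omega>' B c] volume_form_in_nonzero [OF \<Omega> B c])
    from fd_eqI [OF has_derivative_cong_nhds [OF evh [OF c, folded t_def] this]]
    have dh: "fd (h \<circ> chart_inv c) t = (\<lambda>v. fd (form_in A c \<Omega>' B) t v / form_in A c \<Omega>' B t - fd (form_in A c \<Omega> B) t v / form_in A c \<Omega> B t)" .
    have "ham_field A P h x = (\<Sum>i\<in>set B. (\<Sum>j\<in>set B. fd (h \<circ> chart_inv c) t j * bivec_in A c P (co j) (co i) t) *\<^sub>R i)"
      using ham_chart_diff [OF h c B] by (simp add: id t_def)
    also have "\<dots> = (\<Sum>i\<in>set B. (\<Sum>j\<in>set B. (fd (form_in A c \<Omega> B) t j / form_in A c \<Omega> B t -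
        fd (form_in A c \<Omega>' B) t j / form_in A c \<Omega>' B t) * bivec_in A c P (co i) (co j) t) *\<^sub>R i)"
    proof (intro sum.cong refl arg_cong2 [of _ _ _ _ scaleR])
      fix i j
      show "fd (h \<circ> chart_inv c) t j * bivec_in A c P (co j) (co i) t =
        (fd (form_in A c \<Omega> B) t j / form_in A c \<Omega> B t - fd (form_in A c \<Omega>' B) t j / form_in A c \<Omega>' B t) * bivec_in A c P (co i) (co j) t"
        unfolding bivec_in_antisym [OF c(1) tin, of j i] dh by (simp add: algebra_simps)
    qed
    also have "\<dots> = modular_chart \<Omega> B c t - modular_chart \<Omega>' B c t"
      unfolding modular_chart_def sum_subtractf [symmetric] scaleR_diff_left [symmetric]
      by (intro sum.cong refl arg_cong2 [of _ _ _ _ scaleR]) (simp add: algebra_simps)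
    also have "\<dots> = modular_field A P \<Omega> x - modular_field A P \<Omega>' x"
      using modular_field_chart [OF \<Omega> B c] modular_field_chart [OF \<Omega>' B c] by (simp add: id t_def)
    finally show ?thesis by simp
  qed
  then have "modular_field A P \<Omega> - modular_field A P \<Omega>' = ham_field A P h" by (intro ext) simp
  then show ?thesis using hs by (auto simp: Ham_def)
qed

lemma modular_class_eq:
  assumes \<Omega>: "\<Omega> \<in> volume_forms A"
  shows "modular_class A P = poisson_class A P (modular_field A P \<Omega>)"
proof -
  have "poisson_class A P (modular_field A P \<Omega>') = poisson_class A P (modular_field A P \<Omega>)"
    if "\<Omega>' \<in> volume_forms A" for \<Omega>'
    by (rule poisson_class_cong [OF modular_field_indep [OF that \<Omega>]])
  then have "(\<lambda>\<Omega>. poisson_class A P (modular_field A P \<Omega>)) ` volume_forms A =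
      (\<lambda>_. poisson_class A P (modular_field A P \<Omega>)) ` volume_forms A"
    by (intro image_cong refl)
  then have "(\<lambda>\<Omega>. poisson_class A P (modular_field A P \<Omega>)) ` volume_forms A = {poisson_class A P (modular_field A P \<Omega>)}"
    using \<Omega> image_constant [of \<Omega>] by simp
  then show ?thesis by (simp add: modular_class_def)
qed

end

subsection \<open>Foliated charts\<close>

lemma mem_adapted_iff:
  assumes onb: "onb (B1 @ B2)" and L: "span (set B1) = L"
  shows "v \<in> L \<longleftrightarrow> (\<forall>b\<in>set B2. v \<bullet> b = 0)"
proof
  assume v: "v \<in> L"
  show "\<forall>b\<in>set B2. v \<bullet> b = 0"
  proof
    fix b assume b: "b \<in> set B2"
    have "x \<bullet> b = 0" if "x \<in> set B1" for x
    proof -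
      have "x \<noteq> b" using onb that b by (auto simp: onb_def)
      then show ?thesis using onb that b by (simp add: onb_def)
    qed
    moreover have "subspace {x. x \<bullet> b = 0}" by (auto simp: subspace_def inner_add_left)
    ultimately have "span (set B1) \<subseteq> {x. x \<bullet> b = 0}" by (intro span_minimal) auto
    then show "v \<bullet> b = 0" using v L by auto
  qed
next
  assume 0: "\<forall>b\<in>set B2. v \<bullet> b = 0"
  have "v = (\<Sum>b\<in>set (B1 @ B2). (v \<bullet> b) *\<^sub>R b)" using onb_representation [OF onb] by simp
  also have "\<dots> = (\<Sum>b\<in>set B1. (v \<bullet> b) *\<^sub>R b)"
    by (rule sum.mono_neutral_right) (use 0 in auto)
  also have "\<dots> \<in> span (set B1)" by (intro span_sum span_scale span_base)
  finally show "v \<in> L" using L by simp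
qed

lemma adapted_representation:
  assumes onb: "onb (B1 @ B2)" and L: "span (set B1) = L" and v: "v \<in> L"
  shows "v = (\<Sum>b\<in>set B1. (v \<bullet> b) *\<^sub>R b)"
proof -
  have "v = (\<Sum>b\<in>set (B1 @ B2). (v \<bullet> b) *\<^sub>R b)" using onb_representation [OF onb] by simp
  also have "\<dots> = (\<Sum>b\<in>set B1. (v \<bullet> b) *\<^sub>R b)"
    by (rule sum.mono_neutral_right) (use mem_adapted_iff [OF onb L, of v] v in auto)
  finally show ?thesis .
qed

text \<open>\<open>B1\<close> spans the leaf direction and \<open>B2\<close> its orthogonal
  complement, so the densities \<rho> and s of the overview are the values of \<tau> on
  \<open>B1\<close> and of \<sigma> on \<open>B2\<close> in a foliated chart.\<close>

locale foliated_manifold = atlas A for A :: "('a::t2_space, 'e::euclidean_space) chart set" +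
  fixes \<V> :: "('a, 'e) foliation" and B1 B2 :: "'e list"
  assumes foliation: "regular_foliation A \<V>"
    and adapted: "onb (B1 @ B2)" "span (set B1) = leaf_dir \<V>"
    and lengths: "length B1 = dim (leaf_dir \<V>)" "length B2 = DIM('e) - dim (leaf_dir \<V>)"
begin

abbreviation "L \<equiv> leaf_dir \<V>"
abbreviation "T \<equiv> tangent_dist A \<V>"
abbreviation "F \<equiv> fol_charts \<V>"

lemma subspace_L: "subspace L"
  using adapted(2) subspace_span by metis

lemmas mem_L_iff = mem_adapted_iff [OF adapted]

lemma span_L_B2: "span (L \<union> set B2) = UNIV"
proof -
  have "set (B1 @ B2) \<subseteq> L \<union> set B2" using adapted(2) span_superset [of "set B1"] by auto
  then have "span (set (B1 @ B2)) \<subseteq> span (L \<union> set B2)" by (rule span_mono)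
  then show ?thesis using adapted(1) by (auto simp: onb_def)
qed

lemma fol_adm: "c \<in> F \<Longrightarrow> adm c"
  using foliation by (auto simp: regular_foliation_def admissible_def)

text \<open>Literally the choice made inside \<open>fol_d\<close>, so that unfolding the latter
  leads to this chart.\<close>

definition fol_chart :: "'a \<Rightarrow> ('a, 'e) chart" where
  "fol_chart x = (SOME c. c \<in> F \<and> x \<in> chart_dom c)"

lemma fol_chart: "fol_chart x \<in> F" "x \<in> chart_dom (fol_chart x)"
proof -
  have "\<exists>c. c \<in> F \<and> x \<in> chart_dom c" using foliation by (auto simp: regular_foliation_def)
  from someI_ex [OF this] show "fol_chart x \<in> F" "x \<in> chart_dom (fol_chart x)"
    by (auto simp: fol_chart_def)
qed

text \<open>Membership in \<open>L\<close> is expressed by linear equations, one for each vector of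
  \<open>B2\<close>, and these survive differentiation.\<close>

lemma fd_in_L:
  assumes "smooth_at t w" "\<forall>\<^sub>F s in nhds t. w s \<in> L"
  shows "fd w t u \<in> L"
  unfolding mem_L_iff
proof
  fix b assume b: "b \<in> set B2"
  have "\<forall>\<^sub>F s in nhds t. w s \<bullet> b = 0" using assms(2) by eventually_elim (use mem_L_iff b in blast)
  from has_derivative_cong_nhds [OF this has_derivative_inner_left [OF smooth_at_has_derivative [OF assms(1)]]]
  have "((\<lambda>s. 0) has_derivative (\<lambda>h. fd w t h \<bullet> b)) (at t)" .
  from has_derivative_unique [OF this has_derivative_const] show "fd w t u \<bullet> b = 0" by metis
qed

text \<open>Foliated charts are related through differences of nearby points. The derivative along
  \<open>u\<close> is obtained by moving from \<open>t\<close> on a line with direction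
  \<open>u\<close>, on which these differences stay in \<open>L\<close>.\<close>

lemma fd_transition_L:
  assumes c: "c \<in> F" "x \<in> chart_dom c" and c': "c' \<in> F" "x \<in> chart_dom c'" and u: "u \<in> L"
  shows "fd (transition c c') (chart_map c x) u \<in> L"
proof -
  define t where "t = chart_map c x"
  define \<phi> where "\<phi> = transition c c'"
  have \<phi>: "smooth_at t \<phi>" unfolding t_def \<phi>_def by (rule smooth_transition) (use c c' fol_adm in auto)
  have "t \<in> overlap c c'" using c c' by (auto simp: t_def overlap_def)
  then obtain N where N: "open N" "t \<in> N" "\<And>s s'. s \<in> N \<Longrightarrow> s' \<in> N \<Longrightarrow> s - s' \<in> L \<Longrightarrow> \<phi> s - \<phi> s' \<in> L"
    using foliation c c' unfolding regular_foliation_def \<phi>_def by meson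
  have line: "((\<lambda>h::real. t + h *\<^sub>R u) has_derivative (\<lambda>h. h *\<^sub>R u)) (at 0)"
    by (auto intro!: derivative_eq_intros)
  define q where "q = (\<lambda>h::real. t + h *\<^sub>R u)"
  have "isCont q 0" using line has_derivative_continuous unfolding q_def by blast
  then have "(q \<longlongrightarrow> q 0) (nhds 0)"
    unfolding isCont_def tendsto_at_iff_tendsto_nhds .
  from topological_tendstoD [OF this N(1)] N(2)
  have "\<forall>\<^sub>F h in nhds (0::real). t + h *\<^sub>R u \<in> N" by (simp add: q_def)
  then have ev: "\<forall>\<^sub>F h in nhds (0::real). \<phi> (t + h *\<^sub>R u) - \<phi> t \<in> L"
    by eventually_elim (intro N(3), use N(2) u subspace_L subspace_scale in auto)
  have "(\<phi> has_derivative fd \<phi> t) (at (t + 0 *\<^sub>R u))" using smooth_at_has_derivative [OF \<phi>] by simp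
  from has_derivative_diff [OF has_derivative_compose [OF line this] has_derivative_const [of "\<phi> t"]]
  have d: "((\<lambda>h. \<phi> (t + h *\<^sub>R u) - \<phi> t) has_derivative (\<lambda>h. fd \<phi> t (h *\<^sub>R u))) (at 0)" by simp
  have "fd \<phi> t (1 *\<^sub>R u) \<in> L"
    unfolding mem_L_iff
  proof
    fix b assume b: "b \<in> set B2"
    have "\<forall>\<^sub>F h in nhds 0. (\<phi> (t + h *\<^sub>R u) - \<phi> t) \<bullet> b = 0"
      using ev by eventually_elim (use mem_L_iff b in blast)
    from has_derivative_cong_nhds [OF this has_derivative_inner_left [OF d]]
    have "((\<lambda>h::real. 0) has_derivative (\<lambda>h. fd \<phi> t (h *\<^sub>R u) \<bullet> b)) (at 0)" .
    from has_derivative_unique [OF this has_derivative_const] show "fd \<phi> t (1 *\<^sub>R u) \<bullet> b = 0" by metis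
  qed
  then show ?thesis by (simp add: t_def \<phi>_def)
qed

lemma tangent_iff:
  assumes c: "c \<in> F" "x \<in> chart_dom c"
  shows "v \<in> T x \<longleftrightarrow> chart_diff A c x v \<in> L"
proof
  assume "v \<in> T x"
  then obtain c' where c': "c' \<in> F" "x \<in> chart_dom c'" "chart_diff A c' x v \<in> L"
    by (auto simp: tangent_dist_def)
  then show "chart_diff A c x v \<in> L"
    using fd_transition_L [OF c'(1,2) c c'(3)] chart_diff_transition [OF fol_adm fol_adm, of c' c] c by simp
qed (use c in \<open>auto simp: tangent_dist_def\<close>)

lemma frame_tangent_iff:
  assumes "c \<in> F" "x \<in> chart_dom c"
  shows "chart_frame A c x u \<in> T x \<longleftrightarrow> u \<in> L"
  using tangent_iff [OF assms] assms fol_adm by simp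

lemma subspace_T: "subspace (T x)"
proof -
  note lin = linear_chart_diff [OF fol_adm [OF fol_chart(1)] fol_chart(2), of x]
  have "T x = {v. chart_diff A (fol_chart x) x v \<in> L}" using tangent_iff [OF fol_chart] by blast
  then show ?thesis
    using subspace_L by (auto simp: subspace_def linear_0 [OF lin] linear_add [OF lin] linear_cmul [OF lin])
qed

lemma fol_formsD:
  assumes \<omega>: "\<omega> \<in> fol_forms A \<V> k"
  shows "\<omega> x \<in> alt_forms k (T x)"
    and "c \<in> F \<Longrightarrow> s \<in> chart_img c \<Longrightarrow> (\<lambda>us. form_in A c \<omega> us s) \<in> alt_forms k L"
    and "c \<in> F \<Longrightarrow> x \<in> chart_dom c \<Longrightarrow> smooth_at (chart_map c x) (form_in A c \<omega> us)"
proof -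
  show alt: "\<omega> x \<in> alt_forms k (T x)" for x using \<omega> by (simp add: fol_forms_def)
  show altc: "(\<lambda>us. form_in A c \<omega> us s) \<in> alt_forms k L" if c: "c \<in> F" "s \<in> chart_img c" for c s
    unfolding form_in_def
    by (rule alt_forms_pullback [OF alt linear_chart_frame])
      (use c fol_adm inv_in frame_tangent_iff in blast)+
  show "smooth_at (chart_map c x) (form_in A c \<omega> us)" if c: "c \<in> F" "x \<in> chart_dom c"
  proof (cases "length us = k \<and> set us \<subseteq> L")
    case True
    then show ?thesis
      using \<omega> c smooth_on_chart_iff [OF fol_adm [OF c(1)], of "form_in A c \<omega> us"] by (auto simp: fol_forms_def)
  next
    case False
    have "\<forall>\<^sub>F s in nhds (chart_map c x). 0 = form_in A c \<omega> us s"
      using ev_img [OF fol_adm [OF c(1)] c(2)]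
      by eventually_elim (use alt_forms_outside [OF altc [OF c(1)] False] in auto)
    then show ?thesis by (rule smooth_at_cong [OF _ smooth_at_const])
  qed
qed

lemma fol_formsI:
  assumes "\<And>x. \<omega> x \<in> alt_forms k (T x)"
    and "\<And>c x us. c \<in> F \<Longrightarrow> x \<in> chart_dom c \<Longrightarrow> length us = k \<Longrightarrow> set us \<subseteq> L \<Longrightarrow>
      smooth_at (chart_map c x) (form_in A c \<omega> us)"
  shows "\<omega> \<in> fol_forms A \<V> k"
  using assms smooth_on_chart_iff fol_adm unfolding fol_forms_def by blast

text \<open>The Reeb form is characterised through tangent vector fields; to determine it on a
  vector, the vector must extend to such a field.\<close>

lemma extend_tangent_vector:
  assumes v: "v \<in> T x"
  obtains X where "X \<in> tangent_fields A \<V>" "X x = v"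
proof -
  define c where "c = fol_chart x"
  have c: "c \<in> F" "x \<in> chart_dom c" using fol_chart by (auto simp: c_def)
  obtain X \<eta> where X: "X \<in> vector_fields A"
    "\<And>y. y \<in> chart_dom c \<Longrightarrow> X y = \<eta> y *\<^sub>R chart_frame A c y (chart_diff A c x v)"
    "\<And>y. y \<notin> chart_dom c \<Longrightarrow> X y = 0" "\<eta> x = (1::real)"
    using extend_chart_vector [OF fol_adm [OF c(1)] c(2)] by metis
  have "X y \<in> T y" for y
  proof (cases "y \<in> chart_dom c")
    case True
    have "chart_frame A c y (chart_diff A c x v) \<in> T y"
      using frame_tangent_iff [OF c(1) True] tangent_iff [OF c] v by simp
    then show ?thesis using X(2) [OF True] subspace_T subspace_scale by metis
  next
    case False
    then show ?thesis using X(3) subspace_T subspace_0 by metis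
  qed
  then have "X \<in> tangent_fields A \<V>" using X(1) by (simp add: tangent_fields_def)
  moreover have "X x = v" using X(2) [OF c(2)] X(4) c fol_adm by simp
  ultimately show ?thesis using that by blast
qed

subsection \<open>The Reeb class\<close>

lemma transversal_volumesD:
  assumes \<sigma>: "\<sigma> \<in> transversal_volumes A \<V>"
  shows "\<sigma> \<in> forms A (length B2)" and "\<exists>vs. \<sigma> x vs \<noteq> 0"
    and "c \<in> F \<Longrightarrow> s \<in> chart_img c \<Longrightarrow> u \<in> L \<Longrightarrow> u \<in> set us \<Longrightarrow> form_in A c \<sigma> us s = 0"
proof -
  show "\<sigma> \<in> forms A (length B2)" using \<sigma> lengths by (simp add: transversal_volumes_def)
  show "\<exists>vs. \<sigma> x vs \<noteq> 0" using \<sigma> by (simp add: transversal_volumes_def nowhere_vanishing_def)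
  assume c: "c \<in> F" "s \<in> chart_img c" and u: "u \<in> L" "u \<in> set us"
  have x: "chart_inv c s \<in> chart_dom c" using inv_in c fol_adm by blast
  have fr: "chart_frame A c (chart_inv c s) u \<in> T (chart_inv c s)" using frame_tangent_iff [OF c(1) x] u by simp
  show "form_in A c \<sigma> us s = 0"
    unfolding form_in_def by (rule ext_power_kill [of _ "DIM('e) - dim L" "annihilator A \<V> (chart_inv c s)" "chart_frame A c (chart_inv c s) u"])
      (use \<sigma> u fr in \<open>auto simp: transversal_volumes_def annihilator_def\<close>)
qed

lemma transversal_nonzero:
  assumes \<sigma>: "\<sigma> \<in> transversal_volumes A \<V>" and c: "c \<in> F" "x \<in> chart_dom c"
  shows "form_in A c \<sigma> B2 (chart_map c x) \<noteq> 0"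
proof -
  obtain vs where "\<sigma> x vs \<noteq> 0" using transversal_volumesD(2) [OF \<sigma>] by blast
  from form_in_nonzero [OF transversal_volumesD(1) [OF \<sigma>] fol_adm [OF c(1)] c(2) this _ span_L_B2]
  show ?thesis using transversal_volumesD(3) [OF \<sigma> c(1) map_in [OF fol_adm [OF c(1)] c(2)]] by blast
qed

text \<open>The differential of the logarithm of the coefficient of \<sigma>, kept on all tangent
  vectors so as to serve as a linear extension in \<open>fol_sharp\<close>. Off the leaf directions
  it may depend on the chart \<open>c\<close>.\<close>

definition reeb_covector :: "('a \<Rightarrow> 'e list \<Rightarrow> real) \<Rightarrow> ('a, 'e) chart \<Rightarrow> 'a \<Rightarrow> 'e \<Rightarrow> real" where
  "reeb_covector \<sigma> c x v =
     fd (form_in A c \<sigma> B2) (chart_map c x) (chart_diff A c x v) / form_in A c \<sigma> B2 (chart_map c x)"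

lemma linear_reeb_covector:
  assumes \<sigma>: "\<sigma> \<in> transversal_volumes A \<V>" and c: "c \<in> F" "x \<in> chart_dom c"
  shows "linear (reeb_covector \<sigma> c x)"
proof -
  note ac = fol_adm [OF c(1)]
  from linear_compose_scale_right [OF linear_compose [OF linear_chart_diff [OF ac c(2)]
      smooth_at_linear_fd [OF formsD(2) [OF transversal_volumesD(1) [OF \<sigma>] ac c(2), of B2]]]]
  have "linear (\<lambda>v. inverse (form_in A c \<sigma> B2 (chart_map c x)) *\<^sub>R
      (fd (form_in A c \<sigma> B2) (chart_map c x) \<circ> chart_diff A c x) v)" .
  then show ?thesis by (simp add: reeb_covector_def [abs_def] divide_inverse mult.commute)
qed

text \<open>In a foliated chart the components of \<open>[X, Y]\<close> transversal to the leaves vanish for \<open>X\<close>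
  tangent to the leaves and \<open>Y\<close> constant, so only the derivative of the coefficient of \<open>\<sigma>\<close> is left.\<close>

lemma lie_form_transversal:
  assumes \<sigma>: "\<sigma> \<in> transversal_volumes A \<V>" and X: "X \<in> tangent_fields A \<V>" and c: "c \<in> F" "x \<in> chart_dom c"
  shows "lie_form A X \<sigma> x vs = reeb_covector \<sigma> c x (X x) * \<sigma> x vs"
proof -
  note ac = fol_adm [OF c(1)]
  define t where "t = chart_map c x"
  define us where "us = map (chart_diff A c x) vs"
  note \<sigma>f = transversal_volumesD(1) [OF \<sigma>]
  have tin: "t \<in> chart_img c" unfolding t_def by (rule map_in [OF ac c(2)])
  have Xs: "smooth_vec_at x X" using X by (simp add: tangent_fields_def vector_fields_iff)
  have "\<forall>\<^sub>F s in nhds t. vec_in A c X s \<in> L"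
    unfolding t_def vec_in_def
    by (rule ev_chart [OF ac c(2)], use ev_dom [OF ac c(2)] in eventually_elim)
      (use X tangent_iff [OF c(1)] in \<open>auto simp: tangent_fields_def\<close>)
  then have "fd (vec_in A c X) t u \<in> L" for u
    using Xs smooth_vec_at_iff [OF ac c(2)] by (intro fd_in_L) (auto simp: t_def)
  then have 0: "form_in A c \<sigma> (us[i := fd (vec_in A c X) t (us ! i)]) t = 0" if "i < length us" for i
    using transversal_volumesD(3) [OF \<sigma> c(1) tin] that by (metis set_update_memI)
  have "form_in A c \<sigma> us t = \<sigma> x vs" using ac c by (simp add: t_def us_def form_in_map o_def)
  then have "form_in A c \<sigma> B2 t * fd (form_in A c \<sigma> us) t (chart_diff A c x (X x)) =
      \<sigma> x vs * fd (form_in A c \<sigma> B2) t (chart_diff A c x (X x))"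
    using fd_form_in_proportional [OF \<sigma>f ac c(2) transversal_volumesD(3) [OF \<sigma> c(1)] span_L_B2]
    by (simp add: t_def)
  then have "fd (form_in A c \<sigma> us) t (chart_diff A c x (X x)) = reeb_covector \<sigma> c x (X x) * \<sigma> x vs"
    using transversal_nonzero [OF \<sigma> c] by (simp add: reeb_covector_def t_def field_simps)
  moreover have "(\<Sum>i<length vs. form_in A c \<sigma> (us[i := fd (vec_in A c X) t (us ! i)]) t) = 0"
    using 0 by (simp add: us_def)
  ultimately show ?thesis
    using lie_form_chart [OF \<sigma>f Xs ac c(2), of vs] by (simp add: t_def us_def)
qed

text \<open>Both charts compute the same Lie derivative of \<sigma>, and \<sigma> is nonzero on some
  list.\<close>

lemma reeb_covector_indep:
  assumes \<sigma>: "\<sigma> \<in> transversal_volumes A \<V>" and c: "c \<in> F" "x \<in> chart_dom c" and c': "c' \<in> F" "x \<in> chart_dom c'"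
    and v: "v \<in> T x"
  shows "reeb_covector \<sigma> c x v = reeb_covector \<sigma> c' x v"
proof -
  obtain X where X: "X \<in> tangent_fields A \<V>" "X x = v" using extend_tangent_vector [OF v] by blast
  obtain vs where "\<sigma> x vs \<noteq> 0" using transversal_volumesD(2) [OF \<sigma>] by blast
  then show ?thesis
    using lie_form_transversal [OF \<sigma> X(1) c, of vs] lie_form_transversal [OF \<sigma> X(1) c', of vs] X(2) by simp
qed

section \<open>Foliated one-forms given by covector fields\<close>

definition one_form :: "('a \<Rightarrow> 'e \<Rightarrow> real) \<Rightarrow> 'a \<Rightarrow> 'e list \<Rightarrow> real" where
  "one_form \<alpha> x vs = (if length vs = 1 \<and> set vs \<subseteq> T x then \<alpha> x (vs ! 0) else 0)"

lemma one_form_apply: "v \<in> T x \<Longrightarrow> one_form \<alpha> x [v] = \<alpha> x v"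
  by (simp add: one_form_def)

lemma one_form_alt:
  assumes "linear (\<alpha> x)"
  shows "one_form \<alpha> x \<in> alt_forms 1 (T x)"
proof (rule alt_formsI)
  fix vs :: "'e list" and i :: nat and u v a b assume "length vs = 1" "set vs \<subseteq> T x" "i < 1" "u \<in> T x" "v \<in> T x"
  then show "one_form \<alpha> x (vs[i := a *\<^sub>R u + b *\<^sub>R v]) = a * one_form \<alpha> x (vs[i := u]) + b * one_form \<alpha> x (vs[i := v])"
    using subspace_add [OF subspace_T] subspace_scale [OF subspace_T]
    by (cases vs) (auto simp: one_form_def linear_add [OF assms] linear_cmul [OF assms])
qed (auto simp: one_form_def)

lemma one_form_unique:
  assumes "\<mu> x \<in> alt_forms 1 (T x)" "\<And>v. v \<in> T x \<Longrightarrow> \<mu> x [v] = \<alpha> x v"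
  shows "\<mu> x = one_form \<alpha> x"
proof
  fix vs show "\<mu> x vs = one_form \<alpha> x vs"
  proof (cases "length vs = 1 \<and> set vs \<subseteq> T x")
    case True
    then obtain v where "vs = [v]" by (cases vs) auto
    then show ?thesis using assms(2) True by (simp add: one_form_def)
  next
    case False
    then show ?thesis using alt_forms_outside [OF assms(1) False] by (auto simp: one_form_def simp del: One_nat_def)
  qed
qed

text \<open>\<open>fol_chart\<close> jumps with the point, so smoothness is checked in a fixed
  foliated chart \<open>c\<close>, where \<open>reeb_covector_indep\<close> replaces the chosen
  chart by \<open>c\<close>. Uniqueness comes from extending tangent vectors to fields.\<close>

lemma reeb_form_eq:
  assumes \<sigma>: "\<sigma> \<in> transversal_volumes A \<V>"
  shows "reeb_form A \<V> \<sigma> = one_form (\<lambda>x. reeb_covector \<sigma> (fol_chart x) x)" (is "_ = one_form ?\<alpha>")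
    and "reeb_form A \<V> \<sigma> \<in> fol_forms A \<V> 1"
proof -
  have alt: "one_form ?\<alpha> x \<in> alt_forms 1 (T x)" for x
    by (intro one_form_alt linear_reeb_covector \<sigma> fol_chart)
  have mem: "one_form ?\<alpha> \<in> fol_forms A \<V> 1"
  proof (rule fol_formsI [OF alt])
    fix c x and us :: "'e list" assume c: "c \<in> F" "x \<in> chart_dom c" and us: "length us = 1" "set us \<subseteq> L"
    note ac = fol_adm [OF c(1)]
    obtain u where u: "us = [u]" "u \<in> L" using us by (cases us) auto
    have "smooth_at (chart_map c x) (\<lambda>s. fd (form_in A c \<sigma> B2) s u / form_in A c \<sigma> B2 s)"
      by (intro smooth_at_divide smooth_at_fd formsD(2) [OF transversal_volumesD(1) [OF \<sigma>] ac c(2)]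
          transversal_nonzero [OF \<sigma> c])
    moreover have "\<forall>\<^sub>F s in nhds (chart_map c x). fd (form_in A c \<sigma> B2) s u / form_in A c \<sigma> B2 s = form_in A c (one_form ?\<alpha>) us s"
      unfolding form_in_def [of A c "one_form ?\<alpha>"]
    proof (rule ev_chart [OF ac c(2)], use ev_dom [OF ac c(2)] in eventually_elim)
      case (elim y)
      have "chart_frame A c y u \<in> T y" using frame_tangent_iff [OF c(1) elim] u by simp
      moreover from this have "reeb_covector \<sigma> (fol_chart y) y (chart_frame A c y u) = reeb_covector \<sigma> c y (chart_frame A c y u)"
        by (intro reeb_covector_indep \<sigma> fol_chart c(1) elim)
      ultimately show ?case using ac elim by (simp add: u one_form_apply reeb_covector_def)
    qed
    ultimately show "smooth_at (chart_map c x) (form_in A c (one_form ?\<alpha>) us)" by (rule smooth_at_cong [rotated])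
  qed
  have lie: "lie_form A X \<sigma> x vs = one_form ?\<alpha> x [X x] * \<sigma> x vs" if X: "X \<in> tangent_fields A \<V>" for X x vs
  proof -
    have "X x \<in> T x" using X by (simp add: tangent_fields_def)
    then show ?thesis using lie_form_transversal [OF \<sigma> X fol_chart] by (simp add: one_form_apply)
  qed
  have "reeb_form A \<V> \<sigma> = one_form ?\<alpha>"
    unfolding reeb_form_def
  proof (rule the_equality)
    fix \<mu> assume \<mu>: "\<mu> \<in> fol_forms A \<V> 1 \<and> (\<forall>X\<in>tangent_fields A \<V>. \<forall>x vs. lie_form A X \<sigma> x vs = \<mu> x [X x] * \<sigma> x vs)"
    show "\<mu> = one_form ?\<alpha>"
    proof
      fix x
      have "\<mu> x [v] = ?\<alpha> x v" if v: "v \<in> T x" for v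
      proof -
        obtain X where X: "X \<in> tangent_fields A \<V>" "X x = v" using extend_tangent_vector [OF v] by blast
        obtain vs where "\<sigma> x vs \<noteq> 0" using transversal_volumesD(2) [OF \<sigma>] by blast
        moreover have "\<mu> x [v] * \<sigma> x vs = ?\<alpha> x v * \<sigma> x vs"
          using \<mu> X lie_form_transversal [OF \<sigma> X(1) fol_chart, of x vs] by auto
        ultimately show ?thesis by simp
      qed
      then show "\<mu> x = one_form ?\<alpha> x" using \<mu> fol_formsD(1) by (intro one_form_unique) blast+
    qed
  qed (use mem lie in blast)
  then show "reeb_form A \<V> \<sigma> = one_form ?\<alpha>" "reeb_form A \<V> \<sigma> \<in> fol_forms A \<V> 1" using mem by auto
qed

section \<open>Exact foliated one-forms and the change of the transversal volume\<close>

lemma fol_d_0form: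
  assumes g: "g \<in> fol_forms A \<V> 0"
  shows "(\<lambda>y. g y []) \<in> smooth_functions A"
    and "fol_d A \<V> g = one_form (differential A (\<lambda>y. g y []))"
proof -
  have nil: "form_in A c g [] = (\<lambda>y. g y []) \<circ> chart_inv c" for c by (auto simp: form_in_def)
  have sm: "smooth_fun_at x (\<lambda>y. g y [])" for x
    using fol_formsD(3) [OF g fol_chart, of x "[]"] unfolding nil
    by (rule iffD2 [OF smooth_fun_at_iff [OF fol_adm [OF fol_chart(1)] fol_chart(2)]])
  then show "(\<lambda>y. g y []) \<in> smooth_functions A" by (simp add: smooth_functions_iff)
  show "fol_d A \<V> g = one_form (differential A (\<lambda>y. g y []))"
  proof (intro ext)
    fix x vs
    define c where "c = fol_chart x"
    have c: "c \<in> F" "x \<in> chart_dom c" using fol_chart by (auto simp: c_def)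
    have nz: "form_in A c g us = (\<lambda>s. 0)" if "us \<noteq> []" for us
      unfolding form_in_def using that by (intro ext alt_forms_outside [OF fol_formsD(1) [OF g]]) simp
    show "fol_d A \<V> g x vs = one_form (differential A (\<lambda>y. g y [])) x vs"
    proof (cases "set vs \<subseteq> T x")
      case True
      define us where "us = map (chart_diff A c x) vs"
      have d: "fol_d A \<V> g x vs = (\<Sum>i<length vs. (-1) ^ i * fd (form_in A c g (take i us @ drop (Suc i) us)) (chart_map c x) (us ! i))"
        using True by (simp add: fol_d_def Let_def c_def fol_chart_def us_def)
      show ?thesis
      proof (cases "length vs = 1")
        case one: True
        then obtain v where v: "vs = [v]" by (cases vs) auto
        show ?thesis
          using True d by (simp add: us_def v nil one_form_apply differential_chart [OF sm fol_adm [OF c(1)] c(2)])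
      next
        case False
        \<comment> \<open>\<open>fol_d\<close> does not test the length of its list. For lengths
          other than 1 the sum is empty, or the form of degree 0 is evaluated on a nonempty
          list.\<close>
        have "take i us @ drop (Suc i) us \<noteq> []" if "i < length vs" for i
        proof -
          have "length (take i us @ drop (Suc i) us) = length vs - 1" using that by (simp add: us_def)
          then show ?thesis using that False by (metis One_nat_def Suc_pred gr_implies_not0 length_0_conv not_gr_zero)
        qed
        then have "fol_d A \<V> g x vs = 0" unfolding d by (intro sum.neutral) (simp add: nz)
        then show ?thesis using False by (simp add: one_form_def)
      qed
    next
      case False
      then show ?thesis by (simp add: fol_d_def one_form_def)
    qed
  qed
qed

lemma fol_exact1_eq: "fol_exact1 A \<V> = (\<lambda>g. one_form (differential A g)) ` smooth_functions A"
proof (intro equalityI subsetI)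
  fix \<mu> assume "\<mu> \<in> fol_exact1 A \<V>"
  then show "\<mu> \<in> (\<lambda>g. one_form (differential A g)) ` smooth_functions A"
    using fol_d_0form by (auto simp: fol_exact1_def)
next
  fix \<mu> assume "\<mu> \<in> (\<lambda>g. one_form (differential A g)) ` smooth_functions A"
  then obtain g where g: "g \<in> smooth_functions A" "\<mu> = one_form (differential A g)" by blast
  define G where "G = (\<lambda>y (vs :: 'e list). if vs = [] then g y else 0)"
  have "G \<in> fol_forms A \<V> 0"
  proof (rule fol_formsI)
    show "G x \<in> alt_forms 0 (T x)" for x by (rule alt_formsI) (auto simp: G_def)
    fix c x and us :: "'e list" assume "c \<in> F" "x \<in> chart_dom c" "length us = 0"
    then show "smooth_at (chart_map c x) (form_in A c G us)"
      using g(1) smooth_fun_at_iff [OF fol_adm, of c x g]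
      by (simp add: form_in_def [abs_def] G_def smooth_functions_iff o_def)
  qed
  then have "fol_d A \<V> G \<in> fol_exact1 A \<V>" "fol_d A \<V> G = one_form (differential A (\<lambda>y. G y []))"
    using fol_d_0form(2) by (auto simp: fol_exact1_def)
  then show "\<mu> \<in> fol_exact1 A \<V>" by (simp add: g G_def)
qed

lemma one_form_diff: "one_form (differential A g) + one_form \<alpha> = one_form (\<lambda>x v. differential A g x v + \<alpha> x v)"
  by (auto simp: one_form_def fun_eq_iff)

lemma fol_exact1_lincomb:
  assumes "f \<in> smooth_functions A" "g \<in> smooth_functions A"
  shows "one_form (\<lambda>x v. a * differential A f x v + b * differential A g x v) \<in> fol_exact1 A \<V>"
proof -
  have sm: "smooth_fun_at x f" "smooth_fun_at x g" for x using assms by (auto simp: smooth_functions_iff)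
  have "(\<lambda>y. a * f y + b * g y) \<in> smooth_functions A"
    using differential_lincomb(1) [OF sm] by (simp add: smooth_functions_iff)
  moreover have "differential A (\<lambda>y. a * f y + b * g y) = (\<lambda>x v. a * differential A f x v + b * differential A g x v)"
    by (rule ext) (rule differential_lincomb(2) [OF sm])
  ultimately show ?thesis
    unfolding fol_exact1_eq by (intro image_eqI [where x = "\<lambda>y. a * f y + b * g y"]) simp_all
qed

lemma fol_class_eq: "fol_class A \<V> \<mu> = (\<lambda>h. h + \<mu>) ` fol_exact1 A \<V>"
  by (auto simp: fol_class_def r_coset_def add_group_def)

text \<open>Passing from \<sigma> to a multiple a \<sigma> adds X(ln |a|) to the factor by which the
  Lie derivative along a tangent field X acts.\<close>

lemma reeb_form_indep:
  assumes \<sigma>: "\<sigma> \<in> transversal_volumes A \<V>" and \<sigma>': "\<sigma>' \<in> transversal_volumes A \<V>"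
  obtains h where "h \<in> smooth_functions A"
    "reeb_form A \<V> \<sigma>' = one_form (differential A h) + reeb_form A \<V> \<sigma>"
proof -
  \<comment> \<open>A list on which neither form vanishes. The ratio does not depend on it, so
    \<open>h\<close> is smooth although \<open>fol_chart\<close> jumps with
    \<open>y\<close>.\<close>
  define w where "w = (\<lambda>y. map (chart_frame A (fol_chart y) y) B2)"
  define h where "h = (\<lambda>y. ln \<bar>\<sigma>' y (w y) / \<sigma> y (w y)\<bar>)"
  have hc: "h y = ln \<bar>form_in A c \<sigma>' B2 (chart_map c y)\<bar> - ln \<bar>form_in A c \<sigma> B2 (chart_map c y)\<bar>"
    if c: "c \<in> F" "y \<in> chart_dom c" for c y
  proof -
    note ac = fol_adm [OF c(1)]
    note tin = map_in [OF ac c(2)]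
    have nz: "form_in A c \<sigma> B2 (chart_map c y) \<noteq> 0" "form_in A c \<sigma>' B2 (chart_map c y) \<noteq> 0"
      "\<sigma> y (w y) \<noteq> 0" "\<sigma>' y (w y) \<noteq> 0"
      using transversal_nonzero [OF \<sigma> c] transversal_nonzero [OF \<sigma>' c]
        transversal_nonzero [OF \<sigma> fol_chart] transversal_nonzero [OF \<sigma>' fol_chart]
      by (simp_all add: form_in_map fol_adm fol_chart w_def)
    have ww: "form_in A c \<omega> (map (chart_diff A c y) (w y)) (chart_map c y) = \<omega> y (w y)" for \<omega>
      using ac c by (simp add: form_in_map o_def)
    from alt_forms_proportional [OF form_in_alt_img [of \<sigma>, OF formsD(1) [OF transversal_volumesD(1) [OF \<sigma>]] ac tin]
        form_in_alt_img [of \<sigma>', OF formsD(1) [OF transversal_volumesD(1) [OF \<sigma>']] ac tin]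
        subspace_UNIV span_L_B2, of "map (chart_diff A c y) (w y)"]
    have "form_in A c \<sigma> B2 (chart_map c y) * \<sigma>' y (w y) = form_in A c \<sigma>' B2 (chart_map c y) * \<sigma> y (w y)"
      unfolding ww using transversal_volumesD(3) [OF \<sigma> c(1) tin] transversal_volumesD(3) [OF \<sigma>' c(1) tin] by blast
    then have eq: "\<sigma>' y (w y) / \<sigma> y (w y) = form_in A c \<sigma>' B2 (chart_map c y) / form_in A c \<sigma> B2 (chart_map c y)"
      using nz by (simp add: field_simps)
    have "h y = ln \<bar>form_in A c \<sigma>' B2 (chart_map c y) / form_in A c \<sigma> B2 (chart_map c y)\<bar>"
      by (simp only: h_def eq)
    then show ?thesis using nz by (simp add: abs_divide ln_div)
  qed
  have evh: "\<forall>\<^sub>F s in nhds (chart_map c y). ln \<bar>form_in A c \<sigma>' B2 s\<bar> - ln \<bar>form_in A c \<sigma> B2 s\<bar> = (h \<circ> chart_inv c) s"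
    if c: "c \<in> F" "y \<in> chart_dom c" for c y
    unfolding o_def
    by (rule ev_chart [OF fol_adm [OF c(1)] c(2)], use ev_dom [OF fol_adm [OF c(1)] c(2)] in eventually_elim)
      (simp add: hc [OF c(1)])
  have sm: "smooth_at (chart_map c y) (form_in A c \<sigma> B2)" "smooth_at (chart_map c y) (form_in A c \<sigma>' B2)"
    if c: "c \<in> F" "y \<in> chart_dom c" for c y
    using formsD(2) [OF transversal_volumesD(1) [OF \<sigma>] fol_adm [OF c(1)] c(2)]
      formsD(2) [OF transversal_volumesD(1) [OF \<sigma>'] fol_adm [OF c(1)] c(2)] by auto
  have h: "smooth_fun_at y h" for y
  proof -
    note c = fol_chart [of y]
    have "smooth_at (chart_map (fol_chart y) y) (\<lambda>s. ln \<bar>form_in A (fol_chart y) \<sigma>' B2 s\<bar> - ln \<bar>form_in A (fol_chart y) \<sigma> B2 s\<bar>)"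
      by (intro smooth_at_diff smooth_at_ln_abs sm c transversal_nonzero [OF \<sigma> c] transversal_nonzero [OF \<sigma>' c])
    from smooth_at_cong [OF evh [OF c] this] show ?thesis
      unfolding smooth_fun_at_iff [OF fol_adm [OF c(1)] c(2)] o_def .
  qed
  have dh: "differential A h x v = reeb_covector \<sigma>' (fol_chart x) x v - reeb_covector \<sigma> (fol_chart x) x v" for x v
  proof -
    define c where "c = fol_chart x"
    have c: "c \<in> F" "x \<in> chart_dom c" using fol_chart by (auto simp: c_def)
    define t where "t = chart_map c x"
    have "((\<lambda>s. ln \<bar>form_in A c \<sigma>' B2 s\<bar> - ln \<bar>form_in A c \<sigma> B2 s\<bar>) has_derivative
        (\<lambda>v. fd (form_in A c \<sigma>' B2) t v / form_in A c \<sigma>' B2 t - fd (form_in A c \<sigma> B2) t v / form_in A c \<sigma> B2 t)) (at t)"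
      unfolding t_def
      by (intro has_derivative_diff has_derivative_ln_abs smooth_at_has_derivative sm c
          transversal_nonzero [OF \<sigma> c] transversal_nonzero [OF \<sigma>' c])
    from fd_eqI [OF has_derivative_cong_nhds [OF evh [OF c, folded t_def] this]]
    have "fd (h \<circ> chart_inv c) t = (\<lambda>v. fd (form_in A c \<sigma>' B2) t v / form_in A c \<sigma>' B2 t - fd (form_in A c \<sigma> B2) t v / form_in A c \<sigma> B2 t)"
      by (simp add: o_def)
    then show ?thesis
      using differential_chart [OF h fol_adm [OF c(1)] c(2)] by (simp add: reeb_covector_def t_def c_def)
  qed
  have "reeb_form A \<V> \<sigma>' = one_form (differential A h) + reeb_form A \<V> \<sigma>"
    unfolding reeb_form_eq(1) [OF \<sigma>] reeb_form_eq(1) [OF \<sigma>'] one_form_diff dh by simp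
  moreover have "h \<in> smooth_functions A" using h by (simp add: smooth_functions_iff)
  ultimately show ?thesis using that by blast
qed

text \<open>The class is spelled out by its representatives because \<open>sharp_map\<close> ranges
  over all of them.\<close>

lemma reeb_class_eq:
  assumes \<sigma>: "\<sigma> \<in> transversal_volumes A \<V>"
  shows "reeb_class A \<V> = (\<lambda>g. one_form (differential A g) + reeb_form A \<V> \<sigma>) ` smooth_functions A"
proof -
  have sub: "fol_class A \<V> (reeb_form A \<V> \<sigma>1) \<subseteq> fol_class A \<V> (reeb_form A \<V> \<sigma>2)"
    if \<sigma>12: "\<sigma>1 \<in> transversal_volumes A \<V>" "\<sigma>2 \<in> transversal_volumes A \<V>" for \<sigma>1 \<sigma>2
  proof
    fix \<mu> assume "\<mu> \<in> fol_class A \<V> (reeb_form A \<V> \<sigma>1)"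
    then obtain g where g: "g \<in> smooth_functions A" "\<mu> = one_form (differential A g) + reeb_form A \<V> \<sigma>1"
      by (auto simp: fol_class_eq fol_exact1_eq)
    obtain h where h: "h \<in> smooth_functions A" "reeb_form A \<V> \<sigma>1 = one_form (differential A h) + reeb_form A \<V> \<sigma>2"
      using reeb_form_indep [OF \<sigma>12(2,1)] by blast
    have "\<mu> = one_form (\<lambda>x v. 1 * differential A g x v + 1 * differential A h x v) + reeb_form A \<V> \<sigma>2"
      using g h by (simp add: one_form_diff [symmetric] add.assoc)
    then show "\<mu> \<in> fol_class A \<V> (reeb_form A \<V> \<sigma>2)"
      using fol_exact1_lincomb [OF g(1) h(1), of 1 1] unfolding fol_class_eq by blast
  qed
  have "(\<lambda>\<sigma>. fol_class A \<V> (reeb_form A \<V> \<sigma>)) ` transversal_volumes A \<V> =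
      (\<lambda>_. fol_class A \<V> (reeb_form A \<V> \<sigma>)) ` transversal_volumes A \<V>"
    by (rule image_cong [OF refl]) (use sub \<sigma> in blast)
  then have "reeb_class A \<V> = fol_class A \<V> (reeb_form A \<V> \<sigma>)"
    unfolding reeb_class_def by (simp only: image_constant [OF \<sigma>] the_elem_eq)
  then show ?thesis by (auto simp: fol_class_eq fol_exact1_eq)
qed

end

subsection \<open>Splitting of top-degree forms along a subspace\<close>

lemma alt_forms_expand_slot:
  assumes \<omega>: "\<omega> \<in> alt_forms k S" and S: "subspace S"
    and onb: "onb (B1 @ B2)" and B1: "span (set B1) = S" and X: "X \<in> S"
  shows "\<omega> (pre @ X # post) = (\<Sum>i\<in>set B1. (X \<bullet> i) * \<omega> (pre @ i # post))"
proof (cases "length (pre @ X # post) = k \<and> set (pre @ post) \<subseteq> S")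
  case True
  have B1S: "set B1 \<subseteq> S" using B1 span_superset by blast
  have lin: "\<omega> (pre @ (a *\<^sub>R u + b *\<^sub>R v) # post) = a * \<omega> (pre @ u # post) + b * \<omega> (pre @ v # post)"
    if "u \<in> S" "v \<in> S" for a b u v
    using alt_forms_linear [OF \<omega>, of "pre @ X # post" "length pre" u v a b] True X that
    by (simp add: list_update_append)
  have "\<omega> (pre @ (\<Sum>i\<in>I. c i *\<^sub>R i) # post) = (\<Sum>i\<in>I. c i * \<omega> (pre @ i # post))"
    if "finite I" "I \<subseteq> S" for I c
    using that
  proof (induction I rule: finite_induct)
    case empty
    then show ?case using lin [OF X X, of 0 0] by simp
  next
    case (insert i I)
    have "(\<Sum>i\<in>I. c i *\<^sub>R i) \<in> S" 
      by (intro subspace_sum [OF S] subspace_scale [OF S]) (use insert.prems in auto)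
    then show ?case using lin [of i "\<Sum>i\<in>I. c i *\<^sub>R i" "c i" 1] insert by simp
  qed
  from this [of "set B1" "\<lambda>i. X \<bullet> i"] B1S show ?thesis
    using adapted_representation [OF onb B1 X] by simp
next
  case False
  have "\<omega> (pre @ Y # post) = 0" for Y
    using False by (intro alt_forms_outside [OF \<omega>]) auto
  then show ?thesis by simp
qed

lemma alt_forms_swap_head:
  assumes \<omega>: "\<omega> \<in> alt_forms k S" and S: "subspace S"
  shows "\<omega> (a # b # us) = - \<omega> (b # a # us)"
proof (cases "length (a # b # us) = k \<and> set (a # b # us) \<subseteq> S")
  case True
  then show ?thesis using alt_forms_swap [OF \<omega> S, of "b # a # us" 0 1] by simp
next
  case False
  have "\<omega> (a # b # us) = 0" "\<omega> (b # a # us) = 0"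
    using False by (intro alt_forms_outside [OF \<omega>]; auto)+
  then show ?thesis by simp
qed

lemma alt_forms_prefix:
  assumes W: "W \<in> alt_forms (length pre + q) UNIV"
  shows "(\<lambda>vs. W (pre @ vs)) \<in> alt_forms q UNIV"
proof (rule alt_formsI)
  fix vs :: "'a list" and i :: nat and u v a b assume vs: "length vs = q" and i: "i < q"
  then show "W (pre @ vs[i := a *\<^sub>R u + b *\<^sub>R v]) = a * W (pre @ vs[i := u]) + b * W (pre @ vs[i := v])"
    using alt_forms_linear [OF W, of "pre @ vs" "length pre + i" u v a b] by (simp add: list_update_append)
next
  fix vs :: "'a list" and i j :: nat assume "length vs = q" "i < j" "j < q" "vs ! i = vs ! j"
  then show "W (pre @ vs) = 0"
    by (intro alt_forms_repeat [OF W, of "length pre + i" _ "length pre + j"]) (auto simp: nth_append)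
qed (auto intro: alt_forms_outside [OF W])

lemma alt_forms_suffix:
  assumes W: "W \<in> alt_forms (p + length post) UNIV" and S: "subspace S"
  shows "(\<lambda>vs. if set vs \<subseteq> S then W (vs @ post) else 0) \<in> alt_forms p S"
proof (rule alt_formsI)
  fix vs i u v a b assume vs: "length vs = p" "set vs \<subseteq> S" and i: "i < p" and uv: "u \<in> S" "v \<in> S"
  have "set (vs[i := x]) \<subseteq> S" if "x \<in> S" for x
    using vs(2) that set_update_subset_insert by fastforce
  moreover have "a *\<^sub>R u + b *\<^sub>R v \<in> S" using uv S by (simp add: subspace_add subspace_scale)
  ultimately show "(if set (vs[i := a *\<^sub>R u + b *\<^sub>R v]) \<subseteq> S then W (vs[i := a *\<^sub>R u + b *\<^sub>R v] @ post) else 0) =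
      a * (if set (vs[i := u]) \<subseteq> S then W (vs[i := u] @ post) else 0) +
      b * (if set (vs[i := v]) \<subseteq> S then W (vs[i := v] @ post) else 0)"
    using alt_forms_linear [OF W, of "vs @ post" i u v a b] vs i uv by (simp add: list_update_append1)
next
  fix vs i j assume vs: "length vs = p" "set vs \<subseteq> S" "i < j" "j < p" "vs ! i = vs ! j"
  have "W (vs @ post) = 0"
    by (rule alt_forms_repeat [OF W, of i _ j]) (use vs in \<open>auto simp: nth_append\<close>)
  then show "(if set vs \<subseteq> S then W (vs @ post) else 0) = 0" by simp
next
  fix vs assume "\<not> (length vs = p \<and> set vs \<subseteq> S)"
  then show "(if set vs \<subseteq> S then W (vs @ post) else 0) = 0"
    by (auto intro: alt_forms_outside [OF W])
qed

text \<open>With \<open>B1\<close> in front, \<open>W\<close> becomes a form that vanishes on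
  \<open>S\<close>, hence a multiple of \<sigma>; with its last arguments fixed it becomes a
  top-degree form on \<open>S\<close>, hence a multiple of \<tau>. For a block triangular change of
  frame this is the splitting of the determinant.\<close>

lemma top_form_split:
  assumes B1: "span (set B1) = S" and S: "subspace S" and B2: "span (S \<union> set B2) = UNIV"
    and \<tau>: "\<tau> \<in> alt_forms (length B1) S" and \<sigma>: "\<sigma> \<in> alt_forms (length B2) UNIV"
    and kill: "\<And>us u. u \<in> S \<Longrightarrow> u \<in> set us \<Longrightarrow> \<sigma> us = 0"
    and W: "W \<in> alt_forms (length B1 + length B2) UNIV"
    and vs: "set vs1 \<subseteq> S" "length vs2 = length B2"
  shows "\<tau> B1 * \<sigma> B2 * W (vs1 @ vs2) = W (B1 @ B2) * \<tau> vs1 * \<sigma> vs2"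
proof -
  have B1S: "set B1 \<subseteq> S" using B1 span_superset by blast
  have "W (B1 @ us) = 0" if u: "u \<in> S" "u \<in> set us" for u us
  proof (cases "length us = length B2")
    case True
    obtain i where i: "i < length us" "us ! i = u" using u by (auto simp: in_set_conv_nth)
    \<comment> \<open>Vectors whose insertion gives zero form a subspace; it contains
      \<open>B1\<close>, whose members would occur twice in the list.\<close>
    define U where "U = {v. W (B1 @ us[i := v]) = 0}"
    have l: "linear (\<lambda>v. W (B1 @ us[i := v]))"
      using alt_forms_slot_linear [OF alt_forms_prefix [OF W], of i us] i True by simp
    have "subspace U"
      by (auto simp: U_def subspace_def linear_0 [OF l] linear_add [OF l] linear_cmul [OF l])
    moreover have "set B1 \<subseteq> U"
    proof
      fix b assume "b \<in> set B1"
      then obtain j where "j < length B1" "B1 ! j = b" by (auto simp: in_set_conv_nth)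
      then have "W (B1 @ us[i := b]) = 0"
        using i True by (intro alt_forms_repeat [OF W, of j _ "length B1 + i"]) (auto simp: nth_append)
      then show "b \<in> U" by (simp add: U_def)
    qed
    ultimately have "S \<subseteq> U" using B1 span_minimal by blast
    then show ?thesis using u i by (auto simp: U_def)
  next
    case False
    then show ?thesis by (intro alt_forms_outside [OF W]) simp
  qed
  then have 1: "W (B1 @ B2) * \<sigma> vs2 = \<sigma> B2 * W (B1 @ vs2)"
    using alt_forms_proportional [OF alt_forms_prefix [OF W] \<sigma> subspace_UNIV B2, of vs2] kill by blast
  have W': "W \<in> alt_forms (length B1 + length vs2) UNIV" using W vs by simp
  have 2: "\<tau> B1 * W (vs1 @ vs2) = W (B1 @ vs2) * \<tau> vs1"
    using alt_forms_proportional [OF \<tau> alt_forms_suffix [OF W' S] S, of "{}" vs1] B1 B1S vs by simp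
  have "\<tau> B1 * \<sigma> B2 * W (vs1 @ vs2) = \<sigma> B2 * (\<tau> B1 * W (vs1 @ vs2))" by simp
  also have "\<dots> = (\<sigma> B2 * W (B1 @ vs2)) * \<tau> vs1" unfolding 2 by simp
  also have "\<dots> = W (B1 @ B2) * \<tau> vs1 * \<sigma> vs2" unfolding 1 [symmetric] by simp
  finally show ?thesis .
qed

lemma wedge_covectors_onb:
  assumes "onb B"
  shows "wedge_covectors (map co B) B = 1"
proof -
  have dB: "distinct B" using assms by (simp add: onb_def)
  have BB: "B ! i \<bullet> B ! j = (if i = j then 1 else 0)" if "i < length B" "j < length B" for i j
    using assms that dB by (auto simp: onb_def nth_eq_iff_index_eq)
  have "(\<Prod>i<length B. (map co B ! i) (B ! \<sigma> i)) = (if \<sigma> = id then 1 else 0)" if \<sigma>: "\<sigma> permutes {..<length B}" for \<sigma>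
  proof (cases "\<sigma> = id")
    case True
    then show ?thesis by (simp add: BB)
  next
    case False
    then obtain i where i: "\<sigma> i \<noteq> i" by (auto simp: fun_eq_iff)
    then have il: "i < length B" using \<sigma> permutes_not_in by fastforce
    moreover have "\<sigma> i < length B" using \<sigma> il permutes_in_image by fastforce
    ultimately show ?thesis using False i BB by (auto intro!: prod_zero bexI [of _ i])
  qed
  then have "wedge_covectors (map co B) B = (\<Sum>\<sigma> | \<sigma> permutes {..<length B}. of_int (sign \<sigma>) * (if \<sigma> = id then 1 else 0))"
    unfolding wedge_covectors_def by (auto intro!: sum.cong)
  also have "\<dots> = (\<Sum>\<sigma>\<in>{id :: nat \<Rightarrow> nat}. of_int (sign \<sigma>) * (if \<sigma> = id then 1 else 0))"
    by (rule sum.mono_neutral_right) (auto intro: permutes_id finite_permutations)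
  finally show ?thesis by simp
qed

subsection \<open>The sharp map on the Reeb class\<close>

locale poisson_fol = poisson_manifold A P + foliated_manifold A \<V> B1 B2
  for A :: "('a::t2_space, 'e::euclidean_space) chart set"
    and P :: "'a \<Rightarrow> ('e \<Rightarrow> real) \<Rightarrow> ('e \<Rightarrow> real) \<Rightarrow> real"
    and \<V> :: "('a, 'e) foliation" and B1 B2 :: "'e list" +
  assumes leafwise: "P x \<in> bivectors (tangent_dist A \<V> x)"
begin

text \<open>Two linear extensions of \<mu> agree on the leaf directions, and a leafwise bivector
  cannot tell them apart; so any extension computes the description in
  \<open>fol_sharp\<close>.\<close>

lemma fol_sharp_eq:
  assumes \<alpha>: "linear \<alpha>" and eq: "\<And>v. v \<in> T x \<Longrightarrow> \<alpha> v = \<mu> x [v]"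
  shows "fol_sharp A \<V> P \<mu> x = sharp (P x) \<alpha>"
  unfolding fol_sharp_def
proof (rule the_equality)
  show "\<forall>\<beta>. linear \<beta> \<and> (\<forall>v\<in>T x. \<beta> v = \<mu> x [v]) \<longrightarrow> sharp (P x) \<alpha> = sharp (P x) \<beta>"
  proof (intro allI impI)
    fix \<beta> assume "linear \<beta> \<and> (\<forall>v\<in>T x. \<beta> v = \<mu> x [v])"
    then show "sharp (P x) \<alpha> = sharp (P x) \<beta>" using eq by (intro sharp_cong [OF leafwise \<alpha>]) auto
  qed
qed (use assms in blast)

lemma fol_sharp_reeb:
  assumes \<sigma>: "\<sigma> \<in> transversal_volumes A \<V>" and c: "c \<in> F" "x \<in> chart_dom c"
  shows "fol_sharp A \<V> P (reeb_form A \<V> \<sigma>) x = sharp (P x) (reeb_covector \<sigma> c x)"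
  by (rule fol_sharp_eq [OF linear_reeb_covector [OF \<sigma> c]])
    (simp add: reeb_form_eq(1) [OF \<sigma>] one_form_apply reeb_covector_indep [OF \<sigma> c fol_chart])

text \<open>The Reeb form is closed because it is locally the differential of the logarithm of the
  coefficient of \<open>\<sigma>\<close>; hence its image under the sharp map is locally Hamiltonian.\<close>

lemma fol_sharp_reeb_Poiss:
  assumes \<sigma>: "\<sigma> \<in> transversal_volumes A \<V>"
  shows "fol_sharp A \<V> P (reeb_form A \<V> \<sigma>) \<in> Poiss A P"
proof (rule Poiss_locally_ham)
  fix x
  define c where "c = fol_chart x"
  have c: "c \<in> F" "x \<in> chart_dom c" using fol_chart by (auto simp: c_def)
  note ac = fol_adm [OF c(1)]
  define s where "s = form_in A c \<sigma> B2"
  define g where "g = (\<lambda>y. ln \<bar>s (chart_map c y)\<bar>)"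
  have s: "smooth_at (chart_map c y) s" "s (chart_map c y) \<noteq> 0" if "y \<in> chart_dom c" for y
    using formsD(2) [OF transversal_volumesD(1) [OF \<sigma>] ac that] transversal_nonzero [OF \<sigma> c(1) that]
    by (auto simp: s_def)
  have ev: "\<forall>\<^sub>F r in nhds (chart_map c y). ln \<bar>s r\<bar> = (g \<circ> chart_inv c) r" if "y \<in> chart_dom c" for y
    unfolding o_def by (rule ev_chart [OF ac that]) (simp add: g_def)
  have g: "smooth_fun_at y g" if y: "y \<in> chart_dom c" for y
    unfolding smooth_fun_at_iff [OF ac y] by (rule smooth_at_cong [OF ev [OF y] smooth_at_ln_abs [OF s [OF y]]])
  have dg: "differential A g y = reeb_covector \<sigma> c y" if y: "y \<in> chart_dom c" for y
  proof
    fix v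
    have "fd (g \<circ> chart_inv c) (chart_map c y) = (\<lambda>v. fd s (chart_map c y) v / s (chart_map c y))"
      by (rule fd_eqI [OF has_derivative_cong_nhds [OF ev [OF y]
              has_derivative_ln_abs [OF smooth_at_has_derivative [OF s(1) [OF y]] s(2) [OF y]]]])
    then show "differential A g y v = reeb_covector \<sigma> c y v"
      using differential_chart [OF g [OF y] ac y] by (simp add: reeb_covector_def s_def)
  qed
  \<comment> \<open>\<open>g\<close> is controlled on the chart only, whereas
    \<open>Poiss_locally_ham\<close> asks for global functions.\<close>
  obtain f where f: "f \<in> smooth_functions A" "\<forall>\<^sub>F y in nhds x. f y = g y"
    using extend_germ [OF g [OF c(2)]] by blast
  have "\<forall>\<^sub>F y in nhds x. ham_field A P f y = fol_sharp A \<V> P (reeb_form A \<V> \<sigma>) y"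
    using ham_cong [OF f(2)] ev_dom [OF ac c(2)]
    by eventually_elim (simp add: fol_sharp_reeb [OF \<sigma> c(1)] ham_field_def dg)
  then show "\<exists>f\<in>smooth_functions A. \<forall>\<^sub>F y in nhds x. ham_field A P f y = fol_sharp A \<V> P (reeb_form A \<V> \<sigma>) y"
    using f(1) by blast
qed

text \<open>Exact foliated forms are mapped to Hamiltonian fields, so every representative of the
  Reeb class yields the same coset.\<close>

lemma sharp_map_reeb_class:
  assumes \<sigma>: "\<sigma> \<in> transversal_volumes A \<V>"
  shows "sharp_map A \<V> P (reeb_class A \<V>) = poisson_class A P (fol_sharp A \<V> P (reeb_form A \<V> \<sigma>))"
proof -
  define \<Lambda> where "\<Lambda> = reeb_form A \<V> \<sigma>"
  have cls: "poisson_class A P (fol_sharp A \<V> P (one_form (differential A g) + \<Lambda>)) = poisson_class A P (fol_sharp A \<V> P \<Lambda>)"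
    if g: "g \<in> smooth_functions A" for g
  proof (rule poisson_class_cong)
    have "fol_sharp A \<V> P (one_form (differential A g) + \<Lambda>) x = ham_field A P g x + fol_sharp A \<V> P \<Lambda> x" for x
    proof -
      have ld: "linear (differential A g x)" using g by (intro linear_differential) (simp add: smooth_functions_iff)
      note lr = linear_reeb_covector [OF \<sigma> fol_chart, of x]
      have "linear (\<lambda>v. 1 * differential A g x v + 1 * reeb_covector \<sigma> (fol_chart x) x v)"
        using linear_compose_add [OF ld lr] by simp
      then have "fol_sharp A \<V> P (one_form (differential A g) + \<Lambda>) x =
          sharp (P x) (\<lambda>v. 1 * differential A g x v + 1 * reeb_covector \<sigma> (fol_chart x) x v)"
        by (rule fol_sharp_eq) (simp add: \<Lambda>_def reeb_form_eq(1) [OF \<sigma>] one_form_apply)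
      also have "\<dots> = 1 *\<^sub>R sharp (P x) (differential A g x) + 1 *\<^sub>R sharp (P x) (reeb_covector \<sigma> (fol_chart x) x)"
        by (rule sharp_lincomb [OF bivector ld lr])
      finally show ?thesis by (simp add: ham_field_def \<Lambda>_def fol_sharp_reeb [OF \<sigma> fol_chart])
    qed
    then have "fol_sharp A \<V> P (one_form (differential A g) + \<Lambda>) - fol_sharp A \<V> P \<Lambda> = ham_field A P g"
      by (intro ext) simp
    then show "fol_sharp A \<V> P (one_form (differential A g) + \<Lambda>) - fol_sharp A \<V> P \<Lambda> \<in> Ham A P"
      using g by (simp add: Ham_def)
  qed
  have ex: "(\<lambda>_. 0) \<in> smooth_functions A" by (simp add: smooth_functions_iff smooth_fun_at_const)
  have "(\<lambda>\<mu>. poisson_class A P (fol_sharp A \<V> P \<mu>)) ` reeb_class A \<V> =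
      (\<lambda>g. poisson_class A P (fol_sharp A \<V> P (one_form (differential A g) + \<Lambda>))) ` smooth_functions A"
    by (simp add: reeb_class_eq [OF \<sigma>] image_image \<Lambda>_def)
  also have "\<dots> = (\<lambda>_. poisson_class A P (fol_sharp A \<V> P \<Lambda>)) ` smooth_functions A"
    by (rule image_cong [OF refl cls])
  also have "\<dots> = {poisson_class A P (fol_sharp A \<V> P \<Lambda>)}" by (rule image_constant [OF ex])
  finally show ?thesis by (simp add: sharp_map_def \<Lambda>_def)
qed

subsection \<open>The volume form \<open>\<tau> \<and> \<sigma>\<close>\<close>

text \<open>The determinant with respect to the adapted basis.\<close>

definition std_form :: "'e list \<Rightarrow> real" where
  "std_form = wedge_covectors (map co (B1 @ B2))"

lemma std_form: "std_form \<in> alt_forms (length B1 + length B2) UNIV" "std_form (B1 @ B2) = 1"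
  using alt_forms_wedge_covectors [of "map co (B1 @ B2)"] wedge_covectors_onb [OF adapted(1)] linear_co
  by (auto simp: std_form_def)

text \<open>Since \<open>\<tau>\<close> is only defined on vectors tangent to the leaves, \<open>\<tau> \<and> \<sigma>\<close> is described by its coefficient in
  a foliated chart; by \<open>product_volume_chart\<close> any foliated chart gives the same form.\<close>

definition product_volume :: "('a \<Rightarrow> 'e list \<Rightarrow> real) \<Rightarrow> ('a \<Rightarrow> 'e list \<Rightarrow> real) \<Rightarrow> 'a \<Rightarrow> 'e list \<Rightarrow> real" where
  "product_volume \<tau> \<sigma> x vs =
     form_in A (fol_chart x) \<tau> B1 (chart_map (fol_chart x) x) *
     form_in A (fol_chart x) \<sigma> B2 (chart_map (fol_chart x) x) *
     std_form (map (chart_diff A (fol_chart x) x) vs)"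

lemma leaf_volume_formsD:
  assumes "\<tau> \<in> leaf_volume_forms A \<V>"
  shows "\<tau> \<in> fol_forms A \<V> (length B1)" "\<exists>vs. \<tau> x vs \<noteq> 0"
  using assms lengths by (auto simp: leaf_volume_forms_def nowhere_vanishing_def)

lemma leaf_nonzero:
  assumes \<tau>: "\<tau> \<in> leaf_volume_forms A \<V>" and c: "c \<in> F" "x \<in> chart_dom c"
  shows "form_in A c \<tau> B1 (chart_map c x) \<noteq> 0"
proof
  assume 0: "form_in A c \<tau> B1 (chart_map c x) = 0"
  note ac = fol_adm [OF c(1)]
  obtain vs where vs: "\<tau> x vs \<noteq> 0" using leaf_volume_formsD(2) [OF \<tau>] by blast
  have "form_in A c \<tau> (map (chart_diff A c x) vs) (chart_map c x) = 0"
    by (rule alt_forms_eq_0 [OF fol_formsD(2) [OF leaf_volume_formsD(1) [OF \<tau>] c(1) map_in [OF ac c(2)]] subspace_L, of "{}"])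
      (use adapted(2) 0 in auto)
  then show False using vs ac c by (simp add: form_in_map o_def)
qed

text \<open>The change of frame \<open>J\<close> preserves \<open>L\<close>, so by
  \<open>top_form_split\<close> its determinant is the product of a leafwise and a transversal one.
  These are the factors by which the coefficients of \<tau> and \<sigma> change.\<close>

lemma product_volume_chart:
  assumes \<tau>: "\<tau> \<in> leaf_volume_forms A \<V>" and \<sigma>: "\<sigma> \<in> transversal_volumes A \<V>" and c: "c \<in> F" "y \<in> chart_dom c"
  shows "form_in A c (product_volume \<tau> \<sigma>) us (chart_map c y) =
    form_in A c \<tau> B1 (chart_map c y) * form_in A c \<sigma> B2 (chart_map c y) * std_form us"
proof -
  define c0 where "c0 = fol_chart y"
  define t where "t = chart_map c0 y"
  have c0: "c0 \<in> F" "y \<in> chart_dom c0" using fol_chart by (auto simp: c0_def)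
  note ac = fol_adm [OF c(1)] and ac0 = fol_adm [OF c0(1)]
  have tin: "t \<in> chart_img c0" unfolding t_def by (rule map_in [OF ac0 c0(2)])
  define J where "J = chart_diff A c0 y \<circ> chart_frame A c y"
  have J: "linear J" unfolding J_def by (intro linear_compose linear_chart_frame linear_chart_diff ac ac0 c c0)
  have JL: "J u \<in> L" if "u \<in> L" for u
    using that tangent_iff [OF c0] frame_tangent_iff [OF c] by (simp add: J_def)
  have Jform: "form_in A c0 \<omega> (map J vs) t = form_in A c \<omega> vs (chart_map c y)" for \<omega> vs
    using ac ac0 c c0 by (simp add: t_def form_in_map J_def o_def)
  have W: "std_form \<in> alt_forms (length (B1 @ B2)) UNIV" using std_form(1) by simp
  have "std_form (map J us) = std_form (map J (B1 @ B2)) * std_form us"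
    using alt_forms_proportional [OF W alt_forms_pullback [OF W J] subspace_UNIV, of "{}" us] std_form(2) adapted(1)
    by (simp add: onb_def)
  moreover have "form_in A c0 \<tau> B1 t * form_in A c0 \<sigma> B2 t * std_form (map J B1 @ map J B2) =
      std_form (B1 @ B2) * form_in A c0 \<tau> (map J B1) t * form_in A c0 \<sigma> (map J B2) t"
  proof (rule top_form_split [OF adapted(2) subspace_L span_L_B2])
    show "(\<lambda>us. form_in A c0 \<tau> us t) \<in> alt_forms (length B1) L"
      by (rule fol_formsD(2) [OF leaf_volume_formsD(1) [OF \<tau>] c0(1) tin])
    show "(\<lambda>us. form_in A c0 \<sigma> us t) \<in> alt_forms (length B2) UNIV"
      by (rule form_in_alt_img [of \<sigma>, OF formsD(1) [OF transversal_volumesD(1) [OF \<sigma>]] ac0 tin])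
    show "form_in A c0 \<sigma> us t = 0" if "u \<in> L" "u \<in> set us" for u us
      by (rule transversal_volumesD(3) [OF \<sigma> c0(1) tin that])
    show "set (map J B1) \<subseteq> L" using JL adapted(2) span_superset [of "set B1"] by auto
  qed (use std_form in auto)
  moreover have "form_in A c (product_volume \<tau> \<sigma>) us (chart_map c y) =
      form_in A c0 \<tau> B1 t * form_in A c0 \<sigma> B2 t * std_form (map J us)"
    using ac c by (simp add: form_in_map product_volume_def c0_def t_def J_def)
  ultimately show ?thesis by (simp add: Jform std_form(2) mult.assoc [symmetric])
qed

lemma product_volume:
  assumes \<tau>: "\<tau> \<in> leaf_volume_forms A \<V>" and \<sigma>: "\<sigma> \<in> transversal_volumes A \<V>"
  shows "product_volume \<tau> \<sigma> \<in> volume_forms A"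
proof -
  have dim: "length B1 + length B2 = DIM('e)" using onb_length(1) [OF adapted(1)] by simp
  have "product_volume \<tau> \<sigma> \<in> forms A DIM('e)"
  proof (rule formsI)
    fix y
    note ac = fol_adm [OF fol_chart(1), of y]
    have "(\<lambda>vs. std_form (map (chart_diff A (fol_chart y) y) vs)) \<in> alt_forms DIM('e) UNIV"
      using alt_forms_pullback [OF std_form(1) linear_chart_diff [OF ac fol_chart(2)], of UNIV] dim by simp
    then show "product_volume \<tau> \<sigma> y \<in> alt_forms DIM('e) UNIV"
      unfolding product_volume_def [abs_def] by (rule alt_forms_scale)
  next
    fix x
    define c where "c = fol_chart x"
    have c: "c \<in> F" "x \<in> chart_dom c" using fol_chart by (auto simp: c_def)
    note ac = fol_adm [OF c(1)]
    have "smooth_at (chart_map c x) (form_in A c (product_volume \<tau> \<sigma>) us)" for us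
    proof -
      have "\<forall>\<^sub>F s in nhds (chart_map c x). form_in A c \<tau> B1 s * form_in A c \<sigma> B2 s * std_form us =
          form_in A c (product_volume \<tau> \<sigma>) us s"
        using ev_img [OF ac c(2)]
        by eventually_elim (metis product_volume_chart [OF \<tau> \<sigma> c(1)] inv_in [OF ac] map_inv [OF ac])
      moreover have "smooth_at (chart_map c x) (\<lambda>s. form_in A c \<tau> B1 s * form_in A c \<sigma> B2 s * std_form us)"
        by (intro smooth_at_mult smooth_at_const fol_formsD(3) [OF leaf_volume_formsD(1) [OF \<tau>] c]
            formsD(2) [OF transversal_volumesD(1) [OF \<sigma>] ac c(2)])
      ultimately show ?thesis by (rule smooth_at_cong)
    qed
    then show "\<exists>c. adm c \<and> x \<in> chart_dom c \<and> (\<forall>us. length us = DIM('e) \<longrightarrow>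
        smooth_at (chart_map c x) (form_in A c (product_volume \<tau> \<sigma>) us))"
      using ac c by blast
  qed
  moreover have "\<exists>vs. product_volume \<tau> \<sigma> x vs \<noteq> 0" for x
  proof -
    have "form_in A (fol_chart x) (product_volume \<tau> \<sigma>) (B1 @ B2) (chart_map (fol_chart x) x) \<noteq> 0"
      using product_volume_chart [OF \<tau> \<sigma> fol_chart, of x "B1 @ B2"] std_form(2)
        leaf_nonzero [OF \<tau> fol_chart, of x] transversal_nonzero [OF \<sigma> fol_chart, of x] by simp
    then show ?thesis unfolding form_in_map [OF fol_adm [OF fol_chart(1)] fol_chart(2)] by blast
  qed
  ultimately show ?thesis by (simp add: volume_forms_def nowhere_vanishing_def)
qed

subsection \<open>The foliated modular vector field\<close>

abbreviation (input) Q :: "('a, 'e) chart \<Rightarrow> 'e \<Rightarrow> 'e \<Rightarrow> 'e \<Rightarrow> real" where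
  "Q c i j \<equiv> bivec_in A c P (co i) (co j)"

text \<open>The covector belonging to a vector of \<open>B2\<close> vanishes on the leaves, and
  \<open>P\<close> is leafwise. Sums over the whole basis thereby reduce to sums over
  \<open>B1\<close>.\<close>

lemma Q_transversal:
  assumes c: "c \<in> F" "s \<in> chart_img c" and ij: "i \<in> set B2 \<or> j \<in> set B2"
  shows "Q c i j s = 0"
proof -
  note ac = fol_adm [OF c(1)]
  have left: "Q c b b' s = 0" if "b \<in> set B2" for b b'
  proof -
    define y where "y = chart_inv c s"
    have y: "y \<in> chart_dom c" unfolding y_def by (rule inv_in [OF ac c(2)])
    note lD = linear_chart_diff [OF ac y]
    have "(co b \<circ> chart_diff A c y) v = 0" if "v \<in> T y" for v
      using that tangent_iff [OF c(1) y] mem_L_iff \<open>b \<in> set B2\<close> by auto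
    then have "P y (co b \<circ> chart_diff A c y) (co b' \<circ> chart_diff A c y) = P y (\<lambda>v. 0) (co b' \<circ> chart_diff A c y)"
      by (intro bivector_cong [OF leafwise] linear_compose [OF lD] linear_co) (auto simp: linear_iff)
    also have "\<dots> = 0"
      using bivector_lincomb [OF bivector [of y] linear_compose [OF lD linear_co] linear_compose [OF lD linear_co]
          linear_compose [OF lD linear_co], of 0 b 0 b b'] by simp
    finally show ?thesis by (simp add: bivec_in_def y_def)
  qed
  from ij show ?thesis
  proof
    assume "j \<in> set B2"
    then show ?thesis using left [of j i] bivec_in_antisym [OF ac c(2), of i j] by simp
  qed (rule left)
qed

lemma fd_Q_transversal:
  assumes c: "c \<in> F" "x \<in> chart_dom c" and ij: "i \<in> set B2 \<or> j \<in> set B2"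
  shows "fd (Q c i j) (chart_map c x) v = 0"
proof -
  have "\<forall>\<^sub>F s in nhds (chart_map c x). Q c i j s = 0"
    using ev_img [OF fol_adm [OF c(1)] c(2)] by eventually_elim (rule Q_transversal [OF c(1) _ ij])
  from fd_cong [OF this] show ?thesis by simp
qed

text \<open>The sum runs over all pairs of indices in either order, which avoids ordering the basis;
  each wedge is then counted twice, hence the factor 2.\<close>

lemma interior_bivec_pair:
  assumes G: "G \<in> alt_forms k L" and "X \<in> L" "Y \<in> L"
  shows "2 * G (Y # X # us) =
    (\<Sum>i\<in>set B1. \<Sum>j\<in>set B1. ((X \<bullet> i) * (Y \<bullet> j) - (Y \<bullet> i) * (X \<bullet> j)) * G (j # i # us))"
proof -
  have e: "G (Y # X # us) = (\<Sum>i\<in>set B1. \<Sum>j\<in>set B1. (X \<bullet> i) * (Y \<bullet> j) * G (j # i # us))" if "X \<in> L" "Y \<in> L" for X Y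
  proof -
    have "G (Y # X # us) = (\<Sum>i\<in>set B1. (X \<bullet> i) * G (Y # i # us))"
      using alt_forms_expand_slot [OF G subspace_L adapted that(1), of "[Y]" us] by simp
    also have "\<dots> = (\<Sum>i\<in>set B1. (X \<bullet> i) * (\<Sum>j\<in>set B1. (Y \<bullet> j) * G (j # i # us)))"
      using alt_forms_expand_slot [OF G subspace_L adapted that(2), of "[]"] by simp
    finally show ?thesis by (simp add: sum_distrib_left mult.assoc)
  qed
  have "2 * G (Y # X # us) = G (Y # X # us) - G (X # Y # us)"
    using alt_forms_swap_head [OF G subspace_L, of Y X us] by simp
  also have "\<dots> = (\<Sum>i\<in>set B1. \<Sum>j\<in>set B1. ((X \<bullet> i) * (Y \<bullet> j) - (Y \<bullet> i) * (X \<bullet> j)) * G (j # i # us))"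
    unfolding e [OF assms(2,3)] e [OF assms(3,2)] sum_subtractf [symmetric] by (simp add: left_diff_distrib)
  finally show ?thesis .
qed

text \<open>The right-hand side involves \<open>P\<close> only through its components, so all
  decompositions of \<open>P\<close> into leafwise wedges give the same value, and the description
  in \<open>fol_interior_bivec\<close> is resolved.\<close>

lemma fol_interior_bivec_eq:
  assumes \<tau>: "\<tau> \<in> fol_forms A \<V> k" and c: "c \<in> F" "y \<in> chart_dom c"
  shows "fol_interior_bivec A \<V> P \<tau> y ws =
    (\<Sum>i\<in>set B1. \<Sum>j\<in>set B1. Q c i j (chart_map c y) *
      form_in A c \<tau> (j # i # map (chart_diff A c y) ws) (chart_map c y)) / 2"
proof -
  note ac = fol_adm [OF c(1)]
  define t where "t = chart_map c y"
  define D where "D = chart_diff A c y"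
  define us where "us = map D ws"
  define G where "G = (\<lambda>us. form_in A c \<tau> us t)"
  note lD = linear_chart_diff [OF ac c(2)]
  have G: "G \<in> alt_forms k L"
    unfolding G_def t_def by (rule fol_formsD(2) [OF \<tau> c(1) map_in [OF ac c(2)]])
  have \<tau>G: "\<tau> y (Y # X # ws) = G (D Y # D X # us)" for X Y
    using ac c by (simp add: G_def t_def form_in_map us_def D_def o_def)
  have val: "(\<Sum>(X, Y)\<leftarrow>ps. \<tau> y (Y # X # ws)) = (\<Sum>i\<in>set B1. \<Sum>j\<in>set B1. Q c i j t * G (j # i # us)) / 2"
    if ps: "set ps \<subseteq> T y \<times> T y" "wedge_sum (P y) ps" for ps
  proof -
    have "2 * (\<Sum>(X, Y)\<leftarrow>ps. \<tau> y (Y # X # ws)) = (\<Sum>i\<in>set B1. \<Sum>j\<in>set B1.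
        (\<Sum>(X, Y)\<leftarrow>ps. (D X \<bullet> i) * (D Y \<bullet> j) - (D Y \<bullet> i) * (D X \<bullet> j)) * G (j # i # us))"
      using ps(1)
    proof (induction ps)
      case (Cons p ps)
      obtain X Y where p: "p = (X, Y)" by fastforce
      have "X \<in> T y" "Y \<in> T y" using Cons.prems p by auto
      then have "D X \<in> L" "D Y \<in> L" using tangent_iff [OF c] by (auto simp: D_def)
      from interior_bivec_pair [OF G this, of us] show ?case
        using Cons by (simp add: p \<tau>G distrib_left distrib_right sum.distrib)
    qed simp
    moreover have "Q c i j t = (\<Sum>(X, Y)\<leftarrow>ps. (D X \<bullet> i) * (D Y \<bullet> j) - (D Y \<bullet> i) * (D X \<bullet> j))" for i j
      using wedge_sumD [OF ps(2) linear_compose [OF lD linear_co] linear_compose [OF lD linear_co], of i j] ac c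
      by (simp add: bivec_in_map t_def D_def)
    ultimately show ?thesis by simp
  qed
  obtain ps where "set ps \<subseteq> T y \<times> T y" "wedge_sum (P y) ps"
    using leafwise [of y] by (auto simp: bivectors_def)
  then have "fol_interior_bivec A \<V> P \<tau> y ws = (\<Sum>i\<in>set B1. \<Sum>j\<in>set B1. Q c i j t * G (j # i # us)) / 2"
    unfolding fol_interior_bivec_def
  proof (intro the_equality exI [of _ ps] conjI)
    fix r assume "\<exists>ps. set ps \<subseteq> T y \<times> T y \<and> wedge_sum (P y) ps \<and> r = (\<Sum>(X, Y)\<leftarrow>ps. \<tau> y (Y # X # ws))"
    then show "r = (\<Sum>i\<in>set B1. \<Sum>j\<in>set B1. Q c i j t * G (j # i # us)) / 2" using val by auto
  qed (simp_all add: val)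
  then show ?thesis by (simp add: G_def t_def us_def D_def)
qed

text \<open>Within a foliated chart \<tau> is a varying coefficient times a constant form, so that
  only the coefficient has to be differentiated.\<close>

lemma leaf_form_ratio:
  assumes \<tau>: "\<tau> \<in> leaf_volume_forms A \<V>" and c: "c \<in> F" and s: "s \<in> chart_img c" and t: "t \<in> chart_img c"
  shows "form_in A c \<tau> B1 t * form_in A c \<tau> us s = form_in A c \<tau> B1 s * form_in A c \<tau> us t"
  using alt_forms_proportional [OF fol_formsD(2) [OF leaf_volume_formsD(1) [OF \<tau>] c t]
      fol_formsD(2) [OF leaf_volume_formsD(1) [OF \<tau>] c s] subspace_L, of "{}" us] adapted(2)
  by simp

text \<open>In a foliated chart with \<open>\<tau> = \<rho> D\<close>, \<open>D\<close> constant, \<open>d\<^sub>\<V> (i\<^sub>P \<tau>)\<close> is evaluated by means of the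
  identity expressing that the exterior product of a covector with a top-degree form vanishes.\<close>

lemma fol_d_interior_bivec:
  assumes \<tau>: "\<tau> \<in> leaf_volume_forms A \<V>" and vs: "set vs \<subseteq> T x"
  defines "c \<equiv> fol_chart x"
  defines "t \<equiv> chart_map c x"
  shows "fol_d A \<V> (fol_interior_bivec A \<V> P \<tau>) x vs =
    - (\<Sum>i\<in>set B1. (\<Sum>j\<in>set B1. fd (\<lambda>s. form_in A c \<tau> B1 s * Q c i j s) t j) / form_in A c \<tau> B1 t *
        form_in A c \<tau> (i # map (chart_diff A c x) vs) t)"
proof -
  have c: "c \<in> F" "x \<in> chart_dom c" using fol_chart by (auto simp: c_def)
  note ac = fol_adm [OF c(1)]
  have tin: "t \<in> chart_img c" unfolding t_def by (rule map_in [OF ac c(2)])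
  define us where "us = map (chart_diff A c x) vs"
  have usL: "set us \<subseteq> L" using vs tangent_iff [OF c] by (auto simp: us_def)
  define \<rho> where "\<rho> = form_in A c \<tau> B1"
  \<comment> \<open>The constant form of the chart, normalised to 1 on \<open>B1\<close>.\<close>
  define D where "D = (\<lambda>us. form_in A c \<tau> us t / \<rho> t)"
  define g where "g = (\<lambda>i j. fd (\<lambda>s. \<rho> s * Q c i j s) t)"
  note \<tau>f = leaf_volume_formsD(1) [OF \<tau>]
  have \<rho>: "\<rho> t \<noteq> 0" unfolding \<rho>_def t_def by (rule leaf_nonzero [OF \<tau> c])
  have D: "D \<in> alt_forms (length B1) L"
    using alt_forms_scale [OF fol_formsD(2) [OF \<tau>f c(1) tin], of "1 / \<rho> t"] by (simp add: D_def)
  have sQ: "smooth_at t (\<lambda>s. \<rho> s * Q c i j s)" for i j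
    unfolding t_def \<rho>_def by (intro smooth_at_mult fol_formsD(3) [OF \<tau>f c] smooth_bivec_in ac c linear_co)
  have lg: "linear (g i j)" for i j unfolding g_def by (rule smooth_at_linear_fd [OF sQ])
  have ganti: "g j i v = - g i j v" for i j v
  proof -
    have "\<forall>\<^sub>F s in nhds t. - (\<rho> s * Q c i j s) = \<rho> s * Q c j i s"
      using ev_img [OF ac c(2)] unfolding t_def
      by eventually_elim (simp add: bivec_in_antisym [OF ac, of _ _ i])
    from fd_eqI [OF has_derivative_cong_nhds [OF this has_derivative_minus [OF smooth_at_has_derivative [OF sQ]]]]
    show ?thesis by (simp add: g_def)
  qed
  have int: "fol_d A \<V> (fol_interior_bivec A \<V> P \<tau>) x vs =
      (\<Sum>m<length us. (-1) ^ m * fd (form_in A c (fol_interior_bivec A \<V> P \<tau>) (take m us @ drop (Suc m) us)) t (us ! m))"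
    using vs by (simp add: fol_d_def Let_def c_def fol_chart_def us_def t_def)
  have fdi: "fd (form_in A c (fol_interior_bivec A \<V> P \<tau>) ws) t h =
      (\<Sum>i\<in>set B1. \<Sum>j\<in>set B1. g i j h * D (j # i # ws)) / 2" for ws h
  proof -
    have ev: "\<forall>\<^sub>F s in nhds t. (\<Sum>i\<in>set B1. \<Sum>j\<in>set B1. D (j # i # ws) * (\<rho> s * Q c i j s)) / 2 =
        form_in A c (fol_interior_bivec A \<V> P \<tau>) ws s"
      using ev_img [OF ac c(2)] unfolding t_def
    proof eventually_elim
      case (elim s)
      have y: "chart_inv c s \<in> chart_dom c" by (rule inv_in [OF ac elim])
      have r: "form_in A c \<tau> us s = D us * \<rho> s" for us
        using leaf_form_ratio [OF \<tau> c(1) elim tin, of us] \<rho> by (simp add: D_def \<rho>_def field_simps)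
      have "form_in A c (fol_interior_bivec A \<V> P \<tau>) ws s =
          (\<Sum>i\<in>set B1. \<Sum>j\<in>set B1. Q c i j s * form_in A c \<tau> (j # i # ws) s) / 2"
        unfolding form_in_def [of A c "fol_interior_bivec A \<V> P \<tau>"]
        using fol_interior_bivec_eq [OF \<tau>f c(1) y] ac y elim by (simp add: o_def map_inv)
      then show ?case by (simp add: r ac_simps)
    qed
    have der: "((\<lambda>s. (\<Sum>i\<in>set B1. \<Sum>j\<in>set B1. D (j # i # ws) * (\<rho> s * Q c i j s)) / 2) has_derivative
        (\<lambda>h. (\<Sum>i\<in>set B1. \<Sum>j\<in>set B1. D (j # i # ws) * g i j h) / 2)) (at t)"
      unfolding g_def divide_inverse
      by (intro has_derivative_mult_left has_derivative_sum has_derivative_mult_right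
          smooth_at_has_derivative sQ)
    show ?thesis
      unfolding fd_eqI [OF has_derivative_cong_nhds [OF ev der]] by (simp only: mult.commute [of "D _"])
  qed
  \<comment> \<open>The vanishing alternating sum for the list \<open>j # i # us\<close>, with its
    first two terms moved to the other side.\<close>
  have wedge: "(\<Sum>m<length us. (-1) ^ m * (g i j (us ! m) * D (j # i # (take m us @ drop (Suc m) us)))) =
      g i j i * D (j # us) - g i j j * D (i # us)" if "i \<in> set B1" "j \<in> set B1" for i j
  proof -
    have "set (j # i # us) \<subseteq> L" using that usL adapted(2) span_superset [of "set B1"] by auto
    from top_form_wedge_functional_eq_0 [OF D subspace_L lg adapted(2) this, of i j]
    show ?thesis
      by (simp add: sum.lessThan_Suc_shift mult.assoc del: sum.lessThan_Suc)
  qed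
  have "fol_d A \<V> (fol_interior_bivec A \<V> P \<tau>) x vs =
      (\<Sum>m<length us. \<Sum>i\<in>set B1. \<Sum>j\<in>set B1. (-1) ^ m * (g i j (us ! m) * D (j # i # (take m us @ drop (Suc m) us))) / 2)"
    unfolding int fdi by (simp add: sum_distrib_left sum_divide_distrib)
  also have "\<dots> = (\<Sum>i\<in>set B1. \<Sum>m<length us. \<Sum>j\<in>set B1. (-1) ^ m * (g i j (us ! m) * D (j # i # (take m us @ drop (Suc m) us))) / 2)"
    by (rule sum.swap)
  also have "\<dots> = (\<Sum>i\<in>set B1. \<Sum>j\<in>set B1. \<Sum>m<length us. (-1) ^ m * (g i j (us ! m) * D (j # i # (take m us @ drop (Suc m) us))) / 2)"
    by (rule sum.cong [OF refl]) (rule sum.swap)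
  also have "\<dots> = (\<Sum>i\<in>set B1. \<Sum>j\<in>set B1. (g i j i * D (j # us) - g i j j * D (i # us)) / 2)"
    by (intro sum.cong refl) (simp only: sum_divide_distrib [symmetric] wedge)
  also have "\<dots> = (\<Sum>i\<in>set B1. \<Sum>j\<in>set B1. g i j i * D (j # us)) / 2 - (\<Sum>i\<in>set B1. \<Sum>j\<in>set B1. g i j j * D (i # us)) / 2"
    by (simp add: diff_divide_distrib sum_subtractf sum_divide_distrib)
  \<comment> \<open>Exchanging \<open>i\<close> and \<open>j\<close> and using antisymmetry makes
    the two halves equal, which removes the factor 1/2.\<close>
  also have "(\<Sum>i\<in>set B1. \<Sum>j\<in>set B1. g i j i * D (j # us)) = - (\<Sum>i\<in>set B1. \<Sum>j\<in>set B1. g i j j * D (i # us))"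
  proof -
    have "(\<Sum>i\<in>set B1. \<Sum>j\<in>set B1. g i j i * D (j # us)) = (\<Sum>j\<in>set B1. \<Sum>i\<in>set B1. g i j i * D (j # us))"
      by (rule sum.swap)
    also have "\<dots> = (\<Sum>j\<in>set B1. \<Sum>i\<in>set B1. - (g j i i * D (j # us)))"
    proof (intro sum.cong refl)
      fix i j
      show "g i j i * D (j # us) = - (g j i i * D (j # us))" using ganti [of j i i] by simp
    qed
    finally show ?thesis by (simp add: sum_negf)
  qed
  finally have "fol_d A \<V> (fol_interior_bivec A \<V> P \<tau>) x vs = - (\<Sum>i\<in>set B1. (\<Sum>j\<in>set B1. g i j j) * D (i # us))"
    by (simp add: sum_distrib_right)
  then show ?thesis by (simp add: g_def D_def \<rho>_def us_def)
qed

section \<open>The foliated modular field as a sum of two global fields\<close>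

lemma vector_fields_add:
  assumes "X \<in> vector_fields A" "Y \<in> vector_fields A"
  shows "(\<lambda>x. X x + Y x) \<in> vector_fields A"
proof -
  have "smooth_vec_at x (\<lambda>x. X x + Y x)" for x
  proof -
    define c where "c = base_chart A x"
    have c: "adm c" "x \<in> chart_dom c" using base_chart by (auto simp: c_def)
    have "\<forall>\<^sub>F s in nhds (chart_map c x). vec_in A c X s + vec_in A c Y s = vec_in A c (\<lambda>x. X x + Y x) s"
      unfolding vec_in_def
      by (rule ev_chart [OF c], use ev_dom [OF c] in eventually_elim)
        (simp add: linear_add [OF linear_chart_diff [OF c(1)]])
    moreover have "smooth_at (chart_map c x) (\<lambda>s. vec_in A c X s + vec_in A c Y s)"
      using assms smooth_vec_at_iff [OF c] by (intro smooth_at_add) (auto simp: vector_fields_iff)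
    ultimately show ?thesis unfolding smooth_vec_at_iff [OF c] by (rule smooth_at_cong)
  qed
  then show ?thesis by (simp add: vector_fields_iff)
qed

text \<open>The relation of the theorem, solved for the foliated modular field, serves as the
  candidate for it. Smoothness is inherited from the two summands;
  \<open>fol_modular_field_eq\<close> shows that \<sigma> does not influence the result.\<close>

definition leaf_field :: "('a \<Rightarrow> 'e list \<Rightarrow> real) \<Rightarrow> ('a \<Rightarrow> 'e list \<Rightarrow> real) \<Rightarrow> 'a \<Rightarrow> 'e" where
  "leaf_field \<tau> \<sigma> x = modular_field A P (product_volume \<tau> \<sigma>) x + fol_sharp A \<V> P (reeb_form A \<V> \<sigma>) x"

context
  fixes \<tau> \<sigma>
  assumes \<tau>: "\<tau> \<in> leaf_volume_forms A \<V>" and \<sigma>: "\<sigma> \<in> transversal_volumes A \<V>"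
begin

lemma leaf_field_chart:
  assumes c: "c \<in> F" "x \<in> chart_dom c"
  defines "t \<equiv> chart_map c x"
  shows "chart_diff A c x (leaf_field \<tau> \<sigma> x) = (\<Sum>i\<in>set B1.
    ((\<Sum>j\<in>set B1. fd (\<lambda>s. form_in A c \<tau> B1 s * Q c i j s) t j) / form_in A c \<tau> B1 t) *\<^sub>R i)"
proof -
  note ac = fol_adm [OF c(1)]
  let ?B = "B1 @ B2"
  have tin: "t \<in> chart_img c" unfolding t_def by (rule map_in [OF ac c(2)])
  define \<rho> where "\<rho> = form_in A c \<tau> B1"
  define s0 where "s0 = form_in A c \<sigma> B2"
  define w where "w = form_in A c (product_volume \<tau> \<sigma>) ?B"
  have \<rho>: "smooth_at t \<rho>" "\<rho> t \<noteq> 0"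
    unfolding t_def \<rho>_def by (rule fol_formsD(3) [OF leaf_volume_formsD(1) [OF \<tau>] c]) (rule leaf_nonzero [OF \<tau> c])
  have s0: "smooth_at t s0" "s0 t \<noteq> 0"
    unfolding t_def s0_def
    by (rule formsD(2) [OF transversal_volumesD(1) [OF \<sigma>] ac c(2)]) (rule transversal_nonzero [OF \<sigma> c])
  have Q: "smooth_at t (Q c i j)" for i j unfolding t_def by (intro smooth_bivec_in ac c linear_co)
  have w_eq: "w s = \<rho> s * s0 s" if "s \<in> chart_img c" for s
    using product_volume_chart [OF \<tau> \<sigma> c(1) inv_in [OF ac that], of ?B] map_inv [OF ac that] std_form(2)
    by (simp add: w_def \<rho>_def s0_def)
  have "\<forall>\<^sub>F s in nhds t. \<rho> s * s0 s = w s"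
    using ev_img [OF ac c(2)] unfolding t_def by eventually_elim (simp add: w_eq)
  \<comment> \<open>The logarithmic derivative turns the product of the densities into a sum; the
    part belonging to \<sigma> is cancelled by fact \<open>r\<close>.\<close>
  from fd_eqI [OF has_derivative_cong_nhds [OF this has_derivative_mult [OF smooth_at_has_derivative [OF \<rho>(1)] smooth_at_has_derivative [OF s0(1)]]]]
  have fdw: "fd w t v / w t = fd \<rho> t v / \<rho> t + fd s0 t v / s0 t" for v
    using \<rho>(2) s0(2) w_eq [OF tin] by (simp add: field_simps)
  have fdQ: "fd (\<lambda>s. \<rho> s * Q c i j s) t v / \<rho> t = fd \<rho> t v / \<rho> t * Q c i j t + fd (Q c i j) t v" for i j v
    using fd_eqI [OF has_derivative_mult [OF smooth_at_has_derivative [OF \<rho>(1)] smooth_at_has_derivative [OF Q]]] \<rho>(2)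
    by (simp add: field_simps)
  have m: "chart_diff A c x (modular_field A P (product_volume \<tau> \<sigma>) x) =
      (\<Sum>i\<in>set ?B. (\<Sum>j\<in>set ?B. fd w t j / w t * Q c i j t + fd (Q c i j) t j) *\<^sub>R i)"
    using modular_field_chart [OF product_volume [OF \<tau> \<sigma>] adapted(1) ac c(2)]
    by (simp add: modular_chart_def w_def t_def)
  have "linear (\<lambda>v. inverse (s0 t) *\<^sub>R fd s0 t v)"
    by (rule linear_compose_scale_right [OF smooth_at_linear_fd [OF s0(1)]])
  then have la: "linear (\<lambda>v. fd s0 t v / s0 t)" by (simp add: divide_inverse mult.commute)
  have rc: "reeb_covector \<sigma> c x = (\<lambda>v. fd s0 t v / s0 t) \<circ> chart_diff A c x"
    by (auto simp: reeb_covector_def s0_def t_def)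
  have r: "chart_diff A c x (fol_sharp A \<V> P (reeb_form A \<V> \<sigma>) x) =
      (\<Sum>i\<in>set ?B. (\<Sum>j\<in>set ?B. - (fd s0 t j / s0 t * Q c i j t)) *\<^sub>R i)"
    unfolding fol_sharp_reeb [OF \<sigma> c] rc sharp_chart_diff [OF la ac c(2) adapted(1)]
  proof (intro sum.cong refl arg_cong2 [of _ _ _ _ scaleR])
    fix i j
    show "fd s0 t j / s0 t * Q c j i (chart_map c x) = - (fd s0 t j / s0 t * Q c i j t)"
      using bivec_in_antisym [OF ac tin, of j i] by (simp add: t_def)
  qed
  have "chart_diff A c x (leaf_field \<tau> \<sigma> x) =
      (\<Sum>i\<in>set ?B. (\<Sum>j\<in>set ?B. fd w t j / w t * Q c i j t + fd (Q c i j) t j + - (fd s0 t j / s0 t * Q c i j t)) *\<^sub>R i)"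
    unfolding leaf_field_def linear_add [OF linear_chart_diff [OF ac c(2)]] m r
    by (simp only: sum.distrib [symmetric] scaleR_add_left [symmetric])
  also have "\<dots> = (\<Sum>i\<in>set ?B. (\<Sum>j\<in>set ?B. fd (\<lambda>s. \<rho> s * Q c i j s) t j / \<rho> t) *\<^sub>R i)"
    by (intro sum.cong refl arg_cong2 [of _ _ _ _ scaleR]) (simp add: fdw fdQ distrib_right)
  \<comment> \<open>Components of \<open>P\<close> with an index in \<open>B2\<close> vanish
    together with their derivatives. This is used for \<open>j\<close> and then for
    \<open>i\<close>, where it makes the field tangent to the leaves.\<close>
  also have "\<dots> = (\<Sum>i\<in>set ?B. (\<Sum>j\<in>set B1. fd (\<lambda>s. \<rho> s * Q c i j s) t j / \<rho> t) *\<^sub>R i)"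
  proof (rule sum.cong [OF refl], rule arg_cong2 [OF _ refl, of _ _ scaleR],
      rule sum.mono_neutral_right, goal_cases)
    case (3 i)
    show ?case
    proof
    fix j assume "j \<in> set ?B - set B1"
    then have "j \<in> set B2" by auto
    then show "fd (\<lambda>s. \<rho> s * Q c i j s) t j / \<rho> t = 0"
      unfolding fdQ using Q_transversal [OF c(1) tin] fd_Q_transversal [OF c, folded t_def] by simp
    qed
  qed auto
  also have "\<dots> = (\<Sum>i\<in>set B1. (\<Sum>j\<in>set B1. fd (\<lambda>s. \<rho> s * Q c i j s) t j / \<rho> t) *\<^sub>R i)"
  proof (intro sum.mono_neutral_right ballI)
    fix i assume "i \<in> set ?B - set B1"
    then have "i \<in> set B2" by auto
    then show "(\<Sum>j\<in>set B1. fd (\<lambda>s. \<rho> s * Q c i j s) t j / \<rho> t) *\<^sub>R i = 0"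
      unfolding fdQ using Q_transversal [OF c(1) tin] fd_Q_transversal [OF c, folded t_def] by simp
  qed auto
  finally show ?thesis by (simp add: \<rho>_def sum_divide_distrib)
qed

lemma leaf_field_tangent: "leaf_field \<tau> \<sigma> \<in> tangent_fields A \<V>"
proof -
  have "fol_sharp A \<V> P (reeb_form A \<V> \<sigma>) \<in> vector_fields A"
    using fol_sharp_reeb_Poiss [OF \<sigma>] by (simp add: Poiss_def)
  then have "leaf_field \<tau> \<sigma> \<in> vector_fields A"
    unfolding leaf_field_def [abs_def] by (intro vector_fields_add modular_field_smooth product_volume \<tau> \<sigma>)
  moreover have "leaf_field \<tau> \<sigma> x \<in> T x" for x
  proof -
    have "set B1 \<subseteq> L" using adapted(2) span_superset [of "set B1"] by auto
    then show ?thesis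
      unfolding tangent_iff [OF fol_chart] leaf_field_chart [OF fol_chart]
      by (intro subspace_sum subspace_scale subspace_L) auto
  qed
  ultimately show ?thesis by (simp add: tangent_fields_def)
qed

lemma leaf_field_interior:
  "interior_prod (leaf_field \<tau> \<sigma>) \<tau> = - fol_d A \<V> (fol_interior_bivec A \<V> P \<tau>)"
proof (intro ext)
  fix x vs
  note \<tau>f = leaf_volume_formsD(1) [OF \<tau>]
  show "interior_prod (leaf_field \<tau> \<sigma>) \<tau> x vs = (- fol_d A \<V> (fol_interior_bivec A \<V> P \<tau>)) x vs"
  proof (cases "set vs \<subseteq> T x")
    case True
    define c where "c = fol_chart x"
    define t where "t = chart_map c x"
    have c: "c \<in> F" "x \<in> chart_dom c" using fol_chart by (auto simp: c_def)
    note ac = fol_adm [OF c(1)]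
    have tin: "t \<in> chart_img c" unfolding t_def by (rule map_in [OF ac c(2)])
    define z where "z = (\<lambda>i. (\<Sum>j\<in>set B1. fd (\<lambda>s. form_in A c \<tau> B1 s * Q c i j s) t j) / form_in A c \<tau> B1 t)"
    define Z where "Z = chart_diff A c x (leaf_field \<tau> \<sigma> x)"
    have Z: "Z = (\<Sum>i\<in>set B1. z i *\<^sub>R i)" unfolding Z_def z_def t_def by (rule leaf_field_chart [OF c])
    have "leaf_field \<tau> \<sigma> x \<in> T x" using leaf_field_tangent by (simp add: tangent_fields_def)
    then have ZL: "Z \<in> L" using tangent_iff [OF c] by (simp add: Z_def)
    \<comment> \<open>\<open>z\<close> is extended by zero to \<open>B2\<close>, since
      \<open>onb_inner_sum\<close> speaks of a full basis.\<close>
    have Zi: "Z \<bullet> i = z i" if i: "i \<in> set B1" for i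
    proof -
      have "(\<Sum>b\<in>set (B1 @ B2). (if b \<in> set B1 then z b else 0) *\<^sub>R b) = (\<Sum>b\<in>set B1. z b *\<^sub>R b)"
        by (rule sum.mono_neutral_cong_right) auto
      then show ?thesis
        using onb_inner_sum [OF adapted(1), of i "\<lambda>b. if b \<in> set B1 then z b else 0"] i Z by simp
    qed
    have "interior_prod (leaf_field \<tau> \<sigma>) \<tau> x vs = form_in A c \<tau> (Z # map (chart_diff A c x) vs) t"
      using ac c by (simp add: interior_prod_def form_in_map t_def Z_def o_def)
    also have "\<dots> = (\<Sum>i\<in>set B1. z i * form_in A c \<tau> (i # map (chart_diff A c x) vs) t)"
      using alt_forms_expand_slot [OF fol_formsD(2) [OF \<tau>f c(1) tin] subspace_L adapted ZL, of "[]"] Zi by simp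
    also have "\<dots> = - fol_d A \<V> (fol_interior_bivec A \<V> P \<tau>) x vs"
      using fol_d_interior_bivec [OF \<tau> True] by (simp add: z_def t_def c_def)
    finally show ?thesis by simp
  next
    case False
    \<comment> \<open>Both sides are extended by zero to lists that leave the tangent space of the
      leaf.\<close>
    then have "\<tau> x (leaf_field \<tau> \<sigma> x # vs) = 0" by (intro alt_forms_outside [OF fol_formsD(1) [OF \<tau>f]]) auto
    then show ?thesis using False by (simp add: interior_prod_def fol_d_def)
  qed
qed

text \<open>Replacing a vector \<open>b\<close> of \<open>B1\<close> by the components
  \<open>V\<close> of \<open>v\<close> gives the coordinate of \<open>V\<close> along
  \<open>b\<close> times the nonzero value of \<tau> on \<open>B1\<close>. A tangent vector is thus
  determined by its interior product with \<tau>, which makes the foliated modular field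
  unique.\<close>

lemma leaf_volume_kernel:
  assumes v: "v \<in> T x" and 0: "\<And>vs. \<tau> x (v # vs) = 0"
  shows "v = 0"
proof -
  define c where "c = fol_chart x"
  define t where "t = chart_map c x"
  have c: "c \<in> F" "x \<in> chart_dom c" using fol_chart by (auto simp: c_def)
  note ac = fol_adm [OF c(1)]
  define G where "G = (\<lambda>us. form_in A c \<tau> us t)"
  define V where "V = chart_diff A c x v"
  have G: "G \<in> alt_forms (length B1) L"
    unfolding G_def t_def by (rule fol_formsD(2) [OF leaf_volume_formsD(1) [OF \<tau>] c(1) map_in [OF ac c(2)]])
  have VL: "V \<in> L" using v tangent_iff [OF c] by (simp add: V_def)
  have B1L: "set B1 \<subseteq> L" using adapted(2) span_superset [of "set B1"] by auto
  have G0: "G (V # us) = 0" for us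
    using 0 [of "map (chart_frame A c x) us"] ac c by (simp add: G_def t_def form_in_map V_def)
  have "V \<bullet> b = 0" if b: "b \<in> set B1" for b
  proof -
    obtain pre post where B: "B1 = pre @ b # post" using b split_list by metis
    have "G (pre @ V # post) = (-1) ^ length pre * G (V # pre @ post)"
      using alt_forms_move [OF G subspace_L, of "[]" V pre post] VL B1L B by auto
    then have "0 = (\<Sum>i\<in>set B1. (V \<bullet> i) * G (pre @ i # post))"
      using G0 alt_forms_expand_slot [OF G subspace_L adapted VL, of pre post] by simp
    also have "\<dots> = (\<Sum>i\<in>{b}. (V \<bullet> i) * G (pre @ i # post))"
    proof (rule sum.mono_neutral_right)
      show "\<forall>i\<in>set B1 - {b}. (V \<bullet> i) * G (pre @ i # post) = 0"
      proof
        fix i assume "i \<in> set B1 - {b}"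
        then have "\<not> distinct (pre @ i # post)" using B by auto
        then have "G (pre @ i # post) = 0" using alt_forms_repeat [OF G] by (metis distinct_conv_nth)
        then show "(V \<bullet> i) * G (pre @ i # post) = 0" by simp
      qed
    qed (use b in auto)
    finally show ?thesis
      using leaf_nonzero [OF \<tau> c] B by (simp add: G_def t_def)
  qed
  then have "V = 0" using adapted_representation [OF adapted VL] by simp
  then have "chart_frame A c x V = 0" using linear_0 [OF linear_chart_frame [OF ac c(2)]] by simp
  then show ?thesis using ac c by (simp add: V_def)
qed

lemma fol_modular_field_eq: "fol_modular_field A \<V> P \<tau> = leaf_field \<tau> \<sigma>"
  unfolding fol_modular_field_def
proof (rule the_equality)
  fix Z assume Z: "Z \<in> tangent_fields A \<V> \<and> interior_prod Z \<tau> = - fol_d A \<V> (fol_interior_bivec A \<V> P \<tau>)"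
  show "Z = leaf_field \<tau> \<sigma>"
  proof
    fix x
    have t: "Z x \<in> T x" "leaf_field \<tau> \<sigma> x \<in> T x" using Z leaf_field_tangent by (auto simp: tangent_fields_def)
    have "\<tau> x ((Z x - leaf_field \<tau> \<sigma> x) # vs) = 0" for vs
    proof -
      have eq: "\<tau> x (Z x # vs) = \<tau> x (leaf_field \<tau> \<sigma> x # vs)"
        using Z leaf_field_interior by (metis interior_prod_def)
      show ?thesis
      proof (cases "Suc (length vs) = length B1 \<and> set vs \<subseteq> T x")
        case True
        \<comment> \<open>The leaf dimension is positive here, so slot 0 exists and linearity
          applies to it.\<close>
        then have "B1 \<noteq> []" by auto
        with True show ?thesis
          using alt_forms_linear [OF fol_formsD(1) [OF leaf_volume_formsD(1) [OF \<tau>]], of "Z x # vs" x 0 "Z x" "leaf_field \<tau> \<sigma> x" 1 "-1"] t eq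
          by simp
      next
        case False
        then show ?thesis by (intro alt_forms_outside [OF fol_formsD(1) [OF leaf_volume_formsD(1) [OF \<tau>]]]) auto
      qed
    qed
    from leaf_volume_kernel [OF subspace_diff [OF subspace_T t] this] show "Z x = leaf_field \<tau> \<sigma> x" by simp
  qed
qed (use leaf_field_tangent leaf_field_interior in blast)

end

section \<open>From the relation between the fields to the relation between the classes\<close>

lemma modular_class_relation:
  assumes \<tau>: "\<tau> \<in> leaf_volume_forms A \<V>" and \<sigma>: "\<sigma> \<in> transversal_volumes A \<V>"
  shows "modular_class A P = fol_modular_class A \<V> P \<otimes>\<^bsub>H1_poisson A P\<^esub>
    inv\<^bsub>H1_poisson A P\<^esub> (sharp_map A \<V> P (reeb_class A \<V>))"
proof -
  define R where "R = fol_sharp A \<V> P (reeb_form A \<V> \<sigma>)"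
  define M where "M = (\<lambda>\<tau>. modular_field A P (product_volume \<tau> \<sigma>))"
  have fm: "fol_modular_field A \<V> P \<tau>' = M \<tau>' + R" if "\<tau>' \<in> leaf_volume_forms A \<V>" for \<tau>'
    unfolding fol_modular_field_eq [OF that \<sigma>] by (intro ext) (simp add: leaf_field_def M_def R_def)
  \<comment> \<open>\<sigma> is kept fixed, so \<open>R\<close> drops out of the difference of the
    two fields and only a change of the volume form remains.\<close>
  have cls: "poisson_class A P (fol_modular_field A \<V> P \<tau>') = poisson_class A P (M \<tau> + R)"
    if \<tau>': "\<tau>' \<in> leaf_volume_forms A \<V>" for \<tau>'
  proof (rule poisson_class_cong)
    show "fol_modular_field A \<V> P \<tau>' - (M \<tau> + R) \<in> Ham A P"
      using modular_field_indep [OF product_volume [OF \<tau>' \<sigma>] product_volume [OF \<tau> \<sigma>]] fm [OF \<tau>'] by (simp add: M_def)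
  qed
  have "(\<lambda>\<tau>. poisson_class A P (fol_modular_field A \<V> P \<tau>)) ` leaf_volume_forms A \<V> =
      (\<lambda>_. poisson_class A P (M \<tau> + R)) ` leaf_volume_forms A \<V>"
    by (rule image_cong [OF refl cls])
  then have fc: "fol_modular_class A \<V> P = poisson_class A P (M \<tau> + R)"
    unfolding fol_modular_class_def by (simp only: image_constant [OF \<tau>] the_elem_eq)
  have "fol_modular_class A \<V> P \<otimes>\<^bsub>H1_poisson A P\<^esub> inv\<^bsub>H1_poisson A P\<^esub> (sharp_map A \<V> P (reeb_class A \<V>)) =
      poisson_class A P (M \<tau> + R - R)"
    unfolding fc sharp_map_reeb_class [OF \<sigma>] R_def by (rule H1_poisson_diff [OF fol_sharp_reeb_Poiss [OF \<sigma>]])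
  then show ?thesis using modular_class_eq [OF product_volume [OF \<tau> \<sigma>]] by (simp add: M_def)
qed

end

theorem proposition3p1:
  fixes A :: "('a::{t2_space, second_countable_topology}, 'e::euclidean_space) chart set"
    and \<V> :: "('a, 'e) foliation"
    and P :: "'a \<Rightarrow> ('e \<Rightarrow> real) \<Rightarrow> ('e \<Rightarrow> real) \<Rightarrow> real"
  assumes "poisson_foliation A \<V> P"
    and "fol_orientable A \<V>"
    and "transversally_orientable A \<V>"
  shows "modular_class A P =
    fol_modular_class A \<V> P \<otimes>\<^bsub>H1_poisson A P\<^esub>
      inv\<^bsub>H1_poisson A P\<^esub> (sharp_map A \<V> P (reeb_class A \<V>))"
proof -
  have "subspace (leaf_dir \<V>)" using assms(1) by (simp add: poisson_foliation_def regular_foliation_def)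
  then obtain B1 B2 where B: "onb (B1 @ B2)" "span (set B1) = leaf_dir \<V>" "length B1 = dim (leaf_dir \<V>)"
    "length B2 = DIM('e) - dim (leaf_dir \<V>)"
    by (rule exists_adapted_onb)
  interpret poisson_fol A P \<V> B1 B2
    using assms(1) B by unfold_locales (auto simp: poisson_foliation_def)
  obtain \<tau> \<sigma> where "\<tau> \<in> leaf_volume_forms A \<V>" "\<sigma> \<in> transversal_volumes A \<V>"
    using assms(2,3) by (auto simp: fol_orientable_def transversally_orientable_def)
  then show ?thesis by (rule modular_class_relation)
qed

end
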